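(* Let $G\leq \mathrm{Aut}(X^* )$ be finitely generated, just infinite, and strongly self-replicating, and suppose $G$ has well-approximated subgroups. Let $Y$ be a spanning leaf set and $H\leq G$ be such that $\mathrm{st}_H(Y)$ is an infra-direct product of $G^Y$. Then $\mathrm{rk_{CB}}(H)=\mathrm{depth}(H)$; in particular $\mathrm{rk_{CB}}(H)<\omega$.
   Context: Let $X$ be a finite set and $X^*$ the free monoid on $X$, identified with the rooted tree in which the children of $w$ are the words $wx$. $X^n$ is the set of words of length $n$; $\mathrm{Aut}(X^* )$ the group of prefix-preserving bijections of $X^*$. For $g\in\mathrm{Aut}(X^* )$, $u\in X^*$ the section $g_u$ is defined by $g(uw)=g(u)g_u(w)$; $\psi_u(g)=g_u$, $\psi_u(S)=\{g_u:g\in S\}$. For $G\le\mathrm{Aut}(X^* )$: $\mathrm{st}_G(x)$ vertex stabilizer, $\mathrm{st}_G(Y)=\bigcap_{y\in Y}\mathrm{st}_G(y)$, $\mathrm{st}_G(n)=\mathrm{st}_G(X^n)$. A leaf set is a finite $Y\subseteq X^*$ no element of which is a prefix of another; spanning if there is $N$ such that every word of length $\ge N$ has a prefix in $Y$. $G^Y$ is the group of automorphisms acting as an element of $G$ below each $y\in Y$ and trivially elsewhere. $\mathrm{st}_H(Y)$ is an infra-direct product of $G^Y$ if $\psi_y(\mathrm{st}_H(Y))$ is a finite index subgroup of $G$ for every $y\in Y$. $G$ is self-similar if $g_x\in G$ for all $g,x$; strongly self-replicating if self-similar and $\psi_x(\mathrm{st}_G(n))=G$ for all $n\ge1$, $x\in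 X^n$. Just infinite: infinite with every proper quotient finite. Well-approximated subgroups: $\bigcap_{n\ge0}H\,\mathrm{st}_G(n)=H$ for every finitely generated $H\le G$. $\mathrm{Sub}(G)$: space of subgroups with topology induced from $\{0,1\}^G$. Cantor--Bendixson derivatives $Z^0=Z$, $Z^{\alpha+1}=$ non-isolated points of $Z^\alpha$, intersections at limits; $\mathrm{rk_{CB}}(H)=\alpha$ where $H\in Z^\alpha\setminus Z^{\alpha+1}$ for $Z=\mathrm{Sub}(G)$. $\mathrm{depth}(H)$ is the supremum of $n$ with a chain $G=H_0>\dots>H_n=H$ with $|H_i:H_{i+1}|=\infty$ for all $i$. *)

theory Defs
  imports "HOL-Analysis.Analysis" "HOL-Algebra.Algebra" "HOL-Library.Sublist" "HOL-Library.Extended_Nat"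
begin

type_synonym 'a tfun = "'a list \<Rightarrow> 'a list"

definition tree_aut :: "'a set \<Rightarrow> 'a tfun set" where
  "tree_aut A = {g. bij_betw g (lists A) (lists A)
      \<and> (\<forall>u\<in>lists A. \<forall>v\<in>lists A. prefix u v \<longleftrightarrow> prefix (g u) (g v))
      \<and> (\<forall>w. w \<notin> lists A \<longrightarrow> g w = w)}"

definition aut_group :: "'a set \<Rightarrow> 'a tfun monoid" where
  "aut_group A = \<lparr>carrier = tree_aut A, mult = (\<circ>), one = id\<rparr>"

definition sub_grp :: "'a set \<Rightarrow> 'a tfun set \<Rightarrow> 'a tfun monoid" where
  "sub_grp A G = (aut_group A)\<lparr>carrier := G\<rparr>"

definition is_subgroup_of_aut :: "'a set \<Rightarrow> 'a tfun set \<Rightarrow> bool" where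
  "is_subgroup_of_aut A G \<longleftrightarrow> subgroup G (aut_group A)"

text \<open>Section g_u: g(uw) = g(u) g_u(w).\<close>
definition tsection :: "'a set \<Rightarrow> 'a tfun \<Rightarrow> 'a list \<Rightarrow> 'a tfun" where
  "tsection A g u = (\<lambda>w. if w \<in> lists A then drop (length u) (g (u @ w)) else w)"

definition words_len :: "'a set \<Rightarrow> nat \<Rightarrow> 'a list set" where
  "words_len A n = {w \<in> lists A. length w = n}"

definition stab_set :: "'a tfun set \<Rightarrow> 'a list set \<Rightarrow> 'a tfun set" where
  "stab_set G Y = {g \<in> G. \<forall>y\<in>Y. g y = y}"

definition level_stab :: "'a set \<Rightarrow> 'a tfun set \<Rightarrow> nat \<Rightarrow> 'a tfun set" where
  "level_stab A G n = stab_set G (words_len A n)"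

definition self_similar :: "'a set \<Rightarrow> 'a tfun set \<Rightarrow> bool" where
  "self_similar A G \<longleftrightarrow> (\<forall>g\<in>G. \<forall>x\<in>A. tsection A g [x] \<in> G)"

definition strongly_self_replicating :: "'a set \<Rightarrow> 'a tfun set \<Rightarrow> bool" where
  "strongly_self_replicating A G \<longleftrightarrow> self_similar A G \<and>
     (\<forall>n\<ge>1. \<forall>x\<in>words_len A n. (\<lambda>g. tsection A g x) ` level_stab A G n = G)"

definition fin_gen :: "'a set \<Rightarrow> 'a tfun set \<Rightarrow> 'a tfun set \<Rightarrow> bool" where
  "fin_gen A G H \<longleftrightarrow> (\<exists>S. finite S \<and> S \<subseteq> H \<and> generate (sub_grp A G) S = H)"

definition just_infinite :: "'a set \<Rightarrow> 'a tfun set \<Rightarrow> bool" where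
  "just_infinite A G \<longleftrightarrow> infinite G \<and>
     (\<forall>N. N \<lhd> sub_grp A G \<and> N \<noteq> {id} \<longrightarrow> finite (rcosets\<^bsub>sub_grp A G\<^esub> N))"

definition well_approximated :: "'a set \<Rightarrow> 'a tfun set \<Rightarrow> bool" where
  "well_approximated A G \<longleftrightarrow> (\<forall>H. subgroup H (sub_grp A G) \<and> fin_gen A G H \<longrightarrow>
      (\<Inter>n. H <#>\<^bsub>sub_grp A G\<^esub> level_stab A G n) = H)"

definition leaf_set :: "'a set \<Rightarrow> 'a list set \<Rightarrow> bool" where
  "leaf_set A Y \<longleftrightarrow> finite Y \<and> Y \<subseteq> lists A \<and>
     (\<forall>y\<in>Y. \<forall>y'\<in>Y. y \<noteq> y' \<longrightarrow> \<not> prefix y y')"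

definition spanning :: "'a set \<Rightarrow> 'a list set \<Rightarrow> bool" where
  "spanning A Y \<longleftrightarrow> (\<exists>N. \<forall>w\<in>lists A. length w \<ge> N \<longrightarrow> (\<exists>y\<in>Y. prefix y w))"

definition finite_index_subgroup :: "'a set \<Rightarrow> 'a tfun set \<Rightarrow> 'a tfun set \<Rightarrow> bool" where
  "finite_index_subgroup A G K \<longleftrightarrow> subgroup K (sub_grp A G) \<and> finite (rcosets\<^bsub>sub_grp A G\<^esub> K)"

definition infra_direct :: "'a set \<Rightarrow> 'a tfun set \<Rightarrow> 'a tfun set \<Rightarrow> 'a list set \<Rightarrow> bool" where
  "infra_direct A G H Y \<longleftrightarrow>
     (\<forall>y\<in>Y. finite_index_subgroup A G ((\<lambda>g. tsection A g y) ` stab_set H Y))"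

text \<open>Sub(G) with the topology induced from {0,1}^G: a subgroup K is encoded by its
  indicator function on G.\<close>
definition sub_code :: "'a tfun set \<Rightarrow> 'a tfun set \<Rightarrow> ('a tfun \<Rightarrow> bool)" where
  "sub_code G K = restrict (\<lambda>g. g \<in> K) G"

definition sub_top :: "'a tfun set \<Rightarrow> ('a tfun \<Rightarrow> bool) topology" where
  "sub_top G = product_topology (\<lambda>_. discrete_topology (UNIV :: bool set)) G"

definition Sub_space :: "'a set \<Rightarrow> 'a tfun set \<Rightarrow> ('a tfun \<Rightarrow> bool) set" where
  "Sub_space A G = sub_code G ` {K. subgroup K (sub_grp A G)}"

primrec cb_deriv :: "'a set \<Rightarrow> 'a tfun set \<Rightarrow> nat \<Rightarrow> ('a tfun \<Rightarrow> bool) set" where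
  "cb_deriv A G 0 = Sub_space A G"
| "cb_deriv A G (Suc n) = cb_deriv A G n \<inter> (sub_top G derived_set_of cb_deriv A G n)"

definition infinite_index :: "'a set \<Rightarrow> 'a tfun set \<Rightarrow> 'a tfun set \<Rightarrow> bool" where
  "infinite_index A L K \<longleftrightarrow> infinite (rcosets\<^bsub>sub_grp A L\<^esub> K)"

definition depth :: "'a set \<Rightarrow> 'a tfun set \<Rightarrow> 'a tfun set \<Rightarrow> enat" where
  "depth A G H = Sup {enat n | n. \<exists>c :: nat \<Rightarrow> 'a tfun set.
      c 0 = G \<and> c n = H \<and> (\<forall>i\<le>n. subgroup (c i) (sub_grp A G)) \<and>
      (\<forall>i<n. c (Suc i) \<subset> c i \<and> infinite_index A (c i) (c (Suc i)))}"

end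

theory Submission
  imports Defs
begin

text \<open>
  Let \<open>G\<close> be just infinite and finitely generated. Well-approximation makes \<open>G\<close> a torsion group,
  and therefore no nontrivial element of \<open>G\<close> has a centralizer of finite index, and a normal
  subgroup \<open>P\<close> of finite index in \<open>G\<close> contains no nontrivial abelian subgroup that is normal in \<open>P\<close>.
  For a subgroup \<open>W\<close> of \<open>P\<close> normal in \<open>P\<close>, it follows that \<open>W\<close> and its centralizer \<open>C\<close> in \<open>P\<close> generate their direct product,
  and that this product has finite index in \<open>G\<close>. So \<open>W\<close> is finitely generated, an overgroup of \<open>W\<close>
  normalized by \<open>P\<close> that meets \<open>C\<close> trivially contains \<open>W\<close> with finite index, and every increase of
  infinite index adds a member to a family of pairwise commuting subgroups normal in \<open>P\<close>; such a
  family has at most \<open>|G : P|\<close> members.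

  For \<open>H\<close> as in the theorem, filter the stabilizer of \<open>Y\<close> by the subgroups of elements whose
  sections vanish outside a subset of \<open>Y\<close>. The successive quotients embed into \<open>G\<close> as subgroups
  normalized by a finite index subgroup, so the facts above show that \<open>H\<close> is
  finitely generated, that chains of infinite index from \<open>G\<close> to \<open>H\<close> have bounded length, and that
  \<open>H\<close> has finite index in its commensurator, whence \<open>H\<close> has only finitely many overgroups in which
  its index is finite.

  Neighbourhoods of the finitely generated \<open>H\<close> may be taken to consist of overgroups of infinite
  index together with \<open>H\<close>, which bounds the rank by the depth. Conversely, if \<open>K\<close> is the last but
  one member of a chain ending in \<open>H\<close>, the groups generated by \<open>H\<close> and the level stabilizers of \<open>K\<close> have finite
  index in \<open>K\<close> and converge to \<open>H\<close>.
\<close>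

subsection \<open>Subgroups of additive groups\<close>

text \<open>Abstract groups are written additively, as in the type class \<open>group_add\<close>, whose addition
  need not commute. For subgroups, \<open>almost_sub A B\<close> says that \<open>A \<inter> B\<close> has finite index in \<open>A\<close>.\<close>

definition subgrp :: "'g::group_add set \<Rightarrow> bool" where
  "subgrp S \<longleftrightarrow> 0 \<in> S \<and> (\<forall>x\<in>S. \<forall>y\<in>S. x + y \<in> S) \<and> (\<forall>x\<in>S. - x \<in> S)"

definition almost_sub :: "'g::group_add set \<Rightarrow> 'g set \<Rightarrow> bool" where
  "almost_sub A B \<longleftrightarrow> (\<exists>F. finite F \<and> (\<forall>a\<in>A. \<exists>f\<in>F. a - f \<in> B))"

definition gspan :: "'g::group_add set \<Rightarrow> 'g set" where
  "gspan S = \<Inter>{K. subgrp K \<and> S \<subseteq> K}"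

definition fg :: "'g::group_add set \<Rightarrow> bool" where
  "fg K \<longleftrightarrow> (\<exists>S. finite S \<and> gspan S = K)"

definition gconj :: "'g::group_add \<Rightarrow> 'g \<Rightarrow> 'g" where
  "gconj g x = g + x - g"

definition normalizes :: "'g::group_add set \<Rightarrow> 'g set \<Rightarrow> bool" where
  "normalizes P N \<longleftrightarrow> (\<forall>p\<in>P. \<forall>x\<in>N. gconj p x \<in> N)"

definition centr :: "'g::group_add set \<Rightarrow> 'g set \<Rightarrow> 'g set" where
  "centr P S = {p \<in> P. \<forall>x\<in>S. p + x = x + p}"

text \<open>Used with \<open>add_uminus_conv_diff\<close> deleted: words in the noncommutative group
  become right-nested sums of elements and negated elements, in which the simplifier can
  cancel.\<close>

lemmas gassoc = add.assoc minus_add diff_conv_add_uminus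

lemma subgrpI:
  assumes "0 \<in> S" "\<And>x y. x \<in> S \<Longrightarrow> y \<in> S \<Longrightarrow> x + y \<in> S" "\<And>x. x \<in> S \<Longrightarrow> - x \<in> S"
  shows "subgrp S"
  using assms by (auto simp: subgrp_def)

lemma subgrp_zero: "subgrp S \<Longrightarrow> 0 \<in> S"
  and subgrp_add: "subgrp S \<Longrightarrow> x \<in> S \<Longrightarrow> y \<in> S \<Longrightarrow> x + y \<in> S"
  and subgrp_uminus: "subgrp S \<Longrightarrow> x \<in> S \<Longrightarrow> - x \<in> S"
  by (auto simp: subgrp_def)

lemma subgrp_diff: "subgrp S \<Longrightarrow> x \<in> S \<Longrightarrow> y \<in> S \<Longrightarrow> x - y \<in> S"
  using subgrp_add[of S x "- y"] subgrp_uminus[of S y] by simp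

lemma subgrp_gconj: "subgrp S \<Longrightarrow> g \<in> S \<Longrightarrow> x \<in> S \<Longrightarrow> gconj g x \<in> S"
  by (simp add: gconj_def subgrp_add subgrp_diff)

lemmas subgrp_closed = subgrp_zero subgrp_add subgrp_uminus subgrp_diff subgrp_gconj

lemma subgrp_cancel_left: "subgrp S \<Longrightarrow> x \<in> S \<Longrightarrow> x + y \<in> S \<Longrightarrow> y \<in> S"
  using subgrp_add[of S "- x" "x + y"] subgrp_uminus[of S x] by simp

lemma subgrp_Int: "subgrp A \<Longrightarrow> subgrp B \<Longrightarrow> subgrp (A \<inter> B)"
  by (auto simp: subgrp_def)

lemma subgrp_Inter: "(\<And>A. A \<in> S \<Longrightarrow> subgrp A) \<Longrightarrow> subgrp (\<Inter>S)"
  by (auto simp: subgrp_def)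

lemma subgrp_nontrivial: "subgrp S \<Longrightarrow> S \<noteq> {0} \<longleftrightarrow> (\<exists>x\<in>S. x \<noteq> 0)"
  by (auto simp: subgrp_def)

lemma gconj_add: "gconj g (x + y) = gconj g x + gconj g y"
  and gconj_uminus: "gconj g (- x) = - gconj g x"
  and gconj_zero [simp]: "gconj g 0 = 0"
  and gconj_0 [simp]: "gconj 0 x = x"
  and gconj_gconj: "gconj g (gconj h x) = gconj (g + h) x"
  by (simp_all add: gconj_def gassoc del: add_uminus_conv_diff)

lemma gconj_diff: "gconj g (x - y) = gconj g x - gconj g y"
  using gconj_add[of g x "- y"] by (simp add: gconj_uminus)

lemma gconj_minus_cancel [simp]: "gconj (- g) (gconj g x) = x" "gconj g (gconj (- g) x) = x"
  by (simp_all add: gconj_gconj)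

lemma gconj_eq_0_iff [simp]: "gconj g x = 0 \<longleftrightarrow> x = 0"
  using gconj_minus_cancel(1)[of g x] by (metis gconj_zero)

lemma gconj_eq_self_iff: "gconj g x = x \<longleftrightarrow> g + x = x + g"
  by (auto simp: gconj_def diff_eq_eq)

lemma inj_gconj: "inj (gconj g)"
  by (rule inj_on_inverseI[where g = "gconj (- g)"]) simp

lemma subgrp_gconj_image: "subgrp A \<Longrightarrow> subgrp (gconj g ` A)"
  by (rule subgrpI)
    (auto simp: gconj_add[symmetric] gconj_uminus[symmetric] subgrp_closed image_iff
      intro: bexI[of _ 0] subgrp_closed)

lemma gconj_image_gconj_image: "gconj g ` gconj h ` A = gconj (g + h) ` A"
  by (simp add: image_image gconj_gconj)

lemma gconj_image_self: "subgrp A \<Longrightarrow> g \<in> A \<Longrightarrow> gconj g ` A = A"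
proof
  assume A: "subgrp A" "g \<in> A"
  show "A \<subseteq> gconj g ` A"
  proof
    fix x assume "x \<in> A"
    then have "gconj (- g) x \<in> A" using A by (simp add: subgrp_closed)
    moreover have "x = gconj g (gconj (- g) x)" by simp
    ultimately show "x \<in> gconj g ` A" by blast
  qed
qed (auto simp: subgrp_closed)

lemma normalizes_image:
  assumes "subgrp P" "normalizes P N" "p \<in> P"
  shows "gconj p ` N = N"
proof
  show "N \<subseteq> gconj p ` N"
  proof
    fix x assume "x \<in> N"
    then have "gconj (- p) x \<in> N" using assms by (auto simp: normalizes_def subgrp_closed)
    moreover have "x = gconj p (gconj (- p) x)" by simp
    ultimately show "x \<in> gconj p ` N" by blast
  qed
qed (use assms in \<open>auto simp: normalizes_def\<close>)

lemma normalizes_subset: "normalizes P N \<Longrightarrow> Q \<subseteq> P \<Longrightarrow> normalizes Q N"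
  by (auto simp: normalizes_def)

lemma normalizes_self: "subgrp P \<Longrightarrow> normalizes P P"
  by (auto simp: normalizes_def subgrp_closed)

lemma normalizes_Int: "normalizes P M \<Longrightarrow> normalizes P N \<Longrightarrow> normalizes P (M \<inter> N)"
  by (auto simp: normalizes_def)

lemma normalizes_Inter: "(\<And>N. N \<in> S \<Longrightarrow> normalizes P N) \<Longrightarrow> normalizes P (\<Inter>S)"
  by (auto simp: normalizes_def)

text \<open>Moving \<open>p\<close> past \<open>g\<close> turns it into
  \<open>gconj (- g) p\<close>, which stays in \<open>P\<close> because \<open>G\<close> normalizes
  \<open>P\<close>.\<close>

lemma normalizes_gconj_image:
  assumes "subgrp G" "normalizes G P" "normalizes P N" "g \<in> G"
  shows "normalizes P (gconj g ` N)"
  unfolding normalizes_def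
proof (intro ballI)
  fix p y assume p: "p \<in> P" and "y \<in> gconj g ` N"
  then obtain x where x: "x \<in> N" "y = gconj g x" by auto
  have "gconj (- g) p \<in> P" using assms p by (auto simp: normalizes_def subgrp_closed)
  then have "gconj (gconj (- g) p) x \<in> N" using assms(3) x by (auto simp: normalizes_def)
  moreover have "gconj p y = gconj g (gconj (gconj (- g) p) x)"
    by (simp add: x gconj_gconj) (simp add: gconj_def gassoc del: add_uminus_conv_diff)
  ultimately show "gconj p y \<in> gconj g ` N" by simp
qed

lemma subgrp_centr: "subgrp P \<Longrightarrow> subgrp (centr P S)"
proof (rule subgrpI)
  assume P: "subgrp P"
  show "0 \<in> centr P S" using P by (simp add: centr_def subgrp_closed)
  show "x + y \<in> centr P S" if "x \<in> centr P S" "y \<in> centr P S" for x y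
    using that P by (simp add: centr_def subgrp_closed) (metis add.assoc)
  show "- x \<in> centr P S" if "x \<in> centr P S" for x
  proof -
    have "- x + s = s + - x" if "s \<in> S" for s
    proof -
      have "x + s = s + x" using that \<open>x \<in> centr P S\<close> by (simp add: centr_def)
      then have "- x + (x + s) + - x = - x + (s + x) + - x" by simp
      then show ?thesis by (simp add: gassoc del: add_uminus_conv_diff)
    qed
    then show ?thesis using that P by (simp add: centr_def subgrp_closed)
  qed
qed

lemma commute_gconj_iff: "gconj g x + gconj g y = gconj g y + gconj g x \<longleftrightarrow> x + y = y + x"
  by (metis gconj_add gconj_minus_cancel(1))

lemma normalizes_centr:
  assumes "subgrp P" "normalizes P Q" "normalizes P N"
  shows "normalizes P (centr Q N)"
  unfolding normalizes_def
proof (intro ballI)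
  fix p c assume p: "p \<in> P" and c: "c \<in> centr Q N"
  have "gconj p c + x = x + gconj p c" if "x \<in> N" for x
  proof -
    have "gconj (- p) x \<in> N" using assms p that by (auto simp: normalizes_def subgrp_closed)
    then have "c + gconj (- p) x = gconj (- p) x + c" using c by (auto simp: centr_def)
    then show ?thesis using commute_gconj_iff[of p c "gconj (- p) x"] by simp
  qed
  then show "gconj p c \<in> centr Q N" using assms p c by (auto simp: centr_def normalizes_def)
qed

lemma gspan_subgrp: "subgrp (gspan S)"
  unfolding gspan_def by (rule subgrp_Inter) auto

lemma gspan_superset: "S \<subseteq> gspan S"
  by (auto simp: gspan_def)

lemma gspan_least: "subgrp K \<Longrightarrow> S \<subseteq> K \<Longrightarrow> gspan S \<subseteq> K"
  by (auto simp: gspan_def)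

text \<open>Replaces induction over words: the \<open>k\<close> for which right translation by
  \<open>k\<close> and by \<open>- k\<close> preserves \<open>X0\<close> form a subgroup containing
  \<open>S\<close>, and translating 0 by such a \<open>k\<close> shows that \<open>k\<close> lies in
  \<open>X0\<close>.\<close>

lemma gspan_right_closed:
  assumes "0 \<in> X0" and X0: "\<And>x s. x \<in> X0 \<Longrightarrow> s \<in> S \<Longrightarrow> x + s \<in> X0 \<and> x - s \<in> X0"
  shows "gspan S \<subseteq> X0"
proof -
  let ?K = "{k. \<forall>x\<in>X0. x + k \<in> X0 \<and> x - k \<in> X0}"
  have "subgrp ?K"
  proof (rule subgrpI)
    show "x + y \<in> ?K" if "x \<in> ?K" "y \<in> ?K" for x y
    proof -
      have "z + (x + y) \<in> X0 \<and> z - (x + y) \<in> X0" if "z \<in> X0" for z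
      proof -
        have "z + x + y \<in> X0" "z - y - x \<in> X0" using \<open>x \<in> ?K\<close> \<open>y \<in> ?K\<close> that by blast+
        then show ?thesis by (simp add: gassoc del: add_uminus_conv_diff)
      qed
      then show ?thesis by blast
    qed
  qed auto
  moreover have "S \<subseteq> ?K" using X0 by blast
  ultimately have "gspan S \<subseteq> ?K" by (rule gspan_least)
  then show ?thesis using \<open>0 \<in> X0\<close> by force
qed

lemma fg_subgrp: "fg K \<Longrightarrow> subgrp K"
  using gspan_subgrp by (auto simp: fg_def)

lemma fgI: "subgrp K \<Longrightarrow> finite S \<Longrightarrow> S \<subseteq> K \<Longrightarrow> K \<subseteq> gspan S \<Longrightarrow> fg K"
  unfolding fg_def using gspan_least by blast

subsection \<open>Almost inclusion\<close>

lemma almost_sub_coverI: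
  "finite F \<Longrightarrow> (\<And>a. a \<in> A \<Longrightarrow> \<exists>f\<in>F. a - f \<in> B) \<Longrightarrow> almost_sub A B"
  unfolding almost_sub_def by blast

lemma almost_subE:
  assumes "almost_sub A B"
  obtains F where "finite F" "\<forall>a\<in>A. \<exists>f\<in>F. a - f \<in> B"
  using assms unfolding almost_sub_def by (elim exE conjE)

text \<open>A labelling by finitely many values whose fibres lie in single cosets of
  \<open>B\<close> bounds the number of cosets met by \<open>A\<close>. Picking one point per fibre
  keeps the representatives inside \<open>A\<close>.\<close>

lemma almost_sub_labels:
  assumes "finite (c ` A)" "\<forall>a\<in>A. \<forall>b\<in>A. c a = c b \<longrightarrow> a - b \<in> B"
  shows "\<exists>F. finite F \<and> F \<subseteq> A \<and> (\<forall>a\<in>A. \<exists>f\<in>F. a - f \<in> B)"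
proof (intro exI conjI ballI)
  let ?F = "inv_into A c ` c ` A"
  show "finite ?F" using assms(1) by blast
  show "?F \<subseteq> A" by (auto intro: inv_into_into)
  show "\<exists>f\<in>?F. a - f \<in> B" if "a \<in> A" for a
    using that assms(2) by (metis (no_types, lifting) f_inv_into_f imageI inv_into_into)
qed

lemma almost_subI:
  assumes "finite (c ` A)" "\<And>a b. a \<in> A \<Longrightarrow> b \<in> A \<Longrightarrow> c a = c b \<Longrightarrow> a - b \<in> B"
  shows "almost_sub A B"
  using almost_sub_labels[of c A B] assms unfolding almost_sub_def by blast

text \<open>Labels, unlike lists of representatives, can be paired and pulled back along maps;
  \<open>almost_sub_Int\<close> and \<open>almost_sub_extension\<close> use this.\<close>

lemma almost_sub_label:
  fixes A :: "'g::group_add set"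
  assumes "almost_sub A B" "subgrp B"
  obtains c :: "'g \<Rightarrow> 'g" where "finite (c ` A)" "\<forall>a\<in>A. \<forall>b\<in>A. c a = c b \<longrightarrow> a - b \<in> B"
proof -
  obtain F where F: "finite F" "\<forall>a\<in>A. \<exists>f\<in>F. a - f \<in> B"
    by (rule almost_subE[OF assms(1)])
  then obtain c where c: "\<forall>a\<in>A. c a \<in> F \<and> a - c a \<in> B" by metis
  show thesis
  proof
    show "finite (c ` A)" by (rule finite_subset[OF _ F(1)]) (use c in auto)
    have "a - b \<in> B" if "a \<in> A" "b \<in> A" "c a = c b" for a b
    proof -
      have "(a - c a) - (b - c a) \<in> B" using c assms(2) that by (metis subgrp_diff)
      then show "a - b \<in> B" by (simp add: gassoc del: add_uminus_conv_diff)
    qed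
    then show "\<forall>a\<in>A. \<forall>b\<in>A. c a = c b \<longrightarrow> a - b \<in> B" by blast
  qed
qed

lemma almost_sub_reps:
  fixes A :: "'g::group_add set"
  assumes "almost_sub A B" "subgrp B"
  obtains F where "finite F" "F \<subseteq> A" "\<forall>a\<in>A. \<exists>f\<in>F. a - f \<in> B"
proof -
  obtain c :: "'g \<Rightarrow> 'g" where "finite (c ` A)" "\<forall>a\<in>A. \<forall>b\<in>A. c a = c b \<longrightarrow> a - b \<in> B"
    by (rule almost_sub_label[OF assms])
  from almost_sub_labels[OF this] show thesis using that by blast
qed

lemma almost_sub_subset: "A \<subseteq> B \<Longrightarrow> almost_sub A B"
  unfolding almost_sub_def by (rule exI[of _ "{0}"]) auto

lemma almost_sub_mono: "almost_sub A B \<Longrightarrow> A' \<subseteq> A \<Longrightarrow> B \<subseteq> B' \<Longrightarrow> almost_sub A' B'"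
  unfolding almost_sub_def by (meson subset_iff)

lemma almost_sub_mono_right: "almost_sub A B \<Longrightarrow> B \<subseteq> B' \<Longrightarrow> almost_sub A B'"
  using almost_sub_mono[of A B A B'] by simp

lemma almost_sub_trans:
  assumes "almost_sub A B" "almost_sub B C"
  shows "almost_sub A C"
proof -
  obtain F where F: "finite F" "\<forall>a\<in>A. \<exists>f\<in>F. a - f \<in> B"
    by (rule almost_subE[OF assms(1)])
  obtain E where E: "finite E" "\<forall>b\<in>B. \<exists>e\<in>E. b - e \<in> C"
    by (rule almost_subE[OF assms(2)])
  have "\<exists>f\<in>(\<lambda>(e, f). e + f) ` (E \<times> F). a - f \<in> C" if a: "a \<in> A" for a
  proof -
    obtain f where f: "f \<in> F" "a - f \<in> B" using F(2) a by blast
    obtain e where e: "e \<in> E" "a - f - e \<in> C" using bspec[OF E(2) f(2)] by blast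
    have "a - (e + f) \<in> C" using e(2) by (simp add: gassoc del: add_uminus_conv_diff)
    then show ?thesis by (rule rev_bexI[rotated]) (use e f in \<open>auto intro!: image_eqI[of _ _ "(e, f)"]\<close>)
  qed
  then show ?thesis by (rule almost_sub_coverI[OF finite_imageI[OF finite_cartesian_product[OF E(1) F(1)]]])
qed

lemma almost_sub_Int:
  fixes A :: "'g::group_add set"
  assumes "almost_sub A B" "almost_sub A C" "subgrp B" "subgrp C"
  shows "almost_sub A (B \<inter> C)"
proof -
  obtain c :: "'g \<Rightarrow> 'g" where c: "finite (c ` A)" "\<forall>a\<in>A. \<forall>b\<in>A. c a = c b \<longrightarrow> a - b \<in> B"
    using almost_sub_label[OF assms(1,3)] by metis
  obtain d :: "'g \<Rightarrow> 'g" where d: "finite (d ` A)" "\<forall>a\<in>A. \<forall>b\<in>A. d a = d b \<longrightarrow> a - b \<in> C"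
    using almost_sub_label[OF assms(2,4)] by metis
  show ?thesis
  proof (rule almost_subI)
    show "finite ((\<lambda>a. (c a, d a)) ` A)"
      by (rule finite_subset[of _ "c ` A \<times> d ` A"]) (use c d in auto)
  qed (use c d in auto)
qed

lemma almost_sub_Inter:
  assumes "finite S" "\<And>B. B \<in> S \<Longrightarrow> almost_sub A B" "\<And>B. B \<in> S \<Longrightarrow> subgrp B"
  shows "almost_sub A (\<Inter>S)"
  using assms
proof (induction S rule: finite_induct)
  case empty show ?case by (simp add: almost_sub_subset)
next
  case (insert B S)
  then show ?case by (simp add: almost_sub_Int subgrp_Inter)
qed

lemma almost_sub_self_Int:
  assumes "almost_sub A B" "subgrp A" "subgrp B"
  shows "almost_sub A (A \<inter> B)"
  using assms by (simp add: almost_sub_Int almost_sub_subset)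

text \<open>Additivity is asked on a subgroup only, since passing to the section at \<open>y\<close>
  is multiplicative on the stabilizer of \<open>y\<close> but not in general on all of
  \<open>G\<close>.\<close>

definition hom_on :: "'g::group_add set \<Rightarrow> ('g \<Rightarrow> 'h::group_add) \<Rightarrow> bool" where
  "hom_on B \<phi> \<longleftrightarrow> (\<forall>x\<in>B. \<forall>y\<in>B. \<phi> (x + y) = \<phi> x + \<phi> y)"

lemma hom_on_subset: "hom_on B \<phi> \<Longrightarrow> A \<subseteq> B \<Longrightarrow> hom_on A \<phi>"
  by (auto simp: hom_on_def)

lemma hom_on_add: "hom_on B \<phi> \<Longrightarrow> x \<in> B \<Longrightarrow> y \<in> B \<Longrightarrow> \<phi> (x + y) = \<phi> x + \<phi> y"
  by (simp add: hom_on_def)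

lemma hom_on_zero: "hom_on B \<phi> \<Longrightarrow> subgrp B \<Longrightarrow> \<phi> 0 = 0"
  using hom_on_add[of B \<phi> 0 0] by (simp add: subgrp_closed) (metis add_0_right add_left_imp_eq)

lemma hom_on_uminus: "hom_on B \<phi> \<Longrightarrow> subgrp B \<Longrightarrow> x \<in> B \<Longrightarrow> \<phi> (- x) = - \<phi> x"
  using hom_on_add[of B \<phi> "- x" x] hom_on_zero[of B \<phi>]
  by (simp add: subgrp_closed eq_neg_iff_add_eq_0)

lemma hom_on_diff: "hom_on B \<phi> \<Longrightarrow> subgrp B \<Longrightarrow> x \<in> B \<Longrightarrow> y \<in> B \<Longrightarrow> \<phi> (x - y) = \<phi> x - \<phi> y"
  using hom_on_add[of B \<phi> x "- y"] by (simp add: subgrp_closed hom_on_uminus)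

lemmas hom_on_simps = hom_on_add hom_on_zero hom_on_uminus hom_on_diff

lemma hom_on_image_subgrp: "hom_on B \<phi> \<Longrightarrow> subgrp B \<Longrightarrow> subgrp (\<phi> ` B)"
proof (rule subgrpI)
  assume h: "hom_on B \<phi>" "subgrp B"
  show "0 \<in> \<phi> ` B" using h by (metis hom_on_zero imageI subgrp_zero)
  show "x + y \<in> \<phi> ` B" if "x \<in> \<phi> ` B" "y \<in> \<phi> ` B" for x y
    using that h by (auto simp: hom_on_add[symmetric] subgrp_closed)
  show "- x \<in> \<phi> ` B" if "x \<in> \<phi> ` B" for x
    using that h by (auto simp: hom_on_uminus[symmetric] subgrp_closed)
qed

lemma almost_sub_image:
  assumes "almost_sub A B" "subgrp A" "subgrp B" "B \<subseteq> A" "hom_on A \<phi>"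
  shows "almost_sub (\<phi> ` A) (\<phi> ` B)"
proof -
  obtain F where F: "finite F" "F \<subseteq> A" "\<forall>a\<in>A. \<exists>f\<in>F. a - f \<in> B"
    using almost_sub_reps[OF assms(1,3)] by metis
  have "\<exists>f\<in>\<phi> ` F. x - f \<in> \<phi> ` B" if x: "x \<in> \<phi> ` A" for x
  proof -
    obtain a f where a: "a \<in> A" "x = \<phi> a" "f \<in> F" "a - f \<in> B" using x F by blast
    then have "f \<in> A" using F(2) by blast
    then have "x - \<phi> f = \<phi> (a - f)" using assms(2,5) a by (simp add: hom_on_diff)
    then show ?thesis using a(3,4) by (intro bexI[of _ "\<phi> f"]) simp_all
  qed
  then show ?thesis by (rule almost_sub_coverI[OF finite_imageI[OF F(1)]])
qed

lemma almost_sub_gconj: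
  assumes "almost_sub A B"
  shows "almost_sub (gconj g ` A) (gconj g ` B)"
proof -
  obtain F where F: "finite F" "\<forall>a\<in>A. \<exists>f\<in>F. a - f \<in> B"
    by (rule almost_subE[OF assms(1)])
  have "\<exists>f\<in>gconj g ` F. x - f \<in> gconj g ` B" if x: "x \<in> gconj g ` A" for x
  proof -
    obtain a f where "a \<in> A" "x = gconj g a" "f \<in> F" "a - f \<in> B" using x F by blast
    then show ?thesis by (metis gconj_diff imageI)
  qed
  then show ?thesis by (rule almost_sub_coverI[OF finite_imageI[OF F(1)]])
qed

lemma finite_if_almost_sub:
  assumes "almost_sub A B" "finite B"
  shows "finite A"
proof -
  obtain F where F: "finite F" "\<forall>a\<in>A. \<exists>f\<in>F. a - f \<in> B"
    by (rule almost_subE[OF assms(1)])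
  have "A \<subseteq> (\<lambda>(b, f). b + f) ` (B \<times> F)"
  proof
    fix a assume "a \<in> A"
    then obtain f where "f \<in> F" "a - f \<in> B" using F by blast
    then show "a \<in> (\<lambda>(b, f). b + f) ` (B \<times> F)" by (force intro: image_eqI[of _ _ "(a - f, f)"])
  qed
  then show ?thesis using F assms(2) finite_subset by blast
qed

text \<open>The intermediate group is the preimage in \<open>B\<close> of the image of
  \<open>A\<close>. It has finite index in \<open>B\<close> by \<open>im\<close>; its elements
  differ from elements of \<open>A\<close> by kernel elements, so \<open>ker\<close> handles the
  remaining step.\<close>

lemma almost_sub_extension:
  fixes A :: "'g::group_add set" and \<phi> :: "'g \<Rightarrow> 'h::group_add"
  assumes A: "subgrp A" and B: "subgrp B" and AB: "A \<subseteq> B" and hom: "hom_on B \<phi>"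
    and im: "almost_sub (\<phi> ` B) (\<phi> ` A)"
    and ker: "almost_sub {b \<in> B. \<phi> b = 0} {a \<in> A. \<phi> a = 0}"
  shows "almost_sub B A"
proof -
  have "almost_sub B {b \<in> B. \<phi> b \<in> \<phi> ` A}"
  proof -
    have sA: "subgrp (\<phi> ` A)" using hom_on_image_subgrp hom_on_subset hom A AB by blast
    obtain c :: "'h \<Rightarrow> 'h" where c: "finite (c ` \<phi> ` B)"
      "\<forall>a\<in>\<phi> ` B. \<forall>b\<in>\<phi> ` B. c a = c b \<longrightarrow> a - b \<in> \<phi> ` A"
      using almost_sub_label[OF im sA] by metis
    show ?thesis
    proof (rule almost_subI)
      show "finite ((c \<circ> \<phi>) ` B)" using c by (simp add: image_comp)
      fix a b assume ab: "a \<in> B" "b \<in> B" "(c \<circ> \<phi>) a = (c \<circ> \<phi>) b"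
      then have "\<phi> (a - b) = \<phi> a - \<phi> b" using hom B by (simp add: hom_on_diff)
      then show "a - b \<in> {b \<in> B. \<phi> b \<in> \<phi> ` A}" using ab c B by (simp add: subgrp_closed)
    qed
  qed
  moreover have "almost_sub {b \<in> B. \<phi> b \<in> \<phi> ` A} A"
  proof -
    obtain F where F: "finite F" "\<forall>b\<in>{b \<in> B. \<phi> b = 0}. \<exists>f\<in>F. b - f \<in> {a \<in> A. \<phi> a = 0}"
      by (rule almost_subE[OF ker])
    have "\<exists>f\<in>F. b - f \<in> A" if b: "b \<in> B" "\<phi> b \<in> \<phi> ` A" for b
    proof -
      obtain a where a: "a \<in> A" "\<phi> b = \<phi> a" using b by auto
      then have "a \<in> B" using AB by blast
      then have "- a + b \<in> B" "\<phi> (- a + b) = 0"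
        using b a B hom by (simp_all add: hom_on_simps subgrp_closed)
      then obtain f where f: "f \<in> F" "- a + b - f \<in> A" using F by blast
      then have "a + (- a + b - f) \<in> A" using A a by (simp add: subgrp_closed)
      then have "b - f \<in> A" by (simp add: gassoc del: add_uminus_conv_diff)
      then show ?thesis using f by blast
    qed
    then show ?thesis by (intro almost_sub_coverI[OF F(1)]) blast
  qed
  ultimately show ?thesis by (rule almost_sub_trans)
qed

subsection \<open>Finite generation\<close>

text \<open>Schreier's argument: with coset representatives \<open>F\<close>, the elements
  \<open>f + s - f'\<close> that lie in \<open>K\<close> generate \<open>K\<close>, because their
  span plus \<open>F\<close> is stable under right translation by the generators of \<open>G\<close>
  and their negatives.\<close>

lemma fg_finite_index_subgroup:
  assumes "fg G" "subgrp K" "K \<subseteq> G" "almost_sub G K"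
  shows "fg K"
proof -
  obtain S where S: "finite S" "gspan S = G" using assms by (auto simp: fg_def)
  have G: "subgrp G" using assms fg_subgrp by blast
  obtain F0 where F0: "finite F0" "F0 \<subseteq> G" "\<forall>a\<in>G. \<exists>f\<in>F0. a - f \<in> K"
    using almost_sub_reps[OF assms(4,2)] by metis
  \<comment> \<open>Having 0 in \<open>F\<close> puts 0 into \<open>X0\<close>, and the choice
    \<open>s = 0\<close>, \<open>f' = 0\<close> puts every representative lying in \<open>K\<close>
    into \<open>S'\<close>.\<close>
  define F where "F = insert 0 F0"
  have F: "finite F" "0 \<in> F" "F \<subseteq> G" "\<forall>a\<in>G. \<exists>f\<in>F. a - f \<in> K"
    using F0 G unfolding F_def by (auto simp: subgrp_closed)
  define S' where "S' = (\<lambda>(f, s, f'). f + s - f') ` (F \<times> (insert 0 S \<union> uminus ` S) \<times> F) \<inter> K"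
  have S'I: "f + s - f' \<in> S'" if "f \<in> F" "s \<in> insert 0 S \<union> uminus ` S" "f' \<in> F" "f + s - f' \<in> K" for f s f'
    using that unfolding S'_def by (intro IntI image_eqI[of _ _ "(f, s, f')"]) auto
  have S': "finite S'" "S' \<subseteq> K" unfolding S'_def using F(1) S(1) by (blast intro: finite_SigmaI)+
  define X0 where "X0 = {m + f | m f. m \<in> gspan S' \<and> f \<in> F}"
  have "gspan S \<subseteq> X0"
  proof (rule gspan_right_closed)
    show "0 \<in> X0" unfolding X0_def using F(2) gspan_subgrp[of S'] subgrp_zero by force
    have step: "x + s \<in> X0" if x: "x \<in> X0" and s: "s \<in> S \<union> uminus ` S" for x s
    proof -
      obtain m f where m: "m \<in> gspan S'" "f \<in> F" "x = m + f" using x unfolding X0_def by blast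
      have "s \<in> G" using s S gspan_superset[of S] G by (auto simp: subgrp_closed subset_eq)
      then have "f + s \<in> G" using G F m by (auto simp: subgrp_closed)
      then obtain f' where f': "f' \<in> F" "f + s - f' \<in> K" using F by blast
      then have "f + s - f' \<in> gspan S'" using S'I[of f s f'] m s gspan_superset[of S'] by blast
      then have "m + (f + s - f') \<in> gspan S'" using m gspan_subgrp subgrp_add by blast
      moreover have "x + s = m + (f + s - f') + f'" using m by (simp add: gassoc del: add_uminus_conv_diff)
      ultimately show ?thesis unfolding X0_def using f' by blast
    qed
    show "x + s \<in> X0 \<and> x - s \<in> X0" if "x \<in> X0" "s \<in> S" for x s
      using step[of x s] step[of x "- s"] that by simp
  qed
  have "K \<subseteq> gspan S'"
  proof
    fix k assume k: "k \<in> K"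
    then obtain m f where m: "m \<in> gspan S'" "f \<in> F" "k = m + f"
      using \<open>gspan S \<subseteq> X0\<close> S assms(3) unfolding X0_def by blast
    have "m \<in> K" using m S' gspan_least[OF assms(2) S'(2)] by blast
    then have "f \<in> K" using subgrp_cancel_left[OF assms(2)] m k by blast
    then have "f \<in> gspan S'" using S'I[of f 0 0] m(2) F(2) gspan_superset[of S'] by auto
    then show "k \<in> gspan S'" using m gspan_subgrp subgrp_add by blast
  qed
  then show ?thesis using fgI S' assms(2) by blast
qed

lemma fg_finite_index_overgroup:
  assumes "fg K" "subgrp G" "K \<subseteq> G" "almost_sub G K"
  shows "fg G"
proof -
  obtain S where S: "finite S" "gspan S = K" using assms by (auto simp: fg_def)
  obtain F where F: "finite F" "F \<subseteq> G" "\<forall>a\<in>G. \<exists>f\<in>F. a - f \<in> K"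
    using almost_sub_reps[OF assms(4) fg_subgrp[OF assms(1)]] by metis
  have K: "K \<subseteq> gspan (S \<union> F)"
    using S gspan_least[OF gspan_subgrp, of S "S \<union> F"] gspan_superset[of "S \<union> F"] by blast
  show ?thesis
  proof (rule fgI[OF assms(2), of "S \<union> F"])
    show "S \<union> F \<subseteq> G" using S F assms(3) gspan_superset[of S] by blast
    show "G \<subseteq> gspan (S \<union> F)"
    proof
      fix a assume "a \<in> G"
      then obtain f where "f \<in> F" "a - f \<in> K" using F by blast
      then have "a - f + f \<in> gspan (S \<union> F)"
        using K gspan_superset[of "S \<union> F"] by (intro subgrp_add[OF gspan_subgrp]) auto
      then show "a \<in> gspan (S \<union> F)" by simp
    qed
  qed (use S(1) F(1) in simp)
qed

text \<open>Lifts of generators of the image together with generators of the kernel generate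
  \<open>B\<close>: every element agrees with one in the span of the lifts up to a kernel
  element.\<close>

lemma fg_extension:
  assumes B: "subgrp B" and hom: "hom_on B \<phi>"
    and im: "fg (\<phi> ` B)" and ker: "fg {b \<in> B. \<phi> b = 0}"
  shows "fg B"
proof -
  obtain S where S: "finite S" "gspan S = \<phi> ` B" using im by (auto simp: fg_def)
  obtain R where R: "finite R" "gspan R = {b \<in> B. \<phi> b = 0}" using ker by (auto simp: fg_def)
  have "S \<subseteq> \<phi> ` B" using S gspan_superset by blast
  then obtain T where T: "finite T" "T \<subseteq> B" "S = \<phi> ` T"
    using finite_subset_image[OF S(1)] by metis
  have RB: "R \<subseteq> B" using R gspan_superset[of R] by blast
  let ?M = "gspan (R \<union> T)"
  have MB: "?M \<subseteq> B" using gspan_least[OF B, of "R \<union> T"] RB T by blast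
  have "gspan S \<subseteq> \<phi> ` ?M"
  proof (rule gspan_least)
    show "subgrp (\<phi> ` ?M)"
      using hom_on_image_subgrp hom_on_subset[OF hom MB] gspan_subgrp by blast
    show "S \<subseteq> \<phi> ` ?M" using T gspan_superset[of "R \<union> T"] by blast
  qed
  have "B \<subseteq> ?M"
  proof
    fix b assume b: "b \<in> B"
    then obtain m where m: "m \<in> ?M" "\<phi> b = \<phi> m" using \<open>gspan S \<subseteq> \<phi> ` ?M\<close> S by blast
    then have "m \<in> B" using MB by blast
    then have "- m + b \<in> B" "\<phi> (- m + b) = 0"
      using B b m hom by (simp_all add: hom_on_simps subgrp_closed)
    then have "- m + b \<in> gspan R" using R by simp
    then have "- m + b \<in> ?M"
      using gspan_least[OF gspan_subgrp, of R "R \<union> T"] gspan_superset[of "R \<union> T"] by blast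
    then have "m + (- m + b) \<in> ?M" using m gspan_subgrp subgrp_add by blast
    then show "b \<in> ?M" by simp
  qed
  then show ?thesis using fgI[OF B, of "R \<union> T"] R T RB by blast
qed

section \<open>Spans of commuting sets, conjugates and cores\<close>

lemma gspan_commute:
  assumes "\<forall>x\<in>S. \<forall>y\<in>T. x + y = y + x" "x \<in> gspan S" "y \<in> gspan T"
  shows "x + y = y + x"
proof -
  have "gspan T \<subseteq> centr UNIV S"
    by (intro gspan_least subgrp_centr) (use assms(1) in \<open>auto simp: centr_def subgrp_def\<close>)
  then have "S \<subseteq> centr UNIV {y}" using assms(3) unfolding centr_def by auto
  then have "gspan S \<subseteq> centr UNIV {y}"
    by (intro gspan_least subgrp_centr) (simp_all add: subgrp_def)
  then show ?thesis using assms(2) unfolding centr_def by auto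
qed

lemma normalizes_gspan_conjugates:
  assumes G: "subgrp G"
  shows "normalizes G (gspan (\<Union>g\<in>G. gconj g ` M))" (is "normalizes G (gspan ?X)")
  unfolding normalizes_def
proof (intro ballI)
  fix g x assume g: "g \<in> G" and x: "x \<in> gspan ?X"
  have "gspan ?X \<subseteq> gconj (- g) ` gspan ?X"
  proof (intro gspan_least subgrp_gconj_image gspan_subgrp subsetI)
    fix u assume "u \<in> ?X"
    then obtain h m where "h \<in> G" "m \<in> M" "u = gconj h m" by blast
    then have "gconj g u = gconj (g + h) m" "g + h \<in> G" "m \<in> M"
      using G g by (simp_all add: gconj_gconj subgrp_closed)
    then have "gconj g u \<in> ?X" by blast
    then have "gconj g u \<in> gspan ?X" by (rule subsetD[OF gspan_superset])
    then show "u \<in> gconj (- g) ` gspan ?X" by (intro image_eqI[of _ _ "gconj g u"]) simp_all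
  qed
  then obtain y where "y \<in> gspan ?X" "x = gconj (- g) y" using x by blast
  then show "gconj g x \<in> gspan ?X" by simp
qed

text \<open>In the induction step the span of \<open>s\<close> and \<open>S\<close> is contained in
  the setwise sum of two finite subgroups that commute elementwise, which is itself a
  subgroup.\<close>

lemma finite_gspan_commuting:
  assumes "finite S" "\<forall>x\<in>S. \<forall>y\<in>S. x + y = y + x" "\<forall>x\<in>S. finite (gspan {x})"
  shows "finite (gspan S)"
  using assms
proof (induction S rule: finite_induct)
  case empty
  have "gspan {} \<subseteq> {0::'a}" by (rule gspan_least) (auto simp: subgrp_def)
  then show ?case by (rule finite_subset) simp
next
  case (insert s S)
  have comm: "a + b = b + a" if "a \<in> gspan {s}" "b \<in> gspan S" for a b
    by (rule gspan_commute[OF _ that]) (use insert.prems(1) in blast)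
  let ?X = "(\<lambda>(a, b). a + b) ` (gspan {s} \<times> gspan S)"
  have XI: "a + b \<in> ?X" if "a \<in> gspan {s}" "b \<in> gspan S" for a b
    using that by (intro image_eqI[of _ _ "(a, b)"]) auto
  have "gspan (insert s S) \<subseteq> ?X"
  proof (rule gspan_least)
    show "subgrp ?X"
    proof (rule subgrpI)
      show "0 \<in> ?X" using XI[of 0 0] by (simp add: subgrp_zero gspan_subgrp)
      show "x + y \<in> ?X" if xy: "x \<in> ?X" "y \<in> ?X" for x y
      proof -
        obtain a b a' b' where *: "x = a + b" "y = a' + b'" "a \<in> gspan {s}" "a' \<in> gspan {s}"
          "b \<in> gspan S" "b' \<in> gspan S" using xy by auto
        then have "x + y = a + (b + a') + b'" by (simp add: add.assoc)
        also have "\<dots> = (a + a') + (b + b')" using comm[of a' b] * by (metis add.assoc)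
        finally show ?thesis using XI * by (simp add: subgrp_add gspan_subgrp)
      qed
      show "- x \<in> ?X" if x: "x \<in> ?X" for x
      proof -
        obtain a b where *: "x = a + b" "a \<in> gspan {s}" "b \<in> gspan S" using x by auto
        then have "x = b + a" using comm by simp
        then have "- x = - a + - b" by (simp add: minus_add del: add_uminus_conv_diff)
        then show ?thesis using XI[of "- a" "- b"] * by (simp add: subgrp_uminus gspan_subgrp)
      qed
    qed
    have "s + 0 \<in> ?X" using gspan_superset[of "{s}"] subgrp_zero[OF gspan_subgrp] by (intro XI) auto
    moreover have "0 + x \<in> ?X" if "x \<in> S" for x
      using that gspan_superset[of S] subgrp_zero[OF gspan_subgrp] by (intro XI) auto
    ultimately show "insert s S \<subseteq> ?X" by auto
  qed
  moreover have "finite ?X" using insert by (intro finite_imageI finite_cartesian_product) auto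
  ultimately show ?case by (rule finite_subset)
qed

text \<open>Since \<open>P\<close> normalizes each conjugate of \<open>N\<close>, the conjugate by
  \<open>g\<close> depends only on the coset of \<open>g\<close> modulo \<open>P\<close>.\<close>

lemma finite_conjugates:
  assumes "subgrp G" "subgrp P" "normalizes G P" "almost_sub G P" "normalizes P N"
  shows "finite ((\<lambda>g. gconj g ` N) ` G)"
proof -
  obtain F where F: "finite F" "F \<subseteq> G" "\<forall>a\<in>G. \<exists>f\<in>F. a - f \<in> P"
    by (rule almost_sub_reps[OF assms(4,2)])
  have "(\<lambda>g. gconj g ` N) ` G \<subseteq> (\<lambda>g. gconj g ` N) ` F"
  proof
    fix Q assume "Q \<in> (\<lambda>g. gconj g ` N) ` G"
    then obtain g where g: "g \<in> G" "Q = gconj g ` N" by blast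
    then obtain f where f: "f \<in> F" "g - f \<in> P" using F(3) by blast
    have "Q = gconj (g - f) ` gconj f ` N" using g by (simp add: gconj_image_gconj_image)
    also have "\<dots> = gconj f ` N"
      using f F(2) assms by (intro normalizes_image[of P] normalizes_gconj_image[of G]) auto
    finally show "Q \<in> (\<lambda>g. gconj g ` N) ` F" using f by blast
  qed
  then show ?thesis by (rule finite_subset[OF _ finite_imageI[OF F(1)]])
qed

text \<open>The core is the intersection of all conjugates of \<open>Q\<close>, and this is a finite
  intersection of subgroups of finite index.\<close>

lemma finite_index_core:
  assumes G: "subgrp G" and Q: "subgrp Q" "Q \<subseteq> G" "almost_sub G Q"
  obtains P where "subgrp P" "P \<subseteq> Q" "normalizes G P" "almost_sub G P"
proof
  let ?S = "(\<lambda>g. gconj g ` Q) ` G"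
  obtain F where F: "finite F" "F \<subseteq> G" "\<forall>a\<in>G. \<exists>f\<in>F. a - f \<in> Q"
    by (rule almost_sub_reps[OF Q(3,1)])
  have "?S \<subseteq> (\<lambda>f. gconj (- f) ` Q) ` F"
  proof
    fix R assume "R \<in> ?S"
    then obtain g where g: "g \<in> G" "R = gconj g ` Q" by blast
    \<comment> \<open>Representatives are given for the cosets \<open>Q + f\<close>, while the
      conjugate of \<open>Q\<close> by \<open>g\<close> depends on \<open>g + Q\<close>; hence the
      detour through \<open>- g\<close>.\<close>
    then have "- g \<in> G" using G by (simp add: subgrp_closed)
    then obtain f where f: "f \<in> F" "- g - f \<in> Q" using F(3) by blast
    have "R = gconj (- f) ` gconj (- (- g - f)) ` Q"
      using g by (simp add: gconj_image_gconj_image gassoc del: add_uminus_conv_diff)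
    also have "gconj (- (- g - f)) ` Q = Q"
      by (rule gconj_image_self[OF Q(1) subgrp_uminus[OF Q(1) f(2)]])
    finally show "R \<in> (\<lambda>f. gconj (- f) ` Q) ` F" using f by blast
  qed
  then have fin: "finite ?S" by (rule finite_subset[OF _ finite_imageI[OF F(1)]])
  have sg: "subgrp B" if "B \<in> ?S" for B using that Q(1) subgrp_gconj_image by blast
  show "subgrp (\<Inter>?S)" by (rule subgrp_Inter[OF sg])
  have "Q \<in> ?S" using subgrp_zero[OF G] by (intro image_eqI[of _ _ 0]) auto
  then show "\<Inter>?S \<subseteq> Q" by blast
  show "normalizes G (\<Inter>?S)"
    unfolding normalizes_def
  proof (intro ballI InterI)
    fix g x B assume g: "g \<in> G" and x: "x \<in> \<Inter>?S" and "B \<in> ?S"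
    then obtain h where h: "h \<in> G" "B = gconj h ` Q" by blast
    have "- g + h \<in> G" using G g h by (simp add: subgrp_closed)
    then have "x \<in> gconj (- g + h) ` Q" using x by blast
    then have "gconj g x \<in> gconj g ` gconj (- g + h) ` Q" by blast
    then show "gconj g x \<in> B" using h by (simp add: gconj_image_gconj_image)
  qed
  show "almost_sub G (\<Inter>?S)"
  proof (rule almost_sub_Inter[OF fin _ sg])
    fix B assume "B \<in> ?S"
    then obtain h where h: "h \<in> G" "B = gconj h ` Q" by blast
    have "almost_sub (gconj h ` G) (gconj h ` Q)" using Q(3) by (rule almost_sub_gconj)
    then show "almost_sub G B" using gconj_image_self[OF G h(1)] h(2) by simp
  qed
qed

subsection \<open>Just infinite torsion groups\<close>

text \<open>The assumption \<open>torsion\<close> is what well-approximation contributes to the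
  group theory, by \<open>torsion_if_well_approximated\<close>; finite order is encoded by a finite
  cyclic span.\<close>

locale ji_group =
  fixes G :: "'g::group_add set"
  assumes G: "subgrp G" and fg_G: "fg G" and infinite_G: "infinite G"
    and ji: "\<And>N. subgrp N \<Longrightarrow> N \<subseteq> G \<Longrightarrow> normalizes G N \<Longrightarrow> N \<noteq> {0} \<Longrightarrow> almost_sub G N"
    and torsion: "\<And>g. g \<in> G \<Longrightarrow> finite (gspan {g})"
begin

lemma finite_index_nontrivial: "almost_sub G P \<Longrightarrow> P \<noteq> {0}"
  using finite_if_almost_sub infinite_G by blast

text \<open>Otherwise \<open>N\<close> would have finite index, hence be a finitely generated
  abelian torsion group and so finite, which would make \<open>G\<close> finite.\<close>

lemma abelian_normal_trivial:
  assumes N: "subgrp N" "N \<subseteq> G" "normalizes G N" and ab: "\<forall>x\<in>N. \<forall>y\<in>N. x + y = y + x"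
  shows "N = {0}"
proof (rule ccontr)
  assume "N \<noteq> {0}"
  then have idx: "almost_sub G N" using ji N by blast
  then have "fg N" using fg_finite_index_subgroup fg_G N by blast
  then obtain S where S: "finite S" "gspan S = N" by (auto simp: fg_def)
  have "S \<subseteq> N" using S gspan_superset by blast
  then have "finite (gspan S)" using ab torsion N(2) by (intro finite_gspan_commuting[OF S(1)]) blast+
  then show False using finite_if_almost_sub[OF idx] S infinite_G by blast
qed

text \<open>The set \<open>R\<close> of elements with centralizer of finite index is the FC-centre,
  a normal subgroup. If nontrivial, it has finite index and is finitely generated, so its
  centralizer contains a finite intersection of finite-index centralizers. The centre of
  \<open>R\<close> then has finite index in \<open>G\<close>, against
  \<open>abelian_normal_trivial\<close>.\<close>

lemma fc_trivial:
  assumes x: "x \<in> G" "almost_sub G (centr G {x})"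
  shows "x = 0"
proof -
  define R where "R = {x \<in> G. almost_sub G (centr G {x})}"
  have R: "subgrp R"
  proof (rule subgrpI)
    show "0 \<in> R" using G by (auto simp: R_def centr_def subgrp_closed intro: almost_sub_subset)
    show "a + b \<in> R" if ab: "a \<in> R" "b \<in> R" for a b
    proof -
      have "almost_sub G (centr G {a} \<inter> centr G {b})"
        using ab G by (intro almost_sub_Int subgrp_centr) (auto simp: R_def)
      moreover have "centr G {a} \<inter> centr G {b} \<subseteq> centr G {a + b}"
      proof
        fix c assume "c \<in> centr G {a} \<inter> centr G {b}"
        then have c: "c \<in> G" "c + a = a + c" "c + b = b + c" by (auto simp: centr_def)
        have "c + (a + b) = (a + b) + c" using c(2,3) by (metis add.assoc)
        then show "c \<in> centr G {a + b}" using c by (simp add: centr_def)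
      qed
      ultimately have "almost_sub G (centr G {a + b})" by (rule almost_sub_mono_right)
      then show ?thesis using ab G by (auto simp: R_def subgrp_closed)
    qed
    show "- a \<in> R" if a: "a \<in> R" for a
    proof -
      have "centr G {a} \<subseteq> centr G {- a}"
      proof
        fix c assume "c \<in> centr G {a}"
        then have c: "c \<in> G" "c + a = a + c" by (auto simp: centr_def)
        have "gconj c (- a) = - a" using c by (simp add: gconj_uminus gconj_eq_self_iff)
        then show "c \<in> centr G {- a}" using c by (simp add: centr_def gconj_eq_self_iff del: add_uminus_conv_diff)
      qed
      then have "almost_sub G (centr G {- a})" using a almost_sub_mono_right unfolding R_def by blast
      then show ?thesis using a G by (auto simp: R_def subgrp_closed)
    qed
  qed
  have RG: "R \<subseteq> G" by (auto simp: R_def)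
  have nR: "normalizes G R"
    unfolding normalizes_def
  proof (intro ballI)
    fix g a assume g: "g \<in> G" and a: "a \<in> R"
    have "almost_sub (gconj g ` G) (gconj g ` centr G {a})"
      using a by (intro almost_sub_gconj) (simp add: R_def)
    moreover have "gconj g ` centr G {a} \<subseteq> centr G {gconj g a}"
      using g G commute_gconj_iff[of g _ a] subgrp_gconj[OF G g] unfolding centr_def by blast
    ultimately have "almost_sub G (centr G {gconj g a})"
      using gconj_image_self[OF G g] almost_sub_mono_right by metis
    then show "gconj g a \<in> R" using a g G by (auto simp: R_def subgrp_closed)
  qed
  have "R = {0}"
  proof (rule ccontr)
    assume "R \<noteq> {0}"
    then have idx: "almost_sub G R" using ji R RG nR by blast
    then have "fg R" using fg_finite_index_subgroup fg_G R RG by blast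
    then obtain S where S: "finite S" "gspan S = R" by (auto simp: fg_def)
    have SR: "S \<subseteq> R" using S gspan_superset by blast
    have "almost_sub G (\<Inter>((\<lambda>s. centr G {s}) ` S))"
      using S SR G by (intro almost_sub_Inter) (auto simp: R_def subgrp_centr)
    moreover have "G \<inter> \<Inter>((\<lambda>s. centr G {s}) ` S) \<subseteq> centr G R"
    proof
      fix c assume c: "c \<in> G \<inter> \<Inter>((\<lambda>s. centr G {s}) ` S)"
      have "\<forall>x\<in>{c}. \<forall>y\<in>S. x + y = y + x" using c unfolding centr_def by blast
      then have "\<forall>y\<in>R. c + y = y + c"
        using gspan_commute[of "{c}" S c] gspan_superset[of "{c}"] S(2) by blast
      then show "c \<in> centr G R" using c unfolding centr_def by blast
    qed
    ultimately have "almost_sub G (centr G R)"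
      using almost_sub_self_Int G subgrp_Inter[of "(\<lambda>s. centr G {s}) ` S"] subgrp_centr[OF G]
      by (metis (no_types, lifting) almost_sub_mono_right imageE)
    then have 1: "almost_sub G (R \<inter> centr G R)"
      using idx R G by (intro almost_sub_Int subgrp_centr)
    have "R \<inter> centr G R = {0}"
    proof (rule abelian_normal_trivial)
      show "subgrp (R \<inter> centr G R)" using R G by (intro subgrp_Int subgrp_centr)
      show "normalizes G (R \<inter> centr G R)"
        using nR G by (intro normalizes_Int normalizes_centr normalizes_self)
      show "R \<inter> centr G R \<subseteq> G" using RG by blast
      show "\<forall>x\<in>R \<inter> centr G R. \<forall>y\<in>R \<inter> centr G R. x + y = y + x"
        unfolding centr_def by blast
    qed
    then show False using finite_index_nontrivial[OF 1] by blast
  qed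
  then show ?thesis using x by (auto simp: R_def)
qed

lemma centr_finite_index_trivial:
  assumes "Q \<subseteq> G" "almost_sub G Q" "x \<in> G" "\<forall>q\<in>Q. q + x = x + q"
  shows "x = 0"
proof (rule fc_trivial)
  have "Q \<subseteq> centr G {x}" using assms by (auto simp: centr_def)
  then show "almost_sub G (centr G {x})" by (rule almost_sub_mono_right[OF assms(2)])
qed (fact assms)

end

section \<open>Subgroups normal in a normal subgroup \<open>P\<close> of finite index\<close>

locale ji_normal = ji_group G for G :: "'g::group_add set" +
  fixes P :: "'g set"
  assumes P: "subgrp P" "P \<subseteq> G" "normalizes G P" "almost_sub G P"
begin

definition invsub :: "'g set \<Rightarrow> bool" where
  "invsub N \<longleftrightarrow> subgrp N \<and> N \<subseteq> P \<and> normalizes P N"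

lemma invsub_P: "invsub P"
  using P by (simp add: invsub_def normalizes_self)

lemma invsub_Int: "invsub M \<Longrightarrow> invsub N \<Longrightarrow> invsub (M \<inter> N)"
  by (auto simp: invsub_def subgrp_Int normalizes_Int)

lemma invsub_conj: "invsub N \<Longrightarrow> g \<in> G \<Longrightarrow> invsub (gconj g ` N)"
  using P G normalizes_gconj_image[of G P N g]
  by (auto simp: invsub_def subgrp_gconj_image normalizes_def)

text \<open>The commutator of \<open>x\<close> and \<open>y\<close> lies in both normal subgroups,
  hence is trivial.\<close>

lemma invsub_commute:
  assumes "invsub M" "invsub N" "M \<inter> N = {0}" "x \<in> M" "y \<in> N"
  shows "x + y = y + x"
proof -
  have "gconj x y \<in> N" "gconj y x \<in> M"
    using assms by (auto simp: invsub_def normalizes_def)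
  then have "gconj x y - y \<in> N" "x - gconj y x \<in> M"
    using assms by (auto simp: invsub_def subgrp_closed)
  moreover have "gconj x y - y = x - gconj y x"
    by (simp add: gconj_def gassoc del: add_uminus_conv_diff)
  ultimately have "gconj x y - y \<in> M \<inter> N" by simp
  then have "gconj x y - y = 0" using assms(3) by blast
  then show ?thesis by (simp add: gconj_eq_self_iff)
qed

text \<open>Among the conjugates of \<open>A\<close>, take a largest family with nontrivial
  intersection \<open>M\<close>. Each conjugate of \<open>M\<close> equals \<open>M\<close> or meets
  it trivially, so any two conjugates commute, and together they span an abelian normal subgroup of
  \<open>G\<close>, which is trivial.\<close>

lemma abelian_invsub_trivial:
  assumes A: "invsub A" and ab: "\<forall>x\<in>A. \<forall>y\<in>A. x + y = y + x"
  shows "A = {0}"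
proof (rule ccontr)
  assume "A \<noteq> {0}"
  let ?conj = "(\<lambda>g. gconj g ` A) ` G"
  have fin: "finite ?conj"
    using A P G by (intro finite_conjugates) (auto simp: invsub_def)
  have "A \<in> ?conj" using subgrp_zero[OF G] by (intro image_eqI[of _ _ 0]) auto
  define good where "good S \<longleftrightarrow> S \<subseteq> ?conj \<and> S \<noteq> {} \<and> \<Inter>S \<noteq> {0}" for S
  have "good {A}" using \<open>A \<noteq> {0}\<close> \<open>A \<in> ?conj\<close> by (simp add: good_def)
  have "\<forall>S. good S \<longrightarrow> card S < Suc (card ?conj)"
    using card_mono[OF fin] by (simp add: good_def less_Suc_eq_le)
  from ex_has_greatest_nat[OF \<open>good {A}\<close> this] obtain S
    where S: "good S" and max: "\<forall>T. good T \<longrightarrow> card T \<le> card S" by (elim exE conjE)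
  have finS: "finite S" using S fin finite_subset by (auto simp: good_def)
  obtain g0 where g0: "g0 \<in> G" "gconj g0 ` A \<in> S" using S by (auto simp: good_def)
  define M where "M = \<Inter>S"
  have invS: "invsub B" if "B \<in> S" for B using that S A invsub_conj by (auto simp: good_def)
  have M: "invsub M" unfolding invsub_def M_def
  proof (intro conjI)
    show "subgrp (\<Inter>S)" using invS by (intro subgrp_Inter) (auto simp: invsub_def)
    show "normalizes P (\<Inter>S)" using invS by (intro normalizes_Inter) (auto simp: invsub_def)
    show "\<Inter>S \<subseteq> P" using invS[OF g0(2)] g0(2) unfolding invsub_def by blast
  qed
  have abM: "x + y = y + x" if "x \<in> M" "y \<in> M" for x y
  proof -
    have "x \<in> gconj g0 ` A" "y \<in> gconj g0 ` A" using that g0 by (auto simp: M_def)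
    then obtain a b where "a \<in> A" "b \<in> A" "x = gconj g0 a" "y = gconj g0 b" by blast
    then show ?thesis using ab commute_gconj_iff[of g0 a b] by blast
  qed
  \<comment> \<open>If \<open>M\<close> meets its conjugate by \<open>g\<close> nontrivially,
    adjoining the conjugated family keeps the intersection nontrivial; maximality then forces the
    conjugated family to be \<open>S\<close> itself.\<close>
  have dich: "gconj g ` M = M \<or> M \<inter> gconj g ` M = {0}" if g: "g \<in> G" for g
  proof (rule disjCI)
    assume ne: "M \<inter> gconj g ` M \<noteq> {0}"
    let ?T = "(`) (gconj g) ` S"
    have T: "?T \<subseteq> ?conj"
    proof
      fix X0 assume "X0 \<in> ?T"
      then obtain B where "B \<in> S" "X0 = gconj g ` B" by blast
      then obtain h where "h \<in> G" "X0 = gconj g ` gconj h ` A" using S unfolding good_def by blast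
      then show "X0 \<in> ?conj" using G g by (auto simp: gconj_image_gconj_image subgrp_closed)
    qed
    have eq: "\<Inter>?T = gconj g ` M"
    proof
      show "gconj g ` M \<subseteq> \<Inter>?T" unfolding M_def by blast
      show "\<Inter>?T \<subseteq> gconj g ` M"
      proof
        fix x assume x: "x \<in> \<Inter>?T"
        have "gconj (- g) x \<in> B" if "B \<in> S" for B
        proof -
          have "x \<in> gconj g ` B" using x that by blast
          then show ?thesis by auto
        qed
        then have "gconj (- g) x \<in> M" unfolding M_def by blast
        then show "x \<in> gconj g ` M" by (intro image_eqI[of _ _ "gconj (- g) x"]) simp_all
      qed
    qed
    have "good (S \<union> ?T)"
      unfolding good_def using S T ne eq by (auto simp: good_def M_def Inter_Un_distrib)
    then have "card (S \<union> ?T) \<le> card S" using max by blast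
    then have "S \<union> ?T = S" using finS by (intro card_seteq[symmetric]) auto
    moreover have "card ?T = card S"
      by (rule card_image) (simp add: inj_on_def inj_image_eq_iff[OF inj_gconj])
    ultimately have "?T = S" using finS by (intro card_seteq) auto
    then show "gconj g ` M = M" using eq M_def by simp
  qed
  \<comment> \<open>Conjugating by \<open>- g\<close> reduces the case of two conjugates of
    \<open>M\<close> to that of \<open>M\<close> and one conjugate.\<close>
  have comm: "x + y = y + x" if "g \<in> G" "h \<in> G" "x \<in> gconj g ` M" "y \<in> gconj h ` M" for g h x y
  proof -
    have "- g + h \<in> G" using G that by (simp add: subgrp_closed)
    have x: "gconj (- g) x \<in> M" using that by auto
    have y: "gconj (- g) y \<in> gconj (- g + h) ` M"
      using that by (auto simp: gconj_gconj)
    have "gconj (- g) x + gconj (- g) y = gconj (- g) y + gconj (- g) x"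
      using dich[OF \<open>- g + h \<in> G\<close>]
    proof
      assume "gconj (- g + h) ` M = M"
      then show ?thesis using abM x y by simp
    next
      assume "M \<inter> gconj (- g + h) ` M = {0}"
      then show ?thesis
        using invsub_commute[OF M invsub_conj[OF M \<open>- g + h \<in> G\<close>]] x y by blast
    qed
    then show ?thesis by (simp add: commute_gconj_iff)
  qed
  define U where "U = (\<Union>g\<in>G. gconj g ` M)"
  have MU: "M \<subseteq> U" unfolding U_def using subgrp_zero[OF G] by force
  have commU: "\<forall>x\<in>U. \<forall>y\<in>U. x + y = y + x" using comm unfolding U_def by blast
  have "gspan U = {0}"
  proof (intro abelian_normal_trivial gspan_subgrp)
    show "gspan U \<subseteq> G"
      using G M P(2) by (intro gspan_least) (auto simp: U_def invsub_def subgrp_closed)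
    show "normalizes G (gspan U)"
      unfolding U_def by (rule normalizes_gspan_conjugates[OF G])
    show "\<forall>x\<in>gspan U. \<forall>y\<in>gspan U. x + y = y + x"
      using gspan_commute[OF commU] by blast
  qed
  then have "M \<subseteq> {0}" using MU gspan_superset[of U] by blast
  then show False using S M subgrp_zero by (auto simp: good_def M_def invsub_def)
qed

lemma centr_subset: "centr P W \<subseteq> P"
  by (auto simp: centr_def)

lemma invsub_centr: "invsub W \<Longrightarrow> invsub (centr P W)"
  unfolding invsub_def using P centr_subset subgrp_centr normalizes_centr normalizes_self by metis

lemma invsub_center_trivial:
  assumes "invsub W"
  shows "W \<inter> centr P W = {0}"
proof (rule abelian_invsub_trivial)
  show "invsub (W \<inter> centr P W)"
    by (rule invsub_Int[OF assms invsub_centr[OF assms]])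
  show "\<forall>x\<in>W \<inter> centr P W. \<forall>y\<in>W \<inter> centr P W. x + y = y + x"
    unfolding centr_def by blast
qed

end

section \<open>Products with centralizers and essential subgroups\<close>

context ji_normal
begin

text \<open>For an \<open>invsub W\<close> this is an internal direct product, by
  \<open>invsub_center_trivial\<close>.\<close>

definition with_centr :: "'g set \<Rightarrow> 'g set" where
  "with_centr W = {w + c | w c. w \<in> W \<and> c \<in> centr P W}"

lemma with_centrI: "w \<in> W \<Longrightarrow> c \<in> centr P W \<Longrightarrow> w + c \<in> with_centr W"
  unfolding with_centr_def by blast

lemma with_centrE:
  assumes "x \<in> with_centr W"
  obtains w c where "w \<in> W" "c \<in> centr P W" "x = w + c"
  using assms unfolding with_centr_def by blast

lemma centr_commute: "c \<in> centr P W \<Longrightarrow> w \<in> W \<Longrightarrow> c + w = w + c"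
  unfolding centr_def by blast

lemma invsub_with_centr:
  assumes W: "invsub W"
  shows "invsub (with_centr W)"
proof -
  have sW: "subgrp W" "W \<subseteq> P" "normalizes P W" using W by (auto simp: invsub_def)
  have C: "subgrp (centr P W)" "centr P W \<subseteq> P" "normalizes P (centr P W)"
    using invsub_centr[OF W] by (auto simp: invsub_def)
  have "subgrp (with_centr W)"
  proof (rule subgrpI)
    show "0 \<in> with_centr W" using with_centrI[of 0 W 0] sW C by (simp add: subgrp_zero)
    show "x + y \<in> with_centr W" if xy: "x \<in> with_centr W" "y \<in> with_centr W" for x y
    proof -
      obtain w c where x: "w \<in> W" "c \<in> centr P W" "x = w + c" by (rule with_centrE[OF xy(1)])
      obtain v d where y: "v \<in> W" "d \<in> centr P W" "y = v + d" by (rule with_centrE[OF xy(2)])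
      have "x + y = (w + v) + (c + d)"
        using centr_commute[OF x(2) y(1)] x(3) y(3) by (metis add.assoc)
      then show ?thesis using with_centrI x y sW C by (simp add: subgrp_add)
    qed
    show "- x \<in> with_centr W" if x: "x \<in> with_centr W" for x
    proof -
      obtain w c where x: "w \<in> W" "c \<in> centr P W" "x = w + c" by (rule with_centrE[OF x])
      have "x = c + w" using centr_commute[OF x(2,1)] x(3) by simp
      then have "- x = - w + - c" by (simp add: minus_add del: add_uminus_conv_diff)
      then show ?thesis using with_centrI x sW C by (metis subgrp_uminus)
    qed
  qed
  moreover have "with_centr W \<subseteq> P"
    using sW C P(1) by (auto elim!: with_centrE simp: subgrp_add subset_eq)
  moreover have "normalizes P (with_centr W)"
    unfolding normalizes_def
  proof (intro ballI)
    fix p x assume p: "p \<in> P" and x: "x \<in> with_centr W"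
    obtain w c where x: "w \<in> W" "c \<in> centr P W" "x = w + c" by (rule with_centrE[OF x])
    then have "gconj p w \<in> W" "gconj p c \<in> centr P W"
      using sW C p by (auto simp: normalizes_def)
    then show "gconj p x \<in> with_centr W" using with_centrI x by (simp add: gconj_add)
  qed
  ultimately show ?thesis by (simp add: invsub_def)
qed

text \<open>The analogue of an essential submodule. Unlike nontriviality, this property survives
  finite intersections, so all conjugates of a subgroup can be intersected.\<close>

definition essential :: "'g set \<Rightarrow> bool" where
  "essential J \<longleftrightarrow> invsub J \<and> (\<forall>U. invsub U \<and> U \<inter> J = {0} \<longrightarrow> U = {0})"

text \<open>A subgroup normal in \<open>P\<close> that meets \<open>with_centr W\<close> trivially
  commutes with \<open>W\<close>; so it lies in the centralizer of \<open>W\<close>, hence in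
  \<open>with_centr W\<close>, and is trivial.\<close>

lemma essential_with_centr:
  assumes W: "invsub W"
  shows "essential (with_centr W)"
  unfolding essential_def
proof (intro conjI allI impI)
  show J: "invsub (with_centr W)" by (rule invsub_with_centr[OF W])
  fix U assume U: "invsub U \<and> U \<inter> with_centr W = {0}"
  have "0 \<in> W" "0 \<in> centr P W"
    using W invsub_centr[OF W] by (auto simp: invsub_def subgrp_zero)
  then have sub: "W \<subseteq> with_centr W" "centr P W \<subseteq> with_centr W"
    using with_centrI[of _ W 0] with_centrI[of 0 W] by auto
  have "u \<in> centr P W" if u: "u \<in> U" for u
  proof -
    have "u + w = w + u" if "w \<in> W" for w
      using invsub_commute[of U "with_centr W" u w] U J u that sub by blast
    then show ?thesis using U u by (auto simp: centr_def invsub_def)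
  qed
  then show "U = {0}" using U sub subgrp_zero unfolding invsub_def by blast
qed

lemma essential_Int: "essential J \<Longrightarrow> essential K \<Longrightarrow> essential (J \<inter> K)"
  unfolding essential_def
  by (metis (no_types, lifting) invsub_Int inf_assoc)

lemma essential_Inter:
  assumes "finite S" "S \<noteq> {}" "\<And>J. J \<in> S \<Longrightarrow> essential J"
  shows "essential (\<Inter>S)"
  using assms
proof (induction S rule: finite_ne_induct)
  case (insert J S)
  then show ?case using essential_Int by simp
qed simp

lemma essential_conj:
  assumes J: "essential J" and g: "g \<in> G"
  shows "essential (gconj g ` J)"
  unfolding essential_def
proof (intro conjI allI impI)
  show "invsub (gconj g ` J)" using J g invsub_conj by (simp add: essential_def)
  fix U assume U: "invsub U \<and> U \<inter> gconj g ` J = {0}"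
  have sJ: "subgrp J" using J by (simp add: essential_def invsub_def)
  have g': "- g \<in> G" using G g by (simp add: subgrp_uminus)
  then have U': "invsub (gconj (- g) ` U)" using U invsub_conj by blast
  have "gconj (- g) ` U \<inter> J \<subseteq> {0}"
  proof
    fix x assume "x \<in> gconj (- g) ` U \<inter> J"
    then have "gconj g x \<in> U" "gconj g x \<in> gconj g ` J" by auto
    then have "gconj g x = 0" using U by blast
    then show "x \<in> {0}" by simp
  qed
  then have "gconj (- g) ` U \<inter> J = {0}"
    using U' sJ subgrp_zero by (auto simp: invsub_def)
  then have "gconj (- g) ` U = {0}" using J U' by (simp add: essential_def)
  then have "gconj g ` gconj (- g) ` U = {0}" by simp
  then show "U = {0}" by (simp add: gconj_image_gconj_image)
qed

text \<open>Finitely many essential subgroups have nontrivial intersection; for the conjugates of an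
  essential subgroup this intersection is normal in \<^term>\<open>G\<close>, so just infiniteness applies.\<close>

lemma essential_finite_index:
  assumes J: "essential J"
  shows "almost_sub G J"
proof -
  let ?S = "(\<lambda>g. gconj g ` J) ` G"
  have 0: "0 \<in> G" using G by (rule subgrp_zero)
  have iJ: "subgrp J" "normalizes P J" "J \<subseteq> P" using J by (auto simp: essential_def invsub_def)
  have fin: "finite ?S" by (rule finite_conjugates[OF G P(1,3,4) iJ(2)])
  have D: "essential (\<Inter>?S)"
  proof (rule essential_Inter[OF fin])
    show "?S \<noteq> {}" using 0 by blast
    show "essential B" if "B \<in> ?S" for B using that essential_conj[OF J] by blast
  qed
  have "J \<in> ?S" using 0 by (intro image_eqI[of _ _ 0]) auto
  then have DJ: "\<Inter>?S \<subseteq> J" by blast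
  have "\<Inter>?S \<noteq> {0}"
  proof
    assume "\<Inter>?S = {0}"
    then have "P \<inter> \<Inter>?S = {0}" using subgrp_zero[OF P(1)] by auto
    then have "P = {0}" using D invsub_P unfolding essential_def by blast
    then show False using finite_index_nontrivial[OF P(4)] by simp
  qed
  moreover have "normalizes G (\<Inter>?S)"
    unfolding normalizes_def
  proof (intro ballI InterI)
    fix g x B assume g: "g \<in> G" and x: "x \<in> \<Inter>?S" and "B \<in> ?S"
    then obtain h where h: "h \<in> G" "B = gconj h ` J" by blast
    have "- g + h \<in> G" using G g h by (simp add: subgrp_closed)
    then have "x \<in> gconj (- g + h) ` J" using x by blast
    then have "gconj g x \<in> gconj g ` gconj (- g + h) ` J" by blast
    then show "gconj g x \<in> B" using h by (simp add: gconj_image_gconj_image)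
  qed
  moreover have "subgrp (\<Inter>?S)" using D unfolding essential_def invsub_def by (elim conjE)
  moreover have "\<Inter>?S \<subseteq> G" by (rule order_trans[OF DJ order_trans[OF iJ(3) P(2)]])
  ultimately have "almost_sub G (\<Inter>?S)" by (intro ji)
  then show ?thesis using DJ by (rule almost_sub_mono_right)
qed

lemma with_centr_finite_index: "invsub W \<Longrightarrow> almost_sub G (with_centr W)"
  by (rule essential_finite_index[OF essential_with_centr])

text \<open>The direct product of \<open>W\<close> and its centralizer has finite index in
  \<open>G\<close>, so it is finitely generated; the \<open>W\<close>-components of its generators
  then generate \<open>W\<close>.\<close>

lemma fg_invsub:
  assumes W: "invsub W"
  shows "fg W"
proof -
  have J: "invsub (with_centr W)" by (rule invsub_with_centr[OF W])
  have "fg (with_centr W)"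
    using J P(2) by (intro fg_finite_index_subgroup[OF fg_G _ _ with_centr_finite_index[OF W]])
      (auto simp: invsub_def)
  then obtain S where S: "finite S" "gspan S = with_centr W" by (auto simp: fg_def)
  have "\<forall>s\<in>S. \<exists>w. w \<in> W \<and> (\<exists>c\<in>centr P W. s = w + c)"
    using S gspan_superset[of S] by (blast elim: with_centrE)
  then obtain f where f: "\<forall>s\<in>S. f s \<in> W \<and> (\<exists>c\<in>centr P W. s = f s + c)" by metis
  have sW: "subgrp W" using W by (simp add: invsub_def)
  have C: "subgrp (centr P W)" by (rule subgrp_centr[OF P(1)])
  have fW: "gspan (f ` S) \<subseteq> W" using f by (intro gspan_least[OF sW]) auto
  let ?X = "{v + c | v c. v \<in> gspan (f ` S) \<and> c \<in> centr P W}"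
  have "gspan S \<subseteq> ?X"
  proof (rule gspan_right_closed)
    show "0 \<in> ?X" using subgrp_zero[OF gspan_subgrp] subgrp_zero[OF C] by force
    fix x s assume x: "x \<in> ?X" and s: "s \<in> S"
    obtain v c where v: "x = v + c" "v \<in> gspan (f ` S)" "c \<in> centr P W" using x by blast
    obtain d where d: "d \<in> centr P W" "s = f s + d" using f s by blast
    have fs: "f s \<in> gspan (f ` S)" "f s \<in> W" using s f gspan_superset[of "f ` S"] by auto
    have c1: "c + f s = f s + c" by (rule centr_commute[OF v(3) fs(2)])
    have c2: "(c - d) + - f s = - f s + (c - d)"
      by (rule centr_commute[OF subgrp_diff[OF C v(3) d(1)] subgrp_uminus[OF sW fs(2)]])
    have "x + s = v + (c + f s) + d" using v d(2) by (metis add.assoc)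
    then have "x + s = (v + f s) + (c + d)" using c1 by (simp add: add.assoc)
    moreover have "v + f s \<in> gspan (f ` S)" "v - f s \<in> gspan (f ` S)"
      using v fs gspan_subgrp subgrp_closed by blast+
    moreover have "x - s = (v - f s) + (c - d)"
    proof -
      have "x - s = v + c - (f s + d)" using v d(2) by simp
      also have "\<dots> = v + ((c - d) + - f s)" by (simp add: gassoc del: add_uminus_conv_diff)
      also have "\<dots> = (v - f s) + (c - d)"
        unfolding c2 by (simp add: gassoc del: add_uminus_conv_diff)
      finally show ?thesis .
    qed
    moreover have "c + d \<in> centr P W" "c - d \<in> centr P W"
      using v d C subgrp_closed by blast+
    ultimately show "x + s \<in> ?X \<and> x - s \<in> ?X" by blast
  qed
  have "W \<subseteq> gspan (f ` S)"
  proof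
    fix w assume w: "w \<in> W"
    then have "w \<in> with_centr W" using with_centrI[of w W 0] subgrp_zero[OF C] by simp
    then obtain v c where v: "w = v + c" "v \<in> gspan (f ` S)" "c \<in> centr P W"
      using \<open>gspan S \<subseteq> ?X\<close> S by blast
    then have "c \<in> W" using w fW subgrp_cancel_left[OF sW, of v c] by blast
    then have "c = 0" using v invsub_center_trivial[OF W] by blast
    then show "w \<in> gspan (f ` S)" using v by simp
  qed
  then show ?thesis using fgI[OF sW, of "f ` S"] S(1) f by blast
qed

lemma invsub_Int_P: "subgrp V \<Longrightarrow> normalizes P V \<Longrightarrow> invsub (V \<inter> P)"
  unfolding invsub_def using P(1) by (simp add: subgrp_Int normalizes_Int normalizes_self)

lemma fg_normalized:
  assumes V: "subgrp V" "V \<subseteq> G" "normalizes P V"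
  shows "fg V"
proof (rule fg_finite_index_overgroup)
  show "fg (V \<inter> P)" using V by (intro fg_invsub invsub_Int_P)
  show "almost_sub V (V \<inter> P)"
    using V P by (intro almost_sub_self_Int almost_sub_mono[OF P(4) _ order_refl])
qed (use V in auto)

text \<open>\<open>U\<close> meets the direct product of \<open>V \<inter> P\<close> and its
  centralizer in a subgroup of finite index. The centralizer component of an element of this meet
  lies in \<open>U\<close> again, so it vanishes by \<open>triv\<close> and the element is in
  \<open>V\<close>.\<close>

lemma almost_sub_if_no_centr:
  assumes V: "subgrp V" "normalizes P V" and U: "subgrp U" "U \<subseteq> G" "V \<subseteq> U"
    and triv: "U \<inter> centr P (V \<inter> P) \<subseteq> {0}"
  shows "almost_sub U V"
proof -
  have W: "invsub (V \<inter> P)" using V by (rule invsub_Int_P)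
  have J: "subgrp (with_centr (V \<inter> P))" using invsub_with_centr[OF W] by (simp add: invsub_def)
  have "almost_sub U (with_centr (V \<inter> P))"
    by (rule almost_sub_mono[OF with_centr_finite_index[OF W] U(2) order_refl])
  then have "almost_sub U (U \<inter> with_centr (V \<inter> P))" using U J by (intro almost_sub_self_Int)
  moreover have "U \<inter> with_centr (V \<inter> P) \<subseteq> V"
  proof
    fix u assume u: "u \<in> U \<inter> with_centr (V \<inter> P)"
    then obtain w c where w: "w \<in> V \<inter> P" "c \<in> centr P (V \<inter> P)" "u = w + c"
      using with_centrE by blast
    then have "c \<in> U" using u U subgrp_cancel_left[of U w c] by blast
    then have "c = 0" using w triv by blast
    then show "u \<in> V" using w by simp
  qed
  ultimately show ?thesis by (rule almost_sub_mono_right)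
qed

subsection \<open>Commuting families\<close>

text \<open>The number of members plays the part of a dimension: distinct members meet trivially, as
  their intersection is abelian and normal in \<open>P\<close>.\<close>

definition commuting_family :: "nat \<Rightarrow> 'g set \<Rightarrow> bool" where
  "commuting_family k V \<longleftrightarrow> (\<exists>M. (\<forall>i<k. invsub (M i) \<and> M i \<noteq> {0} \<and> M i \<subseteq> V) \<and>
     (\<forall>i<k. \<forall>j<k. i \<noteq> j \<longrightarrow> (\<forall>x\<in>M i. \<forall>y\<in>M j. x + y = y + x)))"

lemma commuting_family_mono: "commuting_family k V \<Longrightarrow> V \<subseteq> U \<Longrightarrow> commuting_family k U"
proof -
  assume fam: "commuting_family k V" and VU: "V \<subseteq> U"
  obtain M where M: "\<forall>i<k. invsub (M i) \<and> M i \<noteq> {0} \<and> M i \<subseteq> V"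
    and comm: "\<forall>i<k. \<forall>j<k. i \<noteq> j \<longrightarrow> (\<forall>x\<in>M i. \<forall>y\<in>M j. x + y = y + x)"
    using fam unfolding commuting_family_def by (elim exE conjE)
  have "\<forall>i<k. invsub (M i) \<and> M i \<noteq> {0} \<and> M i \<subseteq> U"
    using M VU by (auto dest: order_trans)
  then show ?thesis unfolding commuting_family_def using comm by (intro exI[of _ M] conjI)
qed

text \<open>Otherwise \<open>U\<close> would commute with every conjugate of \<open>M\<close>; these
  span a nontrivial normal subgroup of \<open>G\<close>, hence one of finite index, whose
  centralizer is trivial.\<close>

lemma conj_meets:
  assumes U: "invsub U" "U \<noteq> {0}" and M: "invsub M" "M \<noteq> {0}"
  shows "\<exists>g\<in>G. U \<inter> gconj g ` M \<noteq> {0}"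
proof (rule ccontr)
  assume "\<not> ?thesis"
  then have triv: "U \<inter> gconj g ` M = {0}" if "g \<in> G" for g using that by blast
  define X0 where "X0 = (\<Union>g\<in>G. gconj g ` M)"
  have comm: "\<forall>x\<in>X0. \<forall>y\<in>U. x + y = y + x"
  proof (intro ballI)
    fix x y assume "x \<in> X0" and y: "y \<in> U"
    then obtain g where g: "g \<in> G" "x \<in> gconj g ` M" unfolding X0_def by blast
    show "x + y = y + x"
      by (rule invsub_commute[OF U(1) invsub_conj[OF M(1) g(1)] triv[OF g(1)] y g(2), symmetric])
  qed
  have XG: "X0 \<subseteq> G" using M(1) P(2) G subgrp_gconj[OF G] unfolding X0_def invsub_def by blast
  have idx: "almost_sub G (gspan X0)"
  proof (rule ji[OF gspan_subgrp])
    show "gspan X0 \<subseteq> G" by (rule gspan_least[OF G XG])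
    show "normalizes G (gspan X0)"
      unfolding X0_def by (rule normalizes_gspan_conjugates[OF G])
    have "M \<subseteq> X0" unfolding X0_def using subgrp_zero[OF G] by force
    then show "gspan X0 \<noteq> {0}" using M gspan_superset[of X0] subgrp_zero unfolding invsub_def by blast
  qed
  have "u = 0" if u: "u \<in> U" for u
  proof (rule centr_finite_index_trivial[OF gspan_least[OF G XG] idx])
    show "u \<in> G" using u U(1) P(2) unfolding invsub_def by blast
    have "u \<in> gspan U" using u gspan_superset by blast
    then show "\<forall>q\<in>gspan X0. q + u = u + q" using gspan_commute[OF comm] by blast
  qed
  then show False using U subgrp_zero unfolding invsub_def by blast
qed

text \<open>Suitable conjugates of the \<open>k\<close> members have a common nonzero element. If
  two of the conjugating elements lay in the same coset of \<open>P\<close>, a conjugate of that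
  element would lie in two members at once. So the cosets are distinct, and \<open>k\<close> is at
  most \<open>card F\<close>.\<close>

lemma commuting_family_bounded: "\<exists>b. \<forall>k V. commuting_family k V \<longrightarrow> k \<le> b"
proof -
  obtain F where F: "finite F" "F \<subseteq> G" "\<forall>a\<in>G. \<exists>f\<in>F. a - f \<in> P"
    by (rule almost_sub_reps[OF P(4,1)])
  have "k \<le> card F" if fam: "commuting_family k V" for k V
  proof -
    obtain M where M: "\<forall>i<k. invsub (M i) \<and> M i \<noteq> {0} \<and> M i \<subseteq> V"
      and comm: "\<forall>i<k. \<forall>j<k. i \<noteq> j \<longrightarrow> (\<forall>x\<in>M i. \<forall>y\<in>M j. x + y = y + x)"
      using fam unfolding commuting_family_def by (elim exE conjE)
    \<comment> \<open>The factor \<open>P\<close> makes the empty intersection an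
      \<open>invsub\<close>, so that the induction can start at 0.\<close>
    have meet: "\<exists>g. (\<forall>i<m. g i \<in> G) \<and> invsub (P \<inter> (\<Inter>i<m. gconj (g i) ` M i)) \<and>
        P \<inter> (\<Inter>i<m. gconj (g i) ` M i) \<noteq> {0}" if "m \<le> k" for m
      using that
    proof (induction m)
      case 0
      then show ?case using invsub_P finite_index_nontrivial[OF P(4)] by simp
    next
      case (Suc m)
      obtain g where g: "\<forall>i<m. g i \<in> G" "invsub (P \<inter> (\<Inter>i<m. gconj (g i) ` M i))"
        "P \<inter> (\<Inter>i<m. gconj (g i) ` M i) \<noteq> {0}"
        using Suc.IH[OF Suc_leD[OF Suc.prems]] by (elim exE conjE)
      obtain h where h: "h \<in> G" "P \<inter> (\<Inter>i<m. gconj (g i) ` M i) \<inter> gconj h ` M m \<noteq> {0}"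
        using conj_meets[OF g(2,3), of "M m"] M Suc.prems by auto
      let ?g = "g(m := h)"
      have eq: "P \<inter> (\<Inter>i<Suc m. gconj (?g i) ` M i)
          = P \<inter> (\<Inter>i<m. gconj (g i) ` M i) \<inter> gconj h ` M m"
      proof -
        have "(\<Inter>i<m. gconj (?g i) ` M i) = (\<Inter>i<m. gconj (g i) ` M i)"
          by (rule INF_cong) auto
        then show ?thesis by (simp add: lessThan_Suc Int_ac)
      qed
      have "invsub (P \<inter> (\<Inter>i<m. gconj (g i) ` M i) \<inter> gconj h ` M m)"
        using M Suc.prems h(1) by (intro invsub_Int[OF g(2)] invsub_conj) auto
      moreover have "\<forall>i<Suc m. ?g i \<in> G" using g(1) h(1) by (simp add: less_Suc_eq)
      ultimately show ?case using h(2) unfolding eq[symmetric] by (intro exI[of _ ?g] conjI)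
    qed
    obtain g where g: "\<forall>i<k. g i \<in> G" "invsub (P \<inter> (\<Inter>i<k. gconj (g i) ` M i))"
        "P \<inter> (\<Inter>i<k. gconj (g i) ` M i) \<noteq> {0}"
      using meet[OF order_refl] by (elim exE conjE)
    obtain x where x: "x \<noteq> 0" "x \<in> P \<inter> (\<Inter>i<k. gconj (g i) ` M i)"
      using g(2,3) subgrp_nontrivial[of "P \<inter> (\<Inter>i<k. gconj (g i) ` M i)"] unfolding invsub_def by blast
    have "\<exists>f. i < k \<longrightarrow> f \<in> F \<and> g i - f \<in> P" for i
      using bspec[OF F(3), of "g i"] g(1) by auto
    then obtain c where c: "\<forall>i<k. c i \<in> F \<and> g i - c i \<in> P" by metis
    have "inj_on c {..<k}"
    proof (rule inj_onI, rule ccontr)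
      fix i j assume ij: "i \<in> {..<k}" "j \<in> {..<k}" "c i = c j" "i \<noteq> j"
      then have "(g i - c i) - (g j - c i) \<in> P" using c P(1) by (metis lessThan_iff subgrp_diff)
      then have p: "g i - g j \<in> P" by (simp add: gassoc del: add_uminus_conv_diff)
      have Mi: "invsub (M i)" "invsub (M j)" using M ij by auto
      have "gconj (g i) ` M i = gconj (g i - g j) ` gconj (g j) ` M i"
        by (simp add: gconj_image_gconj_image)
      also have "\<dots> = gconj (g j) ` M i"
        using invsub_conj[OF Mi(1), of "g j"] g(1) ij p P(1)
        by (intro normalizes_image[of P]) (auto simp: invsub_def)
      finally have "x \<in> gconj (g j) ` M i" "x \<in> gconj (g j) ` M j" using x(2) ij by auto
      then have y: "gconj (- g j) x \<in> M i \<inter> M j" by (metis IntI gconj_minus_cancel(1) imageE)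
      have "M i \<inter> M j = {0}"
      proof (rule abelian_invsub_trivial[OF invsub_Int[OF Mi]])
        show "\<forall>x\<in>M i \<inter> M j. \<forall>y\<in>M i \<inter> M j. x + y = y + x"
          using comm ij by (metis IntD1 IntD2 lessThan_iff)
      qed
      then show False using y x(1) by auto
    qed
    moreover have "c ` {..<k} \<subseteq> F" using c by blast
    ultimately show ?thesis using card_inj_on_le[of c "{..<k}" F] F(1) by simp
  qed
  then show ?thesis by blast
qed

text \<open>The maximum exists: the set is finite by \<open>commuting_family_finite\<close> and
  contains 0.\<close>

definition crank :: "'g set \<Rightarrow> nat" where
  "crank V = Max {k. commuting_family k V}"

lemma commuting_family_finite: "finite {k. commuting_family k V}"
  using commuting_family_bounded by (metis (no_types, lifting) bounded_nat_set_is_finite le_imp_less_Suc mem_Collect_eq)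

lemma commuting_family_0: "commuting_family 0 V"
  by (simp add: commuting_family_def)

lemma commuting_family_crank: "commuting_family (crank V) V"
  using Max_in[OF commuting_family_finite] commuting_family_0 unfolding crank_def by blast

lemma commuting_family_le_crank: "commuting_family k V \<Longrightarrow> k \<le> crank V"
  using Max_ge[OF commuting_family_finite] unfolding crank_def by blast

lemma crank_mono: "V \<subseteq> U \<Longrightarrow> crank V \<le> crank U"
  using commuting_family_le_crank commuting_family_mono commuting_family_crank by blast

text \<open>By \<open>almost_sub_if_no_centr\<close>, infinite index leaves a nontrivial subgroup
  \<open>N\<close> of \<open>U \<inter> P\<close> centralizing \<open>V \<inter> P\<close>. It
  commutes with a largest family in \<open>V\<close> and enlarges it by one member inside
  \<open>U\<close>.\<close>

lemma crank_less:
  assumes V: "subgrp V" "normalizes P V" and U: "subgrp U" "U \<subseteq> G" "normalizes P U" "V \<subseteq> U"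
    and inf: "\<not> almost_sub U V"
  shows "crank V < crank U"
proof -
  have W: "invsub (V \<inter> P)" using V by (rule invsub_Int_P)
  define N where "N = (U \<inter> P) \<inter> centr P (V \<inter> P)"
  have N: "invsub N" unfolding N_def by (rule invsub_Int[OF invsub_Int_P[OF U(1,3)] invsub_centr[OF W]])
  have "\<not> U \<inter> centr P (V \<inter> P) \<subseteq> {0}" using almost_sub_if_no_centr V U inf by blast
  then have N0: "N \<noteq> {0}" using centr_subset unfolding N_def by blast
  let ?k = "crank V"
  obtain M where M: "\<forall>i<?k. invsub (M i) \<and> M i \<noteq> {0} \<and> M i \<subseteq> V"
    and comm: "\<forall>i<?k. \<forall>j<?k. i \<noteq> j \<longrightarrow> (\<forall>x\<in>M i. \<forall>y\<in>M j. x + y = y + x)"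
    using commuting_family_crank[of V] unfolding commuting_family_def by (elim exE conjE)
  have MN: "x + y = y + x" "y + x = x + y" if "i < ?k" "x \<in> M i" "y \<in> N" for i x y
  proof -
    have "x \<in> V \<inter> P" using M that unfolding invsub_def by blast
    then show "x + y = y + x" using centr_commute[of y "V \<inter> P" x] that unfolding N_def by simp
    then show "y + x = x + y" by simp
  qed
  have "commuting_family (Suc ?k) U"
    unfolding commuting_family_def
  proof (intro exI[of _ "M(?k := N)"] conjI allI impI ballI)
    fix i assume i: "i < Suc ?k"
    show "invsub ((M(?k := N)) i)" "(M(?k := N)) i \<noteq> {0}" "(M(?k := N)) i \<subseteq> U"
      using i M N N0 U(4) by (auto simp: less_Suc_eq N_def)
    fix j x y assume j: "j < Suc ?k" "i \<noteq> j" and x: "x \<in> (M(?k := N)) i" and y: "y \<in> (M(?k := N)) j"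
    consider "i = ?k" "j < ?k" | "j = ?k" "i < ?k" | "i < ?k" "j < ?k"
      using i j by linarith
    then show "x + y = y + x"
    proof cases
      case 1 then show ?thesis using MN(2)[of j y x] x y by simp
    next
      case 2 then show ?thesis using MN(1)[of i x y] x y by simp
    next
      case 3
      then have "x \<in> M i" "y \<in> M j" using x y by simp_all
      then show ?thesis using comm 3 j(2) by blast
    qed
  qed
  then show ?thesis using commuting_family_le_crank by fastforce
qed

end

subsection \<open>Infra-direct subgroups\<close>

text \<open>\<open>L\<close> stands for the stabilizer of \<open>Y\<close> and \<open>psi y\<close>
  for the section at \<open>y\<close>. What is kept of the tree is that \<open>L\<close> has finite
  index and that the sections are jointly injective homomorphisms from \<open>L\<close> to
  \<open>G\<close>.\<close>

locale section_family = ji_group G for G :: "'g::group_add set" +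
  fixes L :: "'g set" and Y :: "'i set" and psi :: "'i \<Rightarrow> 'g \<Rightarrow> 'g"
  assumes L: "subgrp L" "L \<subseteq> G" "almost_sub G L"
    and finite_Y: "finite Y"
    and psi_hom: "y \<in> Y \<Longrightarrow> hom_on L (psi y)"
    and psi_range: "y \<in> Y \<Longrightarrow> psi y ` L \<subseteq> G"
    and psi_faithful: "g \<in> L \<Longrightarrow> \<forall>y\<in>Y. psi y g = 0 \<Longrightarrow> g = 0"
begin

definition infra :: "'g set \<Rightarrow> bool" where
  "infra H \<longleftrightarrow> subgrp H \<and> H \<subseteq> G \<and> (\<forall>y\<in>Y. almost_sub G (psi y ` (H \<inter> L)))"

text \<open>Enlarging \<open>Z\<close> by one leaf at a time filters \<open>K \<inter> L\<close>. By
  \<open>part_kernel\<close> the layer added with \<open>y\<close> is isomorphic to its image under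
  \<open>psi y\<close>, a subgroup of \<open>G\<close>.\<close>

definition part :: "'g set \<Rightarrow> 'i set \<Rightarrow> 'g set" where
  "part K Z = {g \<in> K \<inter> L. \<forall>y\<in>Y - Z. psi y g = 0}"

lemma infra_mono: "infra H \<Longrightarrow> H \<subseteq> K \<Longrightarrow> subgrp K \<Longrightarrow> K \<subseteq> G \<Longrightarrow> infra K"
  unfolding infra_def
  by (metis (no_types, lifting) Int_mono almost_sub_mono_right image_mono order_refl)

lemma part_subset: "part K Z \<subseteq> K \<inter> L"
  by (auto simp: part_def)

lemma part_mono: "H \<subseteq> K \<Longrightarrow> part H Z \<subseteq> part K Z"
  by (auto simp: part_def)

lemma part_subgrp: "subgrp K \<Longrightarrow> subgrp (part K Z)"
  using L(1) hom_on_zero[OF psi_hom L(1)] hom_on_add[OF psi_hom] hom_on_uminus[OF psi_hom L(1)]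
  by (intro subgrpI) (auto simp: part_def subgrp_closed)

lemma part_empty: "subgrp K \<Longrightarrow> part K {} = {0}"
  using psi_faithful subgrp_zero[OF part_subgrp, of K "{}"] by (auto simp: part_def)

lemma part_all: "part K Y = K \<inter> L"
  by (auto simp: part_def)

lemma part_kernel: "y \<in> Y \<Longrightarrow> y \<notin> Z \<Longrightarrow> {g \<in> part K (insert y Z). psi y g = 0} = part K Z"
  by (auto simp: part_def)

lemma psi_hom_part: "y \<in> Y \<Longrightarrow> hom_on (part K Z) (psi y)"
  by (rule hom_on_subset[OF psi_hom]) (auto simp: part_def)

lemma psi_image_subgrp: "y \<in> Y \<Longrightarrow> subgrp K \<Longrightarrow> subgrp (psi y ` part K Z)"
  by (rule hom_on_image_subgrp[OF psi_hom_part part_subgrp])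

lemma psi_image_subset: "y \<in> Y \<Longrightarrow> psi y ` part K Z \<subseteq> G"
  using psi_range by (auto simp: part_def)

lemma psi_gconj:
  "y \<in> Y \<Longrightarrow> g \<in> L \<Longrightarrow> h \<in> L \<Longrightarrow> psi y (gconj g h) = gconj (psi y g) (psi y h)"
  using L(1) psi_hom[of y]
  by (simp add: gconj_def hom_on_add[of L] hom_on_diff[of L] subgrp_add)

text \<open>Conjugation by \<open>H \<inter> L\<close> preserves the vanishing of sections, hence
  the filtration of every overgroup \<open>K\<close>. For an \<open>infra H\<close>, one subgroup of
  finite index in \<open>G\<close> thus normalizes the layers at \<open>y\<close> of all
  overgroups.\<close>

lemma psi_image_normalized:
  assumes y: "y \<in> Y" and K: "subgrp K" "H \<subseteq> K"
  shows "normalizes (psi y ` (H \<inter> L)) (psi y ` part K Z)"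
  unfolding normalizes_def
proof (intro ballI)
  fix p x assume "p \<in> psi y ` (H \<inter> L)" "x \<in> psi y ` part K Z"
  then obtain h g where h: "h \<in> H" "h \<in> L" "p = psi y h" and g: "g \<in> part K Z" "x = psi y g"
    by blast
  have gKL: "g \<in> K" "g \<in> L" "\<forall>z\<in>Y - Z. psi z g = 0" using g by (auto simp: part_def)
  have "gconj h g \<in> K" "gconj h g \<in> L"
    using h gKL K L(1) by (auto simp: subgrp_closed subset_eq)
  moreover have "psi z (gconj h g) = 0" if "z \<in> Y - Z" for z
    using that gKL h by (simp add: psi_gconj)
  ultimately have "gconj h g \<in> part K Z" by (simp add: part_def)
  moreover have "gconj p x = psi y (gconj h g)" using y h g gKL by (simp add: psi_gconj)
  ultimately show "gconj p x \<in> psi y ` part K Z" by blast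
qed

lemma infra_core:
  assumes H: "infra H" and y: "y \<in> Y"
  obtains P where "ji_normal G P" "P \<subseteq> psi y ` (H \<inter> L)"
proof -
  have sH: "subgrp H" using H by (simp add: infra_def)
  have Q: "subgrp (psi y ` (H \<inter> L))" "psi y ` (H \<inter> L) \<subseteq> G" "almost_sub G (psi y ` (H \<inter> L))"
    using psi_image_subgrp[OF y sH, of Y] psi_image_subset[OF y, of H Y] H y
    by (auto simp: part_all infra_def)
  obtain P where P: "subgrp P" "P \<subseteq> psi y ` (H \<inter> L)" "normalizes G P" "almost_sub G P"
    by (rule finite_index_core[OF G Q])
  have "ji_normal G P"
    by unfold_locales (use P Q(2) in auto)
  then show thesis using that P(2) by blast
qed

text \<open>Induction over the leaves: each layer is normalized by a finite-index normal subgroup of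
  \<open>G\<close>, hence finitely generated by \<open>fg_normalized\<close>.\<close>

lemma infra_fg:
  assumes H: "infra H"
  shows "fg H"
proof -
  have sH: "subgrp H" and HG: "H \<subseteq> G" using H by (auto simp: infra_def)
  have "fg (part H Z)" if "finite Z" "Z \<subseteq> Y" for Z
    using that
  proof (induction Z rule: finite_induct)
    case empty
    have "gspan {} \<subseteq> {0::'g}" by (rule gspan_least) (auto simp: subgrp_def)
    then have "gspan {} = {0::'g}" using subgrp_zero[OF gspan_subgrp] by blast
    then show ?case using part_empty[OF sH] by (auto simp: fg_def)
  next
    case (insert y Z)
    then have y: "y \<in> Y" by simp
    obtain P where PH: "ji_normal G P" "P \<subseteq> psi y ` (H \<inter> L)" by (rule infra_core[OF H y])
    interpret ji_normal G P by (rule PH(1))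
    have "fg (psi y ` part H (insert y Z))"
      by (rule fg_normalized[OF psi_image_subgrp[OF y sH] psi_image_subset[OF y]
          normalizes_subset[OF psi_image_normalized[OF y sH order_refl] PH(2)]])
    moreover have "fg {g \<in> part H (insert y Z). psi y g = 0}"
      using insert part_kernel[OF y] by simp
    ultimately show ?case using fg_extension[OF part_subgrp[OF sH] psi_hom_part[OF y]] by blast
  qed
  then have "fg (H \<inter> L)" using finite_Y part_all by fastforce
  moreover have "almost_sub H (H \<inter> L)"
    by (rule almost_sub_self_Int[OF almost_sub_mono[OF L(3) HG order_refl] sH L(1)])
  ultimately show ?thesis using fg_finite_index_overgroup[of "H \<inter> L" H] sH by blast
qed

lemma almost_sub_if_parts:
  assumes "subgrp H" "subgrp K" "K \<subseteq> G" "almost_sub (part K Y) (part H Y)"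
  shows "almost_sub K H"
proof -
  have "almost_sub K (K \<inter> L)"
    by (rule almost_sub_self_Int[OF almost_sub_mono[OF L(3) assms(3) order_refl] assms(2) L(1)])
  moreover have "almost_sub (K \<inter> L) (H \<inter> L)" using assms(4) by (simp add: part_all)
  ultimately have "almost_sub K (H \<inter> L)" by (rule almost_sub_trans)
  then show ?thesis by (rule almost_sub_mono_right) blast
qed

text \<open>The rank of an overgroup is the sum over the leaves of the \<open>crank\<close> of its
  layers. At each leaf \<open>P\<close> is chosen from \<open>H\<close>, so one and the same
  \<open>crank\<close> measures all overgroups.\<close>

lemma infra_rank:
  assumes H: "infra H"
  obtains rk :: "'g set \<Rightarrow> nat" and b where
    "\<And>K K'. subgrp K \<Longrightarrow> subgrp K' \<Longrightarrow> K' \<subseteq> G \<Longrightarrow> H \<subseteq> K \<Longrightarrow> K \<subseteq> K' \<Longrightarrow>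
       rk K \<le> rk K' \<and> rk K' \<le> b \<and> (\<not> almost_sub K' K \<longrightarrow> rk K < rk K')"
proof -
  define ok where "ok K K' \<longleftrightarrow> subgrp K \<and> subgrp K' \<and> K' \<subseteq> G \<and> H \<subseteq> K \<and> K \<subseteq> K'" for K K'
  have "\<exists>(rk :: 'g set \<Rightarrow> nat) b. \<forall>K K'. ok K K' \<longrightarrow> rk K \<le> rk K' \<and> rk K' \<le> b \<and>
      (\<not> almost_sub (part K' Z) (part K Z) \<longrightarrow> rk K < rk K')" if "finite Z" "Z \<subseteq> Y" for Z
    using that
  proof (induction Z rule: finite_induct)
    case empty
    then show ?case
      by (intro exI[of _ "\<lambda>_. 0"] exI[of _ 0]) (auto simp: ok_def part_empty almost_sub_subset)
  next
    case (insert y Z)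
    then have y: "y \<in> Y" and yZ: "y \<notin> Z" by simp_all
    obtain rk :: "'g set \<Rightarrow> nat" and b where rk: "\<forall>K K'. ok K K' \<longrightarrow> rk K \<le> rk K' \<and> rk K' \<le> b \<and>
      (\<not> almost_sub (part K' Z) (part K Z) \<longrightarrow> rk K < rk K')"
      using insert by (elim meta_impE exE) auto
    obtain P where PH: "ji_normal G P" "P \<subseteq> psi y ` (H \<inter> L)" by (rule infra_core[OF H y])
    interpret ji_normal G P by (rule PH(1))
    obtain b' where b': "\<forall>k V. commuting_family k V \<longrightarrow> k \<le> b'" using commuting_family_bounded by blast
    let ?V = "\<lambda>K. psi y ` part K (insert y Z)"
    let ?rk = "\<lambda>K. rk K + crank (?V K)"
    have "?rk K \<le> ?rk K' \<and> ?rk K' \<le> b + b' \<and>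
      (\<not> almost_sub (part K' (insert y Z)) (part K (insert y Z)) \<longrightarrow> ?rk K < ?rk K')"
      if okK: "ok K K'" for K K'
    proof -
      have K: "subgrp K" "subgrp K'" "K' \<subseteq> G" "H \<subseteq> K" "K \<subseteq> K'" "H \<subseteq> K'"
        using okK by (auto simp: ok_def)
      have rkK: "rk K \<le> rk K'" "rk K' \<le> b"
        "\<not> almost_sub (part K' Z) (part K Z) \<Longrightarrow> rk K < rk K'" using rk okK by blast+
      have VV: "?V K \<subseteq> ?V K'" using part_mono[OF K(5)] by blast
      have c: "crank (?V K) \<le> crank (?V K')" by (rule crank_mono[OF VV])
      have c': "crank (?V K') \<le> b'" using b' commuting_family_crank by blast
      have "?rk K < ?rk K'" if inf: "\<not> almost_sub (part K' (insert y Z)) (part K (insert y Z))"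
      proof (cases "almost_sub (?V K') (?V K)")
        case True
        \<comment> \<open>Finite index in the layer at \<open>y\<close> pushes the infinite index
          down to the kernel, where the induction hypothesis applies.\<close>
        have "\<not> almost_sub (part K' Z) (part K Z)"
        proof
          assume "almost_sub (part K' Z) (part K Z)"
          then have "almost_sub {g \<in> part K' (insert y Z). psi y g = 0}
              {g \<in> part K (insert y Z). psi y g = 0}"
            by (simp only: part_kernel[OF y yZ])
          then have "almost_sub (part K' (insert y Z)) (part K (insert y Z))"
            by (rule almost_sub_extension[OF part_subgrp[OF K(1)] part_subgrp[OF K(2)]
                part_mono[OF K(5)] psi_hom_part[OF y] True])
          then show False using inf by blast
        qed
        then show ?thesis using rkK(3) c by linarith
      next
        case False
        have "crank (?V K) < crank (?V K')"
          by (rule crank_less[OF psi_image_subgrp[OF y K(1)]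
              normalizes_subset[OF psi_image_normalized[OF y K(1,4)] PH(2)]
              psi_image_subgrp[OF y K(2)] psi_image_subset[OF y]
              normalizes_subset[OF psi_image_normalized[OF y K(2,6)] PH(2)] VV False])
        then show ?thesis using rkK(1) by linarith
      qed
      then show ?thesis using rkK(1,2) c c' by linarith
    qed
    then show ?case by (intro exI[of _ ?rk] exI[of _ "b + b'"]) blast
  qed
  from this[OF finite_Y order_refl] obtain rk :: "'g set \<Rightarrow> nat" and b where
    rk: "\<forall>K K'. ok K K' \<longrightarrow> rk K \<le> rk K' \<and> rk K' \<le> b \<and>
      (\<not> almost_sub (part K' Y) (part K Y) \<longrightarrow> rk K < rk K')" by (elim exE)
  show thesis
  proof (rule that)
    fix K K' assume K: "subgrp K" "subgrp K'" "K' \<subseteq> G" "H \<subseteq> K" "K \<subseteq> K'"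
    then have "ok K K'" by (simp add: ok_def)
    moreover have "almost_sub (part K' Y) (part K Y) \<longrightarrow> almost_sub K' K"
      using almost_sub_if_parts[OF K(1-3)] by blast
    ultimately show "rk K \<le> rk K' \<and> rk K' \<le> b \<and> (\<not> almost_sub K' K \<longrightarrow> rk K < rk K')"
      using rk by blast
  qed
qed

section \<open>The commensurator and overgroups of finite index\<close>

definition commensurator :: "'g set \<Rightarrow> 'g set" where
  "commensurator H = {t \<in> G. almost_sub (gconj t ` H) H \<and> almost_sub H (gconj t ` H)}"

lemma commensurator_subgrp: "subgrp (commensurator H)"
proof (rule subgrpI)
  show "0 \<in> commensurator H"
    using G by (simp add: commensurator_def subgrp_zero almost_sub_subset)
  show "s + t \<in> commensurator H" if st: "s \<in> commensurator H" "t \<in> commensurator H" for s t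
  proof -
    have t: "almost_sub (gconj s ` gconj t ` H) (gconj s ` H)" "almost_sub (gconj s ` H) (gconj s ` gconj t ` H)"
      using st by (auto simp: commensurator_def intro: almost_sub_gconj)
    have s: "almost_sub (gconj s ` H) H" "almost_sub H (gconj s ` H)" "s + t \<in> G"
      using st G by (auto simp: commensurator_def subgrp_closed)
    show ?thesis
      using almost_sub_trans[OF t(1) s(1)] almost_sub_trans[OF s(2) t(2)] s(3)
      by (simp add: commensurator_def gconj_image_gconj_image)
  qed
  show "- t \<in> commensurator H" if t: "t \<in> commensurator H" for t
  proof -
    have "almost_sub (gconj (- t) ` gconj t ` H) (gconj (- t) ` H)"
      "almost_sub (gconj (- t) ` H) (gconj (- t) ` gconj t ` H)"
      using t by (auto simp: commensurator_def simp del: gconj_minus_cancel intro!: almost_sub_gconj)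
    then show ?thesis using t G by (simp add: commensurator_def gconj_image_gconj_image subgrp_uminus)
  qed
qed

lemma subset_commensurator:
  assumes "subgrp H" "subgrp K" "H \<subseteq> K" "K \<subseteq> G" "almost_sub K H"
  shows "K \<subseteq> commensurator H"
proof
  fix k assume k: "k \<in> K"
  have eq: "gconj k ` K = K" by (rule gconj_image_self[OF assms(2) k])
  have "gconj k ` H \<subseteq> K" using eq assms(3) by blast
  then have "almost_sub (gconj k ` H) H" by (rule almost_sub_mono[OF assms(5) _ order_refl])
  moreover have "almost_sub H (gconj k ` H)"
    using almost_sub_mono[OF almost_sub_gconj[OF assms(5), of k] _ order_refl, of H] eq assms(3) by simp
  ultimately show "k \<in> commensurator H" using k assms(4) by (auto simp: commensurator_def)
qed

text \<open>Layer by layer, \<open>almost_sub_if_no_centr\<close> asks for the triviality of a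
  section \<open>u\<close> of some \<open>t\<close> in the commensurator if \<open>u\<close>
  centralizes the intersection of \<open>P\<close> with the layer of \<open>H\<close>. Commutators
  of \<open>t\<close> with a finite-index subgroup of \<open>H \<inter> L\<close> fall into the
  layer of \<open>H\<close>, which forces \<open>u\<close> to commute with a finite-index subgroup
  of \<open>G\<close>.\<close>

lemma commensurator_finite_index:
  assumes H: "infra H"
  shows "almost_sub (commensurator H) H"
proof -
  let ?T = "commensurator H"
  have sH: "subgrp H" and HG: "H \<subseteq> G" using H by (auto simp: infra_def)
  have T: "subgrp ?T" "?T \<subseteq> G" "H \<subseteq> ?T"
    using commensurator_subgrp subset_commensurator[OF sH sH _ HG] almost_sub_subset
    by (auto simp: commensurator_def)
  have "almost_sub (part ?T Z) (part H Z)" if "finite Z" "Z \<subseteq> Y" for Z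
    using that
  proof (induction Z rule: finite_induct)
    case empty
    then show ?case using sH T by (simp add: part_empty almost_sub_subset)
  next
    case (insert y Z)
    then have y: "y \<in> Y" and yZ: "y \<notin> Z" by simp_all
    obtain P where PH: "ji_normal G P" "P \<subseteq> psi y ` (H \<inter> L)" by (rule infra_core[OF H y])
    interpret ji_normal G P by (rule PH(1))
    let ?V = "psi y ` part H (insert y Z)" and ?U = "psi y ` part ?T (insert y Z)"
    have V: "subgrp ?V" "normalizes P ?V"
      using psi_image_subgrp[OF y sH] normalizes_subset[OF psi_image_normalized[OF y sH order_refl] PH(2)]
      by auto
    have W: "invsub (?V \<inter> P)" by (rule invsub_Int_P[OF V])
    have "?U \<inter> centr P (?V \<inter> P) \<subseteq> {0}"
    proof
      fix u assume u: "u \<in> ?U \<inter> centr P (?V \<inter> P)"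
      then obtain t where t: "t \<in> part ?T (insert y Z)" "u = psi y t" by blast
      have uP: "u \<in> P" using u centr_subset by blast
      have tL: "t \<in> L" "t \<in> ?T" "t \<in> G" using t part_subset T(2) by blast+
      \<comment> \<open>Elements of \<open>H0\<close> stay in \<open>H\<close> when conjugated by
        \<open>t\<close>, and \<open>H0\<close> has finite index in \<open>H \<inter> L\<close>
        because \<open>- t\<close> is in the commensurator.\<close>
      define H0 where "H0 = H \<inter> gconj (- t) ` H \<inter> L"
      have sc: "subgrp (gconj (- t) ` H)" by (rule subgrp_gconj_image[OF sH])
      have "- t \<in> ?T" by (rule subgrp_uminus[OF T(1) tL(2)])
      then have "almost_sub H (gconj (- t) ` H)" by (simp add: commensurator_def)
      then have "almost_sub H (H \<inter> gconj (- t) ` H)" by (rule almost_sub_self_Int[OF _ sH sc])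
      then have "almost_sub (H \<inter> L) (H \<inter> gconj (- t) ` H)"
        by (rule almost_sub_mono) auto
      then have "almost_sub (H \<inter> L) H0"
        unfolding H0_def
        by (rule almost_sub_Int[OF _ almost_sub_subset[OF Int_lower2] subgrp_Int[OF sH sc] L(1)])
      moreover have sH0: "subgrp H0" unfolding H0_def by (intro subgrp_Int sH sc L(1))
      moreover have H0L: "H0 \<subseteq> H \<inter> L" unfolding H0_def by blast
      ultimately have "almost_sub (psi y ` (H \<inter> L)) (psi y ` H0)"
        by (intro almost_sub_image[OF _ subgrp_Int[OF sH L(1)]] hom_on_subset[OF psi_hom[OF y]]) simp_all
      moreover have "almost_sub G (psi y ` (H \<inter> L))" using H y by (simp add: infra_def)
      ultimately have "almost_sub G (psi y ` H0)" using almost_sub_trans by blast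
      moreover have QG: "psi y ` H0 \<subseteq> G" using H0L psi_range[OF y] by blast
      moreover have sQ: "subgrp (psi y ` H0)"
        using H0L by (intro hom_on_image_subgrp[OF hom_on_subset[OF psi_hom[OF y]] sH0]) auto
      ultimately have idx: "almost_sub G (psi y ` H0 \<inter> P)"
        using P(4) P(1) by (intro almost_sub_Int) auto
      have comm: "q + u = u + q" if q: "q \<in> psi y ` H0 \<inter> P" for q
      proof -
        obtain h where h: "h \<in> H0" "q = psi y h" using q by blast
        have hL: "h \<in> H" "h \<in> L" using h H0L by auto
        have "gconj t h \<in> H" using h unfolding H0_def by auto
        then have 1: "gconj t h - h \<in> H" using sH hL by (simp add: subgrp_diff)
        \<comment> \<open>The commutator of \<open>t\<close> and \<open>h\<close> read in two ways:
          the left form lies in \<open>H\<close>, the right form in the filtration of the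
          commensurator. Its section therefore lies in the layer of \<open>H\<close>, and also in
          the centralizer, and these meet trivially inside \<open>P\<close>.\<close>
        have 2: "gconj t h - h = t - gconj h t"
          by (simp add: gconj_def gassoc del: add_uminus_conv_diff)
        have "gconj h t \<in> part ?T (insert y Z)"
        proof -
          have "gconj h t \<in> ?T" "gconj h t \<in> L"
            using hL T tL L(1) by (auto intro: subgrp_gconj)
          then show ?thesis using t hL tL by (auto simp: part_def psi_gconj)
        qed
        then have "t - gconj h t \<in> part ?T (insert y Z)"
          using t by (intro subgrp_diff[OF part_subgrp[OF T(1)]])
        then have "t - gconj h t \<in> part H (insert y Z)"
          using 1 2 by (simp add: part_def)
        then have "psi y (t - gconj h t) \<in> ?V" by blast
        moreover have psi_eq: "psi y (t - gconj h t) = u - gconj q u"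
          using y tL hL L(1) t h by (simp add: hom_on_diff[OF psi_hom[OF y] L(1)] psi_gconj subgrp_gconj)
        ultimately have inV: "u - gconj q u \<in> ?V" by simp
        have "gconj q u \<in> centr P (?V \<inter> P)"
          using invsub_centr[OF W] q u unfolding invsub_def normalizes_def by blast
        then have inC: "u - gconj q u \<in> centr P (?V \<inter> P)"
          using u subgrp_diff[OF subgrp_centr[OF P(1)]] by blast
        then have "u - gconj q u \<in> (?V \<inter> P) \<inter> centr P (?V \<inter> P)"
          using inV centr_subset by blast
        then have "u - gconj q u = 0" using invsub_center_trivial[OF W] by blast
        then show ?thesis by (simp add: gconj_eq_self_iff[symmetric])
      qed
      have "u = 0"
        by (rule centr_finite_index_trivial[OF _ idx]) (use QG uP P(2) comm in auto)
      then show "u \<in> {0}" by simp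
    qed
    then have VU: "almost_sub ?U ?V"
      using part_mono[OF T(3)]
      by (intro almost_sub_if_no_centr V psi_image_subgrp[OF y T(1)] psi_image_subset[OF y] image_mono)
    have "almost_sub {g \<in> part ?T (insert y Z). psi y g = 0} {g \<in> part H (insert y Z). psi y g = 0}"
      using insert by (simp add: part_kernel[OF y yZ])
    then show ?case
      by (rule almost_sub_extension[OF part_subgrp[OF sH] part_subgrp[OF T(1)]
          part_mono[OF T(3)] psi_hom_part[OF y] VU])
  qed
  from this[OF finite_Y order_refl] show ?thesis
    by (rule almost_sub_if_parts[OF sH T(1,2)])
qed

text \<open>All these overgroups lie in the commensurator, which is covered by finitely many cosets
  of \<open>H\<close>; an overgroup is determined by the coset representatives that it
  contains.\<close>

lemma finite_overgroups:
  assumes H: "infra H"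
  shows "finite {K. subgrp K \<and> H \<subseteq> K \<and> K \<subseteq> G \<and> almost_sub K H}"
proof -
  let ?T = "commensurator H"
  have sH: "subgrp H" using H by (auto simp: infra_def)
  obtain F where F: "finite F" "F \<subseteq> ?T" "\<forall>a\<in>?T. \<exists>f\<in>F. a - f \<in> H"
    by (rule almost_sub_reps[OF commensurator_finite_index[OF H] sH])
  have sub: "K \<subseteq> K'" if K: "subgrp K" "H \<subseteq> K" "K \<subseteq> ?T" and K': "subgrp K'" "H \<subseteq> K'"
    and eq: "K \<inter> F = K' \<inter> F" for K K'
  proof
    fix k assume k: "k \<in> K"
    then obtain f where f: "f \<in> F" "k - f \<in> H" using F(3) K(3) by blast
    then have "- (k - f) + k \<in> K" using K k by (intro subgrp_add[OF K(1)] subgrp_uminus) auto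
    then have "f \<in> K" by (simp add: gassoc del: add_uminus_conv_diff)
    then have "f \<in> K'" using f eq by blast
    then have "(k - f) + f \<in> K'" using f K' by (intro subgrp_add[OF K'(1)]) auto
    then show "k \<in> K'" by simp
  qed
  have "inj_on (\<lambda>K. K \<inter> F) {K. subgrp K \<and> H \<subseteq> K \<and> K \<subseteq> ?T}"
  proof (rule inj_onI)
    fix K K' assume "K \<in> {K. subgrp K \<and> H \<subseteq> K \<and> K \<subseteq> ?T}" "K' \<in> {K. subgrp K \<and> H \<subseteq> K \<and> K \<subseteq> ?T}"
      "K \<inter> F = K' \<inter> F"
    then show "K = K'" using sub[of K K'] sub[of K' K] by simp
  qed
  moreover have "finite ((\<lambda>K. K \<inter> F) ` {K. subgrp K \<and> H \<subseteq> K \<and> K \<subseteq> ?T})"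
    by (rule finite_subset[of _ "Pow F"]) (use F(1) in auto)
  ultimately have "finite {K. subgrp K \<and> H \<subseteq> K \<and> K \<subseteq> ?T}" by (rule finite_imageD[rotated])
  then show ?thesis
    by (rule finite_subset[rotated]) (use subset_commensurator[OF sH] in blast)
qed

end

subsection \<open>Cantor--Bendixson derivatives and chains\<close>

text \<open>Basic neighbourhoods in the product topology are spelled out as agreement on a finite
  set \<open>F\<close>; \<open>cb_deriv_eq\<close> links this to the topological derivative.\<close>

primrec cbd :: "'g::group_add set \<Rightarrow> nat \<Rightarrow> 'g set set" where
  "cbd G 0 = {K. subgrp K \<and> K \<subseteq> G}"
| "cbd G (Suc n) = {H \<in> cbd G n. \<forall>F. finite F \<and> F \<subseteq> G \<longrightarrow> (\<exists>K\<in>cbd G n. K \<noteq> H \<and> K \<inter> F = H \<inter> F)}"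

text \<open>A chain of length 0 forces \<open>H = G\<close>. A proper subgroup of finite index ends
  no chain at all, which is why later statements allow \<open>n = 0\<close> as a separate
  case.\<close>

definition inf_chain :: "'g::group_add set \<Rightarrow> nat \<Rightarrow> 'g set \<Rightarrow> bool" where
  "inf_chain G n H \<longleftrightarrow> (\<exists>c. c 0 = G \<and> c n = H \<and> (\<forall>i\<le>n. subgrp (c i) \<and> c i \<subseteq> G) \<and>
     (\<forall>i<n. c (Suc i) \<subset> c i \<and> \<not> almost_sub (c i) (c (Suc i))))"

lemma cbd_subgrp: "K \<in> cbd G n \<Longrightarrow> subgrp K \<and> K \<subseteq> G"
  by (induction n) auto

lemma inf_chain_Suc:
  assumes "inf_chain G m K" "subgrp H" "H \<subseteq> K" "\<not> almost_sub K H"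
  shows "inf_chain G (Suc m) H"
proof -
  obtain c where c: "c 0 = G" "c m = K" "\<forall>i\<le>m. subgrp (c i) \<and> c i \<subseteq> G"
    "\<forall>i<m. c (Suc i) \<subset> c i \<and> \<not> almost_sub (c i) (c (Suc i))"
    using assms(1) unfolding inf_chain_def by (elim exE conjE)
  have KG: "K \<subseteq> G" using c(2,3) by blast
  have ne: "H \<subset> K" using assms(3,4) almost_sub_subset by blast
  let ?c = "c(Suc m := H)"
  have "\<forall>i\<le>Suc m. subgrp (?c i) \<and> ?c i \<subseteq> G"
    using c(3) assms(2,3) KG by (auto simp: le_Suc_eq)
  moreover have "\<forall>i<Suc m. ?c (Suc i) \<subset> ?c i \<and> \<not> almost_sub (?c i) (?c (Suc i))"
    using c(2,4) ne assms(4) by (simp add: less_Suc_eq)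
  ultimately show ?thesis
    unfolding inf_chain_def using c(1) by (intro exI[of _ ?c] conjI) simp_all
qed

text \<open>Replacing the last member by a smaller subgroup keeps its index infinite. The length is
  positive because in a chain of length 0 the last member is also the first and must be
  \<open>G\<close>.\<close>

lemma inf_chain_shrink:
  assumes "inf_chain G (Suc m) K" "subgrp H" "H \<subseteq> K"
  shows "inf_chain G (Suc m) H"
proof -
  obtain c where c: "c 0 = G" "c (Suc m) = K" "\<forall>i\<le>Suc m. subgrp (c i) \<and> c i \<subseteq> G"
    "\<forall>i<Suc m. c (Suc i) \<subset> c i \<and> \<not> almost_sub (c i) (c (Suc i))"
    using assms(1) unfolding inf_chain_def by (elim exE conjE)
  have 1: "inf_chain G m (c m)"
    unfolding inf_chain_def using c by (intro exI[of _ c]) simp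
  have 2: "K \<subset> c m" "\<not> almost_sub (c m) K" using c(2,4) by auto
  show ?thesis
  proof (rule inf_chain_Suc[OF 1 assms(2)])
    show "H \<subseteq> c m" using 2 assms(3) by blast
    show "\<not> almost_sub (c m) H" using 2(2) almost_sub_mono_right[OF _ assms(3)] by blast
  qed
qed

lemma inf_chain_pred:
  assumes "inf_chain G (Suc m) H"
  obtains K where "inf_chain G m K" "subgrp K" "K \<subseteq> G" "H \<subseteq> K" "\<not> almost_sub K H"
proof -
  obtain c where c: "c 0 = G" "c (Suc m) = H" "\<forall>i\<le>Suc m. subgrp (c i) \<and> c i \<subseteq> G"
    "\<forall>i<Suc m. c (Suc i) \<subset> c i \<and> \<not> almost_sub (c i) (c (Suc i))"
    using assms(1) unfolding inf_chain_def by (elim exE conjE)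
  have "inf_chain G m (c m)"
    unfolding inf_chain_def using c by (intro exI[of _ c]) simp
  moreover have "subgrp (c m)" "c m \<subseteq> G" "H \<subseteq> c m" "\<not> almost_sub (c m) H"
    using c(2-4) by auto
  ultimately show thesis by (rule that)
qed

text \<open>\<open>st\<close> stands for the level stabilizers, and \<open>approx\<close> says that
  finitely generated subgroups are closed in the topology they define.\<close>

locale approximated_family = section_family G L Y psi
  for G :: "'g::group_add set" and L and Y :: "'i set" and psi +
  fixes st :: "nat \<Rightarrow> 'g set"
  assumes st: "subgrp (st n)" "st n \<subseteq> G" "normalizes G (st n)" "almost_sub G (st n)"
    and st_antimono: "antimono st"
    and approx: "subgrp H \<Longrightarrow> H \<subseteq> G \<Longrightarrow> fg H \<Longrightarrow> x \<in> G \<Longrightarrow> (\<And>n. \<exists>h\<in>H. \<exists>s\<in>st n. x = h + s) \<Longrightarrow> x \<in> H"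
begin

text \<open>Let \<open>K\<close> be the last but one member of the chain. The products of
  \<open>H\<close> with \<open>K \<inter> st m\<close> have finite index in \<open>K\<close>, so
  they differ from \<open>H\<close>. They agree with \<open>H\<close> on any given finite set for
  large \<open>m\<close> by \<open>approx\<close>, and they lie in the previous derivative by
  induction, since they can replace \<open>K\<close> at the end of its chain.\<close>

lemma infra_mem_cbd:
  assumes "infra H" "n = 0 \<or> inf_chain G n H"
  shows "H \<in> cbd G n"
  using assms
proof (induction n arbitrary: H)
  case 0
  then show ?case by (simp add: infra_def)
next
  case (Suc n)
  have chain: "inf_chain G (Suc n) H" using Suc.prems by simp
  have sH: "subgrp H" "H \<subseteq> G" using Suc.prems(1) by (auto simp: infra_def)
  obtain K where K: "inf_chain G n K" "subgrp K" "K \<subseteq> G" "H \<subseteq> K" "\<not> almost_sub K H"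
    by (rule inf_chain_pred[OF chain])
  \<comment> \<open>Applied both to an approximating group and to \<open>H\<close> itself, which
    must also lie in the previous derivative.\<close>
  have below: "M \<in> cbd G n" if M: "subgrp M" "H \<subseteq> M" "M \<subseteq> K" for M
  proof (rule Suc.IH)
    show "infra M" using infra_mono[OF Suc.prems(1) M(2,1)] M(3) K(3) by blast
    show "n = 0 \<or> inf_chain G n M"
      using inf_chain_shrink[OF _ M(1,3)] K(1) by (cases n) auto
  qed
  have "\<exists>M\<in>cbd G n. M \<noteq> H \<and> M \<inter> F = H \<inter> F" if F: "finite F" "F \<subseteq> G" for F
  proof -
    have fgH: "fg H" by (rule infra_fg[OF Suc.prems(1)])
    have "\<exists>n. \<forall>h\<in>H. \<forall>s\<in>st n. x \<noteq> h + s" if "x \<in> F - H" for x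
      using approx[OF sH fgH, of x] that F(2) by blast
    then obtain N where N: "\<forall>x\<in>F - H. \<forall>h\<in>H. \<forall>s\<in>st (N x). x \<noteq> h + s" by metis
    \<comment> \<open>One level that keeps all of \<open>F - H\<close> away from the product with
      \<open>H\<close>, by \<open>st_antimono\<close>; the inserted 0 covers the case
      \<open>F \<subseteq> H\<close>.\<close>
    define m where "m = Max (insert 0 (N ` (F - H)))"
    have Nm: "N x \<le> m" if "x \<in> F - H" for x
      unfolding m_def using that F(1) by (intro Max_ge) auto
    define S where "S = K \<inter> st m"
    define M where "M = {h + s | h s. h \<in> H \<and> s \<in> S}"
    have MI: "h + s \<in> M" if "h \<in> H" "s \<in> S" for h s using that unfolding M_def by blast
    have ME: "\<exists>h s. x = h + s \<and> h \<in> H \<and> s \<in> S" if "x \<in> M" for x using that unfolding M_def by blast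
    have sS: "subgrp S" unfolding S_def by (rule subgrp_Int[OF K(2) st(1)])
    have nS: "gconj h s \<in> S" if "h \<in> H" "s \<in> S" for h s
      using that K(2,4) st(3)[of m] sH(2) unfolding S_def by (auto simp: normalizes_def subgrp_gconj subset_eq)
    have sM: "subgrp M"
    proof (rule subgrpI)
      show "0 \<in> M" using MI[OF subgrp_zero[OF sH(1)] subgrp_zero[OF sS]] by simp
      show "x + y \<in> M" if xy: "x \<in> M" "y \<in> M" for x y
      proof -
        obtain h s h' s' where *: "x = h + s" "y = h' + s'" "h \<in> H" "h' \<in> H" "s \<in> S" "s' \<in> S"
          using ME[OF xy(1)] ME[OF xy(2)] by (elim exE conjE)
        have "x + y = (h + h') + (gconj (- h') s + s')"
          using *(1,2) by (simp add: gconj_def gassoc del: add_uminus_conv_diff)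
        moreover have "gconj (- h') s + s' \<in> S"
          by (rule subgrp_add[OF sS nS[OF subgrp_uminus[OF sH(1) *(4)] *(5)] *(6)])
        ultimately show ?thesis using MI[OF subgrp_add[OF sH(1) *(3,4)]] by simp
      qed
      show "- x \<in> M" if x: "x \<in> M" for x
      proof -
        obtain h s where *: "x = h + s" "h \<in> H" "s \<in> S" using ME[OF x] by (elim exE conjE)
        have "- x = - h + gconj h (- s)"
          using *(1) by (simp add: gconj_def gassoc del: add_uminus_conv_diff)
        then show ?thesis
          using MI[OF subgrp_uminus[OF sH(1) *(2)] nS[OF *(2) subgrp_uminus[OF sS *(3)]]] by simp
      qed
    qed
    have HM: "H \<subseteq> M" using MI[of _ 0] subgrp_zero[OF sS] by auto
    have MK: "M \<subseteq> K" using K(4) subgrp_add[OF K(2)] unfolding M_def S_def by blast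
    have SM: "S \<subseteq> M" using MI[of 0] subgrp_zero[OF sH(1)] by auto
    have "almost_sub K S"
      unfolding S_def
      by (rule almost_sub_self_Int[OF almost_sub_mono[OF st(4) K(3) order_refl] K(2) st(1)])
    then have "almost_sub K M" using SM by (rule almost_sub_mono_right)
    then have "M \<noteq> H" using K(5) by metis
    moreover have "M \<inter> F = H \<inter> F"
    proof
      show "M \<inter> F \<subseteq> H \<inter> F"
      proof
        fix x assume x: "x \<in> M \<inter> F"
        then obtain h s where *: "x = h + s" "h \<in> H" "s \<in> st m" using ME[of x] unfolding S_def by blast
        have "x \<in> H"
        proof (rule ccontr)
          assume "x \<notin> H"
          then have xF: "x \<in> F - H" using x by blast
          then have "s \<in> st (N x)" using antimonoD[OF st_antimono Nm[OF xF]] *(3) by blast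
          then show False using N xF * by blast
        qed
        then show "x \<in> H \<inter> F" using x by blast
      qed
      show "H \<inter> F \<subseteq> M \<inter> F" using HM by (rule Int_mono) simp
    qed
    ultimately show ?thesis using below[OF sM HM MK] by blast
  qed
  moreover have "H \<in> cbd G n" by (rule below[OF sH(1) order_refl K(4)])
  ultimately show ?case by simp
qed

text \<open>\<open>F\<close> consists of generators of \<open>H\<close> and of one element outside
  \<open>H\<close> from each of the finitely many other overgroups in which \<open>H\<close> has
  finite index. A different subgroup agreeing with \<open>H\<close> on \<open>F\<close> contains
  \<open>H\<close>, and with infinite index.\<close>

lemma cbd_SucE:
  assumes H: "infra H" and mem: "H \<in> cbd G (Suc n)"
  obtains K where "K \<in> cbd G n" "infra K" "H \<subseteq> K" "\<not> almost_sub K H"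
proof -
  have sH: "subgrp H" "H \<subseteq> G" using H by (auto simp: infra_def)
  obtain S where S: "finite S" "gspan S = H" using infra_fg[OF H] by (auto simp: fg_def)
  let ?O = "{K. subgrp K \<and> H \<subseteq> K \<and> K \<subseteq> G \<and> almost_sub K H}"
  have "\<forall>K\<in>?O - {H}. \<exists>x. x \<in> K - H" by blast
  then obtain w where w: "\<forall>K\<in>?O - {H}. w K \<in> K - H" by metis
  define F where "F = S \<union> w ` (?O - {H})"
  have "finite F" unfolding F_def using S(1) finite_overgroups[OF H] by simp
  moreover have "F \<subseteq> G"
  proof -
    have "S \<subseteq> G" using S(2) gspan_superset[of S] sH(2) by blast
    moreover have "w K \<in> G" if "K \<in> ?O - {H}" for K using bspec[OF w that] that by blast
    ultimately show ?thesis unfolding F_def by blast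
  qed
  moreover have "\<forall>F. finite F \<and> F \<subseteq> G \<longrightarrow> (\<exists>K\<in>cbd G n. K \<noteq> H \<and> K \<inter> F = H \<inter> F)"
    using mem by simp
  ultimately have "\<exists>K\<in>cbd G n. K \<noteq> H \<and> K \<inter> F = H \<inter> F" by simp
  then obtain K where K: "K \<in> cbd G n" "K \<noteq> H" "K \<inter> F = H \<inter> F" by (elim bexE conjE)
  have sK: "subgrp K" "K \<subseteq> G" using cbd_subgrp[OF K(1)] by auto
  have "S \<subseteq> K" using K(3) S(2) gspan_superset[of S] unfolding F_def by blast
  then have HK: "H \<subseteq> K" using gspan_least[OF sK(1)] S(2) by blast
  have "\<not> almost_sub K H"
  proof
    assume "almost_sub K H"
    then have KO: "K \<in> ?O - {H}" using sK HK K(2) by blast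
    then have "w K \<in> K - H" "w K \<in> F" using bspec[OF w KO] unfolding F_def by auto
    then show False using K(3) by blast
  qed
  then show thesis using that K(1) infra_mono[OF H HK sK] HK by blast
qed

text \<open>Membership in a derivative yields an overgroup of infinite index one stage lower.
  Appending \<open>H\<close> to a chain for that overgroup lengthens it by one, so the bound on
  chain lengths drops with the stage.\<close>

lemma infra_notin_cbd:
  assumes "infra H" "\<forall>m. inf_chain G m H \<longrightarrow> m \<le> n"
  shows "H \<notin> cbd G (Suc n)"
  using assms
proof (induction n arbitrary: H)
  case 0
  have sH: "subgrp H" "H \<subseteq> G" using 0(1) by (auto simp: infra_def)
  show ?case
  proof
    assume "H \<in> cbd G (Suc 0)"
    then obtain K where K: "K \<in> cbd G 0" "infra K" "H \<subseteq> K" "\<not> almost_sub K H"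
      by (rule cbd_SucE[OF 0(1)])
    then have "K \<subseteq> G" by (simp add: infra_def)
    then have "\<not> almost_sub G H" using K(4) almost_sub_mono[OF _ _ order_refl] by blast
    moreover have "inf_chain G 0 G" unfolding inf_chain_def using G by (intro exI[of _ "\<lambda>_. G"]) simp
    ultimately have "inf_chain G (Suc 0) H" using inf_chain_Suc sH by blast
    then show False using 0(2) by blast
  qed
next
  case (Suc n)
  have sH: "subgrp H" using Suc.prems(1) by (auto simp: infra_def)
  show ?case
  proof
    assume "H \<in> cbd G (Suc (Suc n))"
    then obtain K where K: "K \<in> cbd G (Suc n)" "infra K" "H \<subseteq> K" "\<not> almost_sub K H"
      by (rule cbd_SucE[OF Suc.prems(1)])
    have "\<forall>m. inf_chain G m K \<longrightarrow> m \<le> n"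
      using inf_chain_Suc[OF _ sH K(3,4)] Suc.prems(2) by (meson Suc_le_mono)
    then show False using Suc.IH[OF K(2)] K(1) by blast
  qed
qed

lemma inf_chain_bounded:
  assumes H: "infra H"
  obtains b where "\<forall>n. inf_chain G n H \<longrightarrow> n \<le> b"
proof -
  have sH: "subgrp H" "H \<subseteq> G" using H by (auto simp: infra_def)
  obtain rk :: "'g set \<Rightarrow> nat" and b where rk:
    "\<And>K K'. subgrp K \<Longrightarrow> subgrp K' \<Longrightarrow> K' \<subseteq> G \<Longrightarrow> H \<subseteq> K \<Longrightarrow> K \<subseteq> K' \<Longrightarrow>
       rk K \<le> rk K' \<and> rk K' \<le> b \<and> (\<not> almost_sub K' K \<longrightarrow> rk K < rk K')"
    using infra_rank[OF H] by metis
  \<comment> \<open>Every step down the chain lowers \<open>rk\<close> strictly, starting from a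
    value at most \<open>b\<close>.\<close>
  have "n + rk K \<le> b" if "inf_chain G n K" "subgrp K" "K \<subseteq> G" "H \<subseteq> K" for n K
    using that
  proof (induction n arbitrary: K)
    case 0
    then show ?case using rk[of K K] by simp
  next
    case (Suc n)
    obtain M where M: "inf_chain G n M" "subgrp M" "M \<subseteq> G" "K \<subseteq> M" "\<not> almost_sub M K"
      by (rule inf_chain_pred[OF Suc.prems(1)])
    have "n + rk M \<le> b" using Suc.IH[OF M(1-3)] Suc.prems(4) M(4) by blast
    moreover have "rk K < rk M" using rk[OF Suc.prems(2) M(2,3) Suc.prems(4) M(4)] M(5) by blast
    ultimately show ?case by linarith
  qed
  from this[OF _ sH order_refl] have "\<forall>n. inf_chain G n H \<longrightarrow> n \<le> b" by fastforce
  then show thesis by (rule that)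
qed

lemma infra_cb_rank:
  assumes H: "infra H"
  obtains n where "\<forall>m. inf_chain G m H \<longrightarrow> m \<le> n" "n = 0 \<or> inf_chain G n H"
    "H \<in> cbd G n" "H \<notin> cbd G (Suc n)"
proof -
  obtain b where b: "\<forall>n. inf_chain G n H \<longrightarrow> n \<le> b" by (rule inf_chain_bounded[OF H])
  \<comment> \<open>The inserted 0 is the value for a subgroup that ends no chain.\<close>
  define n where "n = Max (insert 0 {n. inf_chain G n H})"
  have "{n. inf_chain G n H} \<subseteq> {..b}" using b by blast
  then have fin: "finite {n. inf_chain G n H}" by (rule finite_subset) simp
  have 1: "\<forall>m. inf_chain G m H \<longrightarrow> m \<le> n"
    unfolding n_def using fin by (intro allI impI Max_ge) simp_all
  have "n \<in> insert 0 {n. inf_chain G n H}"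
    unfolding n_def using fin by (intro Max_in) simp_all
  then have 2: "n = 0 \<or> inf_chain G n H" by blast
  show thesis
    by (rule that[OF 1 2 infra_mem_cbd[OF H 2] infra_notin_cbd[OF H 1]])
qed

end

subsection \<open>The additive group of permutations of a type\<close>

text \<open>In the given encoding tree automorphisms fix every list outside \<open>lists A\<close>,
  so they are bijections of the whole type and live in one \<open>group_add\<close> type, with
  composition as addition.\<close>

typedef 'b bperm = "{f :: 'b \<Rightarrow> 'b. bij f}" morphisms bapp Bperm
  by (rule exI[of _ id]) simp

lemma bij_bapp: "bij (bapp p)"
  using bapp[of p] by simp

lemma bapp_Bperm: "bij f \<Longrightarrow> bapp (Bperm f) = f"
  by (rule Bperm_inverse) simp

instantiation bperm :: (type) group_add
begin

definition zero_bperm :: "'a bperm" where "0 = Bperm id"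
definition plus_bperm :: "'a bperm \<Rightarrow> 'a bperm \<Rightarrow> 'a bperm" where "p + q = Bperm (bapp p \<circ> bapp q)"
definition uminus_bperm :: "'a bperm \<Rightarrow> 'a bperm" where "- p = Bperm (inv_into UNIV (bapp p))"
definition minus_bperm :: "'a bperm \<Rightarrow> 'a bperm \<Rightarrow> 'a bperm" where "p - q = p + - (q :: 'a bperm)"

lemma bapp_zero: "bapp (0 :: 'a bperm) = id"
  unfolding zero_bperm_def by (rule bapp_Bperm) simp

lemma bapp_plus: "bapp (p + q) = bapp p \<circ> bapp q" for p q :: "'a bperm"
  unfolding plus_bperm_def by (rule bapp_Bperm) (intro bij_comp bij_bapp)

lemma bapp_uminus: "bapp (- p) = inv_into UNIV (bapp p)" for p :: "'a bperm"
  unfolding uminus_bperm_def by (rule bapp_Bperm) (intro bij_imp_bij_inv bij_bapp)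

instance
proof
  fix a b c :: "'a bperm"
  show "a + b + c = a + (b + c)" by (simp add: bapp_inject[symmetric] bapp_plus comp_assoc)
  show "0 + a = a" "a + 0 = a" by (simp_all add: bapp_inject[symmetric] bapp_plus bapp_zero)
  show "- a + a = 0"
    by (simp add: bapp_inject[symmetric] bapp_plus bapp_zero bapp_uminus bij_is_inj[OF bij_bapp])
  show "a + - b = a - b" by (simp add: minus_bperm_def)
qed

end

definition perms_of :: "('b \<Rightarrow> 'b) set \<Rightarrow> 'b bperm set" where
  "perms_of S = {p. bapp p \<in> S}"

lemma perms_of_iff: "p \<in> perms_of S \<longleftrightarrow> bapp p \<in> S"
  by (simp add: perms_of_def)

lemma perms_of_mono: "S \<subseteq> T \<Longrightarrow> perms_of S \<subseteq> perms_of T"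
  by (auto simp: perms_of_def)

lemma perms_of_Int: "perms_of (S \<inter> T) = perms_of S \<inter> perms_of T"
  by (auto simp: perms_of_def)

lemma bapp_image_perms_of: "(\<And>f. f \<in> S \<Longrightarrow> bij f) \<Longrightarrow> bapp ` perms_of S = S"
  by (auto simp: perms_of_def image_iff) (metis bapp_Bperm)

lemma perms_of_bapp_image: "perms_of (bapp ` P) = P"
  by (auto simp: perms_of_def bapp_inject)

lemma finite_perms_of: "(\<And>f. f \<in> S \<Longrightarrow> bij f) \<Longrightarrow> finite S \<longleftrightarrow> finite (perms_of S)"
  by (metis bapp_image_perms_of bapp_inject finite_imageD finite_imageI inj_onI)

subsection \<open>Tree automorphisms\<close>

lemma tree_aut_fix: "g \<in> tree_aut A \<Longrightarrow> w \<notin> lists A \<Longrightarrow> g w = w"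
  by (simp add: tree_aut_def)

lemma tree_aut_lists: "g \<in> tree_aut A \<Longrightarrow> g w \<in> lists A \<longleftrightarrow> w \<in> lists A"
  by (cases "w \<in> lists A") (auto simp: tree_aut_def dest: bij_betwE)

lemma tree_aut_prefix:
  "g \<in> tree_aut A \<Longrightarrow> u \<in> lists A \<Longrightarrow> v \<in> lists A \<Longrightarrow> prefix (g u) (g v) \<longleftrightarrow> prefix u v"
  by (simp add: tree_aut_def)

lemma tree_aut_bij:
  assumes g: "g \<in> tree_aut A"
  shows "bij g"
proof -
  have 1: "bij_betw g (lists A) (lists A)" using g by (simp add: tree_aut_def)
  have "bij_betw g (- lists A) (- lists A)"
    using tree_aut_fix[OF g] by (subst bij_betw_cong[of _ _ id]) auto
  then have "bij_betw g (lists A \<union> - lists A) (lists A \<union> - lists A)"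
    by (rule bij_betw_combine[OF 1]) simp
  then show ?thesis by simp
qed

lemma tree_aut_id: "id \<in> tree_aut A"
  by (simp add: tree_aut_def)

lemma tree_aut_comp:
  assumes "g \<in> tree_aut A" "h \<in> tree_aut A"
  shows "g \<circ> h \<in> tree_aut A"
proof -
  have "bij_betw (g \<circ> h) (lists A) (lists A)"
    using assms by (intro bij_betw_trans[of h _ "lists A"]) (simp_all add: tree_aut_def)
  moreover have "\<forall>u\<in>lists A. \<forall>v\<in>lists A. prefix u v \<longleftrightarrow> prefix (g (h u)) (g (h v))"
    using tree_aut_prefix[OF assms(1)] tree_aut_prefix[OF assms(2)] tree_aut_lists[OF assms(2)] by simp
  moreover have "\<forall>w. w \<notin> lists A \<longrightarrow> g (h w) = w"
    using tree_aut_fix[OF assms(1)] tree_aut_fix[OF assms(2)] by simp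
  ultimately show ?thesis by (simp add: tree_aut_def)
qed

lemma tree_aut_inv:
  assumes g: "g \<in> tree_aut A"
  shows "inv_into UNIV g \<in> tree_aut A"
proof -
  let ?h = "inv_into UNIV g"
  have gh: "g (?h w) = w" for w using tree_aut_bij[OF g] by (simp add: bij_is_surj surj_f_inv_f)
  have hl: "?h w \<in> lists A \<longleftrightarrow> w \<in> lists A" for w using tree_aut_lists[OF g, of "?h w"] gh by simp
  have "bij_betw ?h (lists A) (lists A)"
  proof (rule bij_betwI[of _ _ _ g])
    show "?h (g w) = w" for w using tree_aut_bij[OF g] by (simp add: bij_is_inj inv_f_f)
  qed (use gh hl tree_aut_lists[OF g] in auto)
  moreover have "prefix u v \<longleftrightarrow> prefix (?h u) (?h v)" if "u \<in> lists A" "v \<in> lists A" for u v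
    using tree_aut_prefix[OF g, of "?h u" "?h v"] gh hl that by simp
  moreover have "?h w = w" if "w \<notin> lists A" for w
    using tree_aut_fix[OF g, of "?h w"] gh hl that by metis
  ultimately show ?thesis by (simp add: tree_aut_def)
qed

text \<open>\<open>g\<close> maps the prefixes of \<open>w\<close> bijectively onto the prefixes of
  \<open>g w\<close>, and a word has one more prefix than its length.\<close>

lemma tree_aut_length:
  assumes g: "g \<in> tree_aut A" and w: "w \<in> lists A"
  shows "length (g w) = length w"
proof -
  have pl: "u \<in> lists A" if "prefix u v" "v \<in> lists A" for u v
    using that by (auto elim!: prefixE)
  have gw: "g w \<in> lists A" using tree_aut_lists[OF g] w by simp
  have "bij_betw g {u. prefix u w} {u. prefix u (g w)}"
    unfolding bij_betw_def
  proof
    show "inj_on g {u. prefix u w}" using bij_is_inj[OF tree_aut_bij[OF g]] inj_on_subset by blast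
    show "g ` {u. prefix u w} = {u. prefix u (g w)}"
    proof
      show "g ` {u. prefix u w} \<subseteq> {u. prefix u (g w)}"
        using tree_aut_prefix[OF g _ w] pl[OF _ w] by blast
      show "{u. prefix u (g w)} \<subseteq> g ` {u. prefix u w}"
      proof
        fix v assume v: "v \<in> {u. prefix u (g w)}"
        obtain u where u: "v = g u" using bij_is_surj[OF tree_aut_bij[OF g]] by blast
        have "v \<in> lists A" using pl gw v by simp
        then have "u \<in> lists A" using u tree_aut_lists[OF g] by simp
        then have "prefix u w" using tree_aut_prefix[OF g _ w] v u by simp
        then show "v \<in> g ` {u. prefix u w}" using u by blast
      qed
    qed
  qed
  then have "card {u. prefix u w} = card {u. prefix u (g w)}" by (rule bij_betw_same_card)
  moreover have "card {u. prefix u v} = length v + 1" for v :: "'a list"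
    using distinct_card[OF distinct_prefixes[of v]]
    by (metis Collect_cong Collect_mem_eq in_set_prefixes length_prefixes)
  ultimately show ?thesis by simp
qed

lemma tree_aut_append:
  assumes g: "g \<in> tree_aut A" and uw: "u \<in> lists A" "w \<in> lists A"
  shows "g (u @ w) = g u @ tsection A g u w"
proof -
  have "prefix (g u) (g (u @ w))" using tree_aut_prefix[OF g] uw by simp
  then obtain v where "g (u @ w) = g u @ v" by (auto elim: prefixE)
  then show ?thesis using uw tree_aut_length[OF g uw(1)] by (simp add: tsection_def)
qed

lemma tree_aut_fix_prefix:
  assumes g: "g \<in> tree_aut A" and uv: "u \<in> lists A" "v \<in> lists A" "prefix u v" "g v = v"
  shows "g u = u"
proof -
  have "prefix (g u) v" using tree_aut_prefix[OF g uv(1,2)] uv by simp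
  then obtain a where "v = g u @ a" by (auto elim: prefixE)
  moreover obtain b where "v = u @ b" using uv(3) by (auto elim: prefixE)
  ultimately show ?thesis using tree_aut_length[OF g uv(1)] by (metis append_eq_append_conv)
qed

lemma tsection_lists: "g \<in> tree_aut A \<Longrightarrow> u \<in> lists A \<Longrightarrow> tsection A g u w \<in> lists A \<longleftrightarrow> w \<in> lists A"
  using tree_aut_append[of g A u w] tree_aut_lists[of g A "u @ w"]
  by (cases "w \<in> lists A") (auto simp: tsection_def dest: in_set_dropD)

text \<open>In general the section of \<open>g\<close> is taken at \<open>h u\<close>; if
  \<open>h\<close> fixes \<open>u\<close>, sections at \<open>u\<close> become
  multiplicative.\<close>

lemma tsection_comp:
  assumes g: "g \<in> tree_aut A" "h \<in> tree_aut A" and u: "u \<in> lists A" "h u = u"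
  shows "tsection A (g \<circ> h) u = tsection A g u \<circ> tsection A h u"
proof
  fix w
  show "tsection A (g \<circ> h) u w = (tsection A g u \<circ> tsection A h u) w"
  proof (cases "w \<in> lists A")
    case True
    have "h (u @ w) = u @ tsection A h u w" using tree_aut_append[OF g(2) u(1) True] u(2) by simp
    moreover have "tsection A h u w \<in> lists A" using tsection_lists[OF g(2) u(1)] True by simp
    ultimately show ?thesis using True by (simp add: tsection_def[of A g] tsection_def[of A "g \<circ> h"])
  qed (simp add: tsection_def)
qed

lemma tsection_Nil: "g \<in> tree_aut A \<Longrightarrow> tsection A g [] = g"
  by (rule ext) (simp add: tsection_def tree_aut_fix)

lemma tsection_snoc: "x \<in> A \<Longrightarrow> tsection A g (u @ [x]) = tsection A (tsection A g u) [x]"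
  by (rule ext) (simp add: tsection_def drop_Suc tl_drop)

lemma tsection_self_similar:
  assumes "self_similar A G" "G \<subseteq> tree_aut A" "g \<in> G" "u \<in> lists A"
  shows "tsection A g u \<in> G"
  using assms(4)
proof (induction u rule: rev_induct)
  case Nil
  then show ?case using assms tsection_Nil by (metis subsetD)
next
  case (snoc x u)
  then show ?case using assms(1) by (simp add: tsection_snoc self_similar_def)
qed

lemma words_len_finite: "finite A \<Longrightarrow> finite (words_len A n)"
  using finite_lists_length_eq[of A n] unfolding words_len_def
  by (rule finite_subset[rotated]) auto

subsection \<open>Subgroups of the automorphism group\<close>

lemma group_aut_group: "group (aut_group A)"
proof (rule groupI)
  fix x assume x: "x \<in> carrier (aut_group A)"
  then have "inv_into UNIV x \<circ> x = id"
    using tree_aut_bij[of x A] by (simp add: aut_group_def bij_is_inj)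
  then show "\<exists>y\<in>carrier (aut_group A). y \<otimes>\<^bsub>aut_group A\<^esub> x = \<one>\<^bsub>aut_group A\<^esub>"
    using x tree_aut_inv by (auto simp: aut_group_def)
qed (auto simp: aut_group_def tree_aut_id tree_aut_comp comp_assoc)

lemma aut_group_inv:
  assumes "g \<in> tree_aut A"
  shows "m_inv (aut_group A) g = inv_into UNIV g"
  using assms tree_aut_bij[OF assms] tree_aut_inv[OF assms]
  by (intro group.inv_equality[OF group_aut_group]) (simp_all add: aut_group_def bij_is_inj)

locale aut_subgroup =
  fixes A :: "'a set" and G :: "'a tfun set"
  assumes G_sub: "is_subgroup_of_aut A G"
begin

lemma G_aut: "G \<subseteq> tree_aut A"
  using G_sub subgroup.subset unfolding is_subgroup_of_aut_def aut_group_def by fastforce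

lemma G_bij: "g \<in> G \<Longrightarrow> bij g"
  using G_aut tree_aut_bij by blast

lemma group_sub_grp: "group (sub_grp A G)"
  using G_sub subgroup.subgroup_is_group[OF _ group_aut_group]
  unfolding is_subgroup_of_aut_def sub_grp_def by blast

lemma sub_grp_simps [simp]:
  "carrier (sub_grp A G) = G" "mult (sub_grp A G) = (\<circ>)" "one (sub_grp A G) = id"
  by (simp_all add: sub_grp_def aut_group_def)

lemma sub_grp_inv: "g \<in> G \<Longrightarrow> m_inv (sub_grp A G) g = inv_into UNIV g"
  using group.m_inv_consistent[OF group_aut_group, of G A g] G_sub aut_group_inv G_aut
  unfolding is_subgroup_of_aut_def sub_grp_def by fastforce

lemma subgroup_iff: "subgroup K (sub_grp A G) \<longleftrightarrow> K \<subseteq> G \<and> subgrp (perms_of K)"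
proof
  assume K: "subgroup K (sub_grp A G)"
  have KG: "K \<subseteq> G" using subgroup.subset[OF K] by simp
  have "subgrp (perms_of K)"
  proof (rule subgrpI)
    show "0 \<in> perms_of K" using subgroup.one_closed[OF K] by (simp add: perms_of_iff bapp_zero)
    show "p + q \<in> perms_of K" if "p \<in> perms_of K" "q \<in> perms_of K" for p q
      using that subgroup.m_closed[OF K] by (simp add: perms_of_iff bapp_plus)
    show "- p \<in> perms_of K" if "p \<in> perms_of K" for p
      using that subgroup.m_inv_closed[OF K, of "bapp p"] KG sub_grp_inv[of "bapp p"]
      by (auto simp: perms_of_iff bapp_uminus)
  qed
  then show "K \<subseteq> G \<and> subgrp (perms_of K)" using KG by blast
next
  assume K: "K \<subseteq> G \<and> subgrp (perms_of K)"
  have b: "bapp (Bperm k) = k" "Bperm k \<in> perms_of K" if "k \<in> K" for k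
    using that K G_bij bapp_Bperm[of k] by (auto simp: perms_of_iff)
  show "subgroup K (sub_grp A G)"
  proof
    show "K \<subseteq> carrier (sub_grp A G)" using K by simp
    show "x \<otimes>\<^bsub>sub_grp A G\<^esub> y \<in> K" if "x \<in> K" "y \<in> K" for x y
      using subgrp_add[of "perms_of K" "Bperm x" "Bperm y"] K b that by (simp add: perms_of_iff bapp_plus)
    show "\<one>\<^bsub>sub_grp A G\<^esub> \<in> K"
      using subgrp_zero[of "perms_of K"] K by (simp add: perms_of_iff bapp_zero)
    show "m_inv (sub_grp A G) x \<in> K" if x: "x \<in> K" for x
    proof -
      have "- Bperm x \<in> perms_of K" using subgrp_uminus K b(2)[OF x] by blast
      moreover have "x \<in> G" using K x by blast
      ultimately show ?thesis using b(1)[OF x] sub_grp_inv by (simp add: perms_of_iff bapp_uminus)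
    qed
  qed
qed

lemma subgroup_bapp_image: "subgrp P \<Longrightarrow> P \<subseteq> perms_of G \<Longrightarrow> subgroup (bapp ` P) (sub_grp A G)"
  unfolding subgroup_iff perms_of_bapp_image by (auto simp: perms_of_iff)

lemma bapp_perms_of: "K \<subseteq> G \<Longrightarrow> bapp ` perms_of K = K"
  by (rule bapp_image_perms_of) (use G_bij in blast)

lemma G_subgroup: "subgroup G (sub_grp A G)"
  using group.subgroup_self[OF group_sub_grp] by simp

lemma subgrp_G: "subgrp (perms_of G)"
  using G_subgroup subgroup_iff by blast

text \<open>Two elements of \<open>L\<close> give the same right coset of \<open>K\<close> exactly
  if their difference lies in \<open>K\<close>, so the cosets themselves serve as labels for
  \<open>almost_subI\<close>.\<close>

lemma finite_rcosets_iff: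
  assumes K: "subgroup K (sub_grp A G)" and L: "L \<subseteq> G"
  shows "finite (rcosets\<^bsub>sub_grp A L\<^esub> K) \<longleftrightarrow> almost_sub (perms_of L) (perms_of K)"
proof -
  have sK: "subgrp (perms_of K)" and KG: "K \<subseteq> G" using K subgroup_iff by blast+
  have cos: "K #>\<^bsub>sub_grp A L\<^esub> bapp a = bapp ` (\<lambda>h. h + a) ` perms_of K" for a
  proof -
    have "K #>\<^bsub>sub_grp A L\<^esub> bapp a = (\<lambda>k. k \<circ> bapp a) ` K"
      by (auto simp: r_coset_def sub_grp_def aut_group_def)
    also have "\<dots> = (\<lambda>k. k \<circ> bapp a) ` bapp ` perms_of K" by (simp only: bapp_perms_of[OF KG])
    finally show ?thesis by (simp add: image_image bapp_plus)
  qed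
  have rc: "rcosets\<^bsub>sub_grp A L\<^esub> K = (\<lambda>a. K #>\<^bsub>sub_grp A L\<^esub> bapp a) ` perms_of L"
  proof -
    have "rcosets\<^bsub>sub_grp A L\<^esub> K = (\<lambda>a. K #>\<^bsub>sub_grp A L\<^esub> a) ` L"
      by (auto simp: RCOSETS_def sub_grp_def aut_group_def)
    also have "\<dots> = (\<lambda>a. K #>\<^bsub>sub_grp A L\<^esub> a) ` bapp ` perms_of L" using bapp_perms_of[OF L] by simp
    finally show ?thesis by (simp add: image_image)
  qed
  show ?thesis
  proof
    assume fin: "finite (rcosets\<^bsub>sub_grp A L\<^esub> K)"
    show "almost_sub (perms_of L) (perms_of K)"
    proof (rule almost_subI[where c = "\<lambda>a. K #>\<^bsub>sub_grp A L\<^esub> bapp a"])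
      show "finite ((\<lambda>a. K #>\<^bsub>sub_grp A L\<^esub> bapp a) ` perms_of L)" using fin rc by simp
      fix a b :: "'a list bperm" assume eq: "K #>\<^bsub>sub_grp A L\<^esub> bapp a = K #>\<^bsub>sub_grp A L\<^esub> bapp b"
      have "bapp (0 + a) \<in> bapp ` (\<lambda>h. h + a) ` perms_of K" using subgrp_zero[OF sK] by blast
      then have "bapp (0 + a) \<in> bapp ` (\<lambda>h. h + b) ` perms_of K" using eq cos by simp
      then obtain h where "h \<in> perms_of K" "a = h + b" unfolding image_image by (auto simp: bapp_inject)
      then show "a - b \<in> perms_of K" by simp
    qed
  next
    assume "almost_sub (perms_of L) (perms_of K)"
    then obtain F where F: "finite F" "\<forall>a\<in>perms_of L. \<exists>f\<in>F. a - f \<in> perms_of K" by (rule almost_subE)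
    have "rcosets\<^bsub>sub_grp A L\<^esub> K \<subseteq> (\<lambda>f. K #>\<^bsub>sub_grp A L\<^esub> bapp f) ` F"
    proof
      fix R assume "R \<in> rcosets\<^bsub>sub_grp A L\<^esub> K"
      then obtain a where a: "a \<in> perms_of L" "R = K #>\<^bsub>sub_grp A L\<^esub> bapp a" using rc by blast
      obtain f where f: "f \<in> F" "a - f \<in> perms_of K" using bspec[OF F(2) a(1)] by blast
      have "(\<lambda>h. h + a) ` perms_of K = (\<lambda>h. h + f) ` perms_of K"
      proof
        show "(\<lambda>h. h + a) ` perms_of K \<subseteq> (\<lambda>h. h + f) ` perms_of K"
        proof
          fix x assume "x \<in> (\<lambda>h. h + a) ` perms_of K"
          then obtain h where h: "h \<in> perms_of K" "x = h + a" by blast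
          then have "x = (h + (a - f)) + f" by (simp add: gassoc del: add_uminus_conv_diff)
          then show "x \<in> (\<lambda>h. h + f) ` perms_of K" using subgrp_add[OF sK h(1) f(2)] by blast
        qed
        show "(\<lambda>h. h + f) ` perms_of K \<subseteq> (\<lambda>h. h + a) ` perms_of K"
        proof
          fix x assume "x \<in> (\<lambda>h. h + f) ` perms_of K"
          then obtain h where h: "h \<in> perms_of K" "x = h + f" by blast
          then have "x = (h + - (a - f)) + a" by (simp add: gassoc del: add_uminus_conv_diff)
          then show "x \<in> (\<lambda>h. h + a) ` perms_of K"
            using subgrp_add[OF sK h(1) subgrp_uminus[OF sK f(2)]] by blast
        qed
      qed
      then have "R = K #>\<^bsub>sub_grp A L\<^esub> bapp f" using a cos by simp
      then show "R \<in> (\<lambda>f. K #>\<^bsub>sub_grp A L\<^esub> bapp f) ` F" using f(1) by blast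
    qed
    then show "finite (rcosets\<^bsub>sub_grp A L\<^esub> K)" by (rule finite_subset) (simp add: F(1))
  qed
qed

lemma normal_bapp_image:
  assumes "subgrp N" "N \<subseteq> perms_of G" "normalizes (perms_of G) N"
  shows "bapp ` N \<lhd> sub_grp A G"
  unfolding group.normal_inv_iff[OF group_sub_grp]
proof (intro conjI ballI)
  show "subgroup (bapp ` N) (sub_grp A G)" using subgroup_bapp_image assms by blast
  fix x h assume x: "x \<in> carrier (sub_grp A G)" and "h \<in> bapp ` N"
  then obtain n where n: "n \<in> N" "h = bapp n" by blast
  have xG: "x \<in> G" and bx: "bapp (Bperm x) = x" using x G_bij bapp_Bperm by auto
  have "gconj (Bperm x) n \<in> N" using assms(3) n xG bx by (simp add: normalizes_def perms_of_iff)
  moreover have "x \<circ> h \<circ> inv_into UNIV x = bapp (gconj (Bperm x) n)"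
    unfolding gconj_def minus_bperm_def using bx n
    by (simp add: bapp_plus bapp_uminus del: add_uminus_conv_diff)
  ultimately show "x \<otimes>\<^bsub>sub_grp A G\<^esub> h \<otimes>\<^bsub>sub_grp A G\<^esub> m_inv (sub_grp A G) x \<in> bapp ` N"
    using sub_grp_inv[OF xG] by simp
qed

lemma perms_of_generate:
  assumes S: "S \<subseteq> G"
  shows "perms_of (generate (sub_grp A G) S) = gspan (perms_of S)"
proof
  have "generate (sub_grp A G) S \<subseteq> bapp ` gspan (perms_of S)"
  proof (rule group.generate_subgroup_incl[OF group_sub_grp])
    show "S \<subseteq> bapp ` gspan (perms_of S)"
      using bapp_perms_of[OF S] gspan_superset[of "perms_of S"] by blast
    show "subgroup (bapp ` gspan (perms_of S)) (sub_grp A G)"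
      by (rule subgroup_bapp_image[OF gspan_subgrp gspan_least[OF subgrp_G perms_of_mono[OF S]]])
  qed
  then show "perms_of (generate (sub_grp A G) S) \<subseteq> gspan (perms_of S)"
    using perms_of_mono perms_of_bapp_image by metis
  show "gspan (perms_of S) \<subseteq> perms_of (generate (sub_grp A G) S)"
  proof (rule gspan_least)
    show "subgrp (perms_of (generate (sub_grp A G) S))"
      using group.generate_is_subgroup[OF group_sub_grp, of S] S subgroup_iff by simp
    show "perms_of S \<subseteq> perms_of (generate (sub_grp A G) S)"
      by (rule perms_of_mono) (auto intro: generate.incl)
  qed
qed

lemma fg_if_fin_gen:
  assumes "fin_gen A G H" "H \<subseteq> G"
  shows "fg (perms_of H)"
proof -
  obtain S where S: "finite S" "S \<subseteq> H" "generate (sub_grp A G) S = H"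
    using assms by (auto simp: fin_gen_def)
  have SG: "S \<subseteq> G" using S assms by blast
  have "finite (perms_of S)" using finite_perms_of[of S] S(1) SG G_bij by blast
  then show ?thesis unfolding fg_def using perms_of_generate[OF SG] S(3) by metis
qed

lemma fin_gen_if_fg:
  assumes "fg P" "P \<subseteq> perms_of G"
  shows "fin_gen A G (bapp ` P)"
proof -
  obtain S where S: "finite S" "gspan S = P" using assms by (auto simp: fg_def)
  have SP: "S \<subseteq> P" using S gspan_superset by blast
  then have SG: "bapp ` S \<subseteq> G" using assms(2) by (auto simp: perms_of_def)
  have P: "subgrp P" using fg_subgrp[OF assms(1)] .
  have inc: "generate (sub_grp A G) (bapp ` S) \<subseteq> G"
    using group.generate_incl[OF group_sub_grp, of "bapp ` S"] SG by simp
  have "perms_of (generate (sub_grp A G) (bapp ` S)) = P"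
    using perms_of_generate[OF SG] S(2) by (simp add: perms_of_bapp_image)
  then have "generate (sub_grp A G) (bapp ` S) = bapp ` P"
    using bapp_perms_of[OF inc] by simp
  then show ?thesis unfolding fin_gen_def using S(1) SP by (intro exI[of _ "bapp ` S"]) auto
qed

end

subsection \<open>Torsion\<close>

primrec gmult :: "nat \<Rightarrow> 'g::group_add \<Rightarrow> 'g" where
  "gmult 0 g = 0"
| "gmult (Suc n) g = g + gmult n g"

lemma gmult_add: "gmult (m + n) g = gmult m g + gmult n g"
  by (induction m) (simp_all add: add.assoc)

lemma gmult_commute: "gmult m g + gmult n g = gmult n g + gmult m g"
  by (metis gmult_add add.commute)

lemma gmult_diff_commute: "- gmult m g + gmult n g = gmult n g - gmult m g"
proof -
  have "gconj (gmult m g) (gmult n g) = gmult n g"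
    by (simp add: gconj_eq_self_iff gmult_commute)
  then have "gconj (- gmult m g) (gmult n g) = gmult n g" by (metis gconj_minus_cancel(1))
  then show ?thesis by (simp add: gconj_eq_self_iff)
qed

lemma gmult_in_subgrp: "subgrp S \<Longrightarrow> g \<in> S \<Longrightarrow> gmult n g \<in> S"
  by (induction n) (simp_all add: subgrp_closed)

lemma gmult_gmult: "gmult i (gmult q g) = gmult (q * i) g"
  by (induction i) (simp_all add: gmult_add[symmetric])

text \<open>Integer multiples of \<open>gmult q g\<close> are expressed as differences of natural
  multiples of \<open>g\<close> whose coefficients are divisible by \<open>q\<close>.\<close>

lemma gspan_singleton_gmult:
  assumes "x \<in> gspan {gmult q g}"
  obtains i j where "x = gmult (q * i) g - gmult (q * j) g"
proof -
  let ?X = "{gmult (q * i) g - gmult (q * j) g | i j. True}"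
  have "gspan {gmult q g} \<subseteq> ?X"
  proof (rule gspan_right_closed)
    have "0 = gmult (q * 0) g - gmult (q * 0) g" by simp
    then show "0 \<in> ?X" by blast
    fix x s assume "x \<in> ?X" and s: "s \<in> {gmult q g}"
    then obtain i j where x: "x = gmult (q * i) g - gmult (q * j) g" by blast
    have "x + gmult q g = gmult (q * i) g + (- gmult (q * j) g + gmult q g)"
      by (simp add: x gassoc del: add_uminus_conv_diff)
    also have "\<dots> = gmult (q * i) g + gmult q g - gmult (q * j) g"
      by (simp only: gmult_diff_commute add_diff_eq)
    also have "\<dots> = gmult (q * (i + 1)) g - gmult (q * j) g"
      by (simp add: gmult_add distrib_left gmult_commute[of "q * i"])
    finally have 1: "x + gmult q g = gmult (q * (i + 1)) g - gmult (q * j) g" .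
    have "x - gmult q g = gmult (q * i) g - gmult (q * (j + 1)) g"
      by (simp add: x gmult_add distrib_left gassoc del: add_uminus_conv_diff)
    then show "x + s \<in> ?X \<and> x - s \<in> ?X" using 1 s by blast
  qed
  then show thesis using assms that by blast
qed

lemma finite_gspan_if_torsion:
  assumes "0 < k" "gmult k g = 0"
  shows "finite (gspan {g})"
proof -
  have per: "gmult (k * i) g = 0" for i
    using assms(2) by (induction i) (simp_all add: gmult_add)
  have "gmult n g \<in> (\<lambda>i. gmult i g) ` {..<k}" for n
  proof -
    have "gmult n g = gmult (k * (n div k) + n mod k) g" by simp
    also have "\<dots> = gmult (n mod k) g" unfolding gmult_add per by simp
    finally show ?thesis using assms(1) by auto
  qed
  moreover have "gspan {g} \<subseteq> range (\<lambda>i. gmult i g)"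
  proof (rule gspan_right_closed)
    show "0 \<in> range (\<lambda>i. gmult i g)" by (rule range_eqI[of _ _ 0]) simp
    fix x s assume "x \<in> range (\<lambda>i. gmult i g)" and s: "s \<in> {g}"
    then obtain i where x: "x = gmult i g" by blast
    have g1: "gmult 1 g = g" by simp
    have "x + g = gmult (i + 1) g" using x by (simp only: gmult_add g1)
    \<comment> \<open>One step backwards is \<open>k - 1\<close> steps forwards.\<close>
    moreover have "x - g = gmult (i + (k - 1)) g"
    proof -
      have "gmult (i + (k - 1)) g + g = gmult (i + (k - 1) + 1) g" by (simp only: gmult_add g1)
      also have "i + (k - 1) + 1 = i + k" using assms(1) by simp
      also have "gmult (i + k) g = x" by (simp add: gmult_add assms(2) x)
      finally show ?thesis by (metis add_diff_cancel)
    qed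
    ultimately show "x + s \<in> range (\<lambda>i. gmult i g) \<and> x - s \<in> range (\<lambda>i. gmult i g)"
      using s by (metis rangeI singletonD)
  qed
  ultimately have "gspan {g} \<subseteq> (\<lambda>i. gmult i g) ` {..<k}" by blast
  then show ?thesis by (rule finite_subset) simp
qed

lemma bapp_gmult: "bapp (gmult n p) = bapp p ^^ n"
  by (induction n) (simp_all add: bapp_zero bapp_plus id_def)

lemma tree_aut_funpow: "g \<in> tree_aut A \<Longrightarrow> g ^^ n \<in> tree_aut A"
  by (induction n) (simp_all add: tree_aut_id[unfolded id_def] tree_aut_comp id_def)

lemma funpow_fixed: "h w = w \<Longrightarrow> (h ^^ n) w = w"
  by (induction n) simp_all

text \<open>Induction on the level: once a power \<open>h\<close> of \<open>g\<close> fixes the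
  parent \<open>u\<close>, it permutes the \<open>card A\<close> children of \<open>u\<close>, so
  each child has a period of at most \<open>card A\<close>, which divides the factorial.\<close>

lemma level_power:
  assumes A: "finite A" and g: "g \<in> tree_aut A"
  shows "w \<in> words_len A n \<Longrightarrow> (g ^^ (fact (card A) ^ n)) w = w"
proof (induction n arbitrary: w)
  case 0
  then have "w = []" by (simp add: words_len_def)
  have "length (g []) = 0" using tree_aut_length[OF g, of "[]"] by simp
  then show ?case using \<open>w = []\<close> by simp
next
  case (Suc n)
  then obtain u x where w: "w = u @ [x]" and u: "u \<in> words_len A n" "x \<in> A" "u \<in> lists A"
    by (cases w rule: rev_cases) (auto simp: words_len_def)
  have wl: "w \<in> lists A" using w u by simp
  define h where "h = g ^^ (fact (card A) ^ n)"
  have h: "h \<in> tree_aut A" "h u = u" unfolding h_def using tree_aut_funpow[OF g] Suc.IH[OF u(1)] by auto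
  have "(h ^^ i) w \<in> (\<lambda>a. u @ [a]) ` A" for i
  proof -
    have hi: "h ^^ i \<in> tree_aut A" "(h ^^ i) u = u" using h tree_aut_funpow funpow_fixed by metis+
    let ?v = "tsection A (h ^^ i) u [x]"
    have eq: "(h ^^ i) w = u @ ?v"
      using tree_aut_append[OF hi(1) u(3), of "[x]"] u(2) hi(2) w by simp
    have "length ?v = 1" using tree_aut_length[OF hi(1) wl] eq w by simp
    moreover have "?v \<in> lists A" using tsection_lists[OF hi(1) u(3)] u(2) by simp
    ultimately obtain a where "?v = [a]" "a \<in> A" by (cases ?v) auto
    then show ?thesis using eq by simp
  qed
  \<comment> \<open>The \<open>card A + 1\<close> exponents up to \<open>card A\<close> reach at
    most \<open>card A\<close> children, so two powers of \<open>h\<close> agree on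
    \<open>w\<close>.\<close>
  then have sub: "(\<lambda>i. (h ^^ i) w) ` {..card A} \<subseteq> (\<lambda>a. u @ [a]) ` A" by blast
  have "card ((\<lambda>i. (h ^^ i) w) ` {..card A}) \<le> card ((\<lambda>a. u @ [a]) ` A)"
    using sub A by (intro card_mono) auto
  also have "\<dots> \<le> card A" using A by (rule card_image_le)
  finally have "\<not> inj_on (\<lambda>i. (h ^^ i) w) {..card A}" using card_image by fastforce
  then obtain i j where ij: "i < j" "j \<le> card A" "(h ^^ i) w = (h ^^ j) w"
    unfolding inj_on_def by (metis atMost_iff linorder_neqE_nat)
  have "(h ^^ i) ((h ^^ (j - i)) w) = (h ^^ i) w"
  proof -
    have "(h ^^ j) w = (h ^^ i) ((h ^^ (j - i)) w)"
      using ij(1) by (metis add_diff_inverse_nat comp_apply funpow_add less_imp_not_less)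
    then show ?thesis using ij(3) by simp
  qed
  then have fixw: "(h ^^ (j - i)) w = w"
    using bij_is_inj[OF tree_aut_bij[OF tree_aut_funpow[OF h(1), of i]]] by (simp add: inj_eq)
  have "(j - i) dvd fact (card A)" using ij by (intro dvd_fact) auto
  then obtain d where d: "fact (card A) = (j - i) * d" by (rule dvdE)
  have "((h ^^ (j - i)) ^^ d) w = w" by (rule funpow_fixed[of "h ^^ (j - i)" w d, OF fixw])
  then have "(h ^^ fact (card A)) w = w" by (simp add: funpow_mult d)
  then show ?case unfolding h_def by (simp add: funpow_mult mult.commute)
qed

context aut_subgroup
begin

lemma level_stab_iff:
  "p \<in> perms_of (level_stab A G n) \<longleftrightarrow> p \<in> perms_of G \<and> (\<forall>w\<in>words_len A n. bapp p w = w)"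
  by (simp add: perms_of_iff level_stab_def stab_set_def)

lemma approximation:
  assumes wa: "well_approximated A G" and H: "fg H" "H \<subseteq> perms_of G"
    and x: "\<And>n. \<exists>h\<in>H. \<exists>s\<in>perms_of (level_stab A G n). x = h + s"
  shows "x \<in> H"
proof -
  have sub: "subgroup (bapp ` H) (sub_grp A G)"
    by (rule subgroup_bapp_image[OF fg_subgrp[OF H(1)] H(2)])
  have eq: "(\<Inter>n. (bapp ` H) <#>\<^bsub>sub_grp A G\<^esub> level_stab A G n) = bapp ` H"
    using wa sub fin_gen_if_fg[OF H] by (simp add: well_approximated_def)
  have "bapp x \<in> (bapp ` H) <#>\<^bsub>sub_grp A G\<^esub> level_stab A G n" for n
  proof -
    obtain h s where "h \<in> H" "s \<in> perms_of (level_stab A G n)" "x = h + s" using x by blast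
    then have "bapp x = bapp h \<circ> bapp s" "bapp h \<in> bapp ` H" "bapp s \<in> level_stab A G n"
      by (simp_all add: bapp_plus perms_of_iff)
    then show ?thesis unfolding set_mult_def by force
  qed
  then have "bapp x \<in> (\<Inter>n. (bapp ` H) <#>\<^bsub>sub_grp A G\<^esub> level_stab A G n)" by (rule INT_I)
  then have "bapp x \<in> bapp ` H" by (simp only: eq)
  then show ?thesis by (auto simp: bapp_inject)
qed

text \<open>The order of \<open>g\<close> modulo a level stabilizer divides a power of \<open>|A|!\<close>, hence is coprime to
  \<open>q = |A|! + 1\<close>. So the closure of the subgroup generated by \<open>q g\<close> contains \<open>g\<close>, and
  well-approximation puts \<open>g\<close> into that subgroup itself.\<close>

lemma torsion_if_well_approximated:
  assumes A: "finite A" and wa: "well_approximated A G" and g: "g \<in> perms_of G"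
  shows "finite (gspan {g})"
proof -
  define q :: nat where "q = fact (card A) + 1"
  have q: "1 < q" by (simp add: q_def)
  have "coprime q (fact (card A))" unfolding q_def by (rule coprime_add_one_left)
  then have cop: "coprime q (fact (card A) ^ n)" for n by simp
  let ?H = "gspan {gmult q g}"
  have gq: "gmult q g \<in> perms_of G" using gmult_in_subgrp[OF subgrp_G g] .
  have "g \<in> ?H"
  proof (rule approximation[OF wa])
    show "fg ?H" unfolding fg_def by (intro exI[of _ "{gmult q g}"]) simp
    show "?H \<subseteq> perms_of G" using gq by (intro gspan_least[OF subgrp_G]) simp
    fix n
    let ?e = "fact (card A) ^ n"
    have "q \<noteq> 0" using q by simp
    then obtain a b where ab: "q * a = ?e * b + 1"
      using bezout_nat[of q ?e] cop[of n] by (auto simp only: coprime_iff_gcd_eq_1)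
    let ?s = "- gmult (?e * b) g"
    \<comment> \<open>By Bezout, \<open>g\<close> is a multiple of \<open>gmult q g\<close> minus
      the multiple with coefficient \<open>?e * b\<close>, which acts trivially on level
      \<open>n\<close> by \<open>level_power\<close>.\<close>
    have "gmult (q * a) g = gmult (1 + ?e * b) g" using ab by simp
    then have "g + gmult (?e * b) g = gmult (q * a) g" by (simp add: gmult_add)
    then have "g = gmult (q * a) g + ?s" by (metis add_diff_cancel add_uminus_conv_diff)
    moreover have "gmult (q * a) g \<in> ?H"
      using gmult_in_subgrp[OF gspan_subgrp, of "gmult q g" "{gmult q g}" a] gspan_superset[of "{gmult q g}"]
      by (simp add: gmult_gmult)
    moreover have "?s \<in> perms_of (level_stab A G n)"
    proof -
      have gt: "bapp g \<in> tree_aut A" using g G_aut by (auto simp: perms_of_iff)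
      have "bapp ?s w = w" if w: "w \<in> words_len A n" for w
      proof -
        have "bapp (gmult (?e * b) g) w = w"
          using funpow_fixed[of "bapp g ^^ ?e" w b, OF level_power[OF A gt w]]
          by (simp add: bapp_gmult funpow_mult)
        then show ?thesis
          by (metis bapp_uminus bij_bapp bij_is_inj inv_f_f)
      qed
      moreover have "?s \<in> perms_of G"
        by (rule subgrp_uminus[OF subgrp_G gmult_in_subgrp[OF subgrp_G g]])
      ultimately show ?thesis by (simp add: level_stab_iff)
    qed
    ultimately show "\<exists>h\<in>?H. \<exists>s\<in>perms_of (level_stab A G n). g = h + s" by blast
  qed
  then obtain i j where "g = gmult (q * i) g - gmult (q * j) g" by (rule gspan_singleton_gmult)
  then have eq: "gmult (1 + q * j) g = gmult (q * i) g" by (simp add: gmult_add eq_diff_eq)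
  \<comment> \<open>The two coefficients differ modulo \<open>q > 1\<close>, so two distinct
    multiples of \<open>g\<close> coincide and \<open>g\<close> has finite order.\<close>
  have ne: "1 + q * j \<noteq> q * i"
  proof
    assume "1 + q * j = q * i"
    then have "q dvd 1" by (metis dvd_add_left_iff dvd_triv_left)
    then show False using q by simp
  qed
  have "\<exists>k>0. gmult k g = 0"
  proof -
    have "gmult (n - m) g = 0" if "m < n" "gmult m g = gmult n g" for m n
    proof -
      have "gmult n g = gmult m g + gmult (n - m) g" using that(1) by (simp add: gmult_add[symmetric])
      then show ?thesis using that(2) by (metis add.right_neutral add_left_imp_eq)
    qed
    then show ?thesis using eq ne by (metis linorder_neqE_nat zero_less_diff)
  qed
  then show ?thesis using finite_gspan_if_torsion by blast
qed

section \<open>Stabilizers of sets of words and of levels\<close>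

lemma stab_set_subgrp: "subgrp (perms_of (stab_set G Z))"
proof (rule subgrpI)
  show "0 \<in> perms_of (stab_set G Z)"
    using subgrp_zero[OF subgrp_G] by (simp add: perms_of_iff stab_set_def bapp_zero)
  show "p + q \<in> perms_of (stab_set G Z)"
    if "p \<in> perms_of (stab_set G Z)" "q \<in> perms_of (stab_set G Z)" for p q
    using that subgrp_add[OF subgrp_G] by (simp add: perms_of_iff stab_set_def bapp_plus)
  show "- p \<in> perms_of (stab_set G Z)" if p: "p \<in> perms_of (stab_set G Z)" for p
  proof -
    have "bapp (- p) z = z" if "z \<in> Z" for z
    proof -
      have "bapp p z = z" using p that by (simp add: perms_of_iff stab_set_def)
      moreover have "bapp (- p) (bapp p z) = z"
        by (simp add: bapp_uminus inv_f_f[OF bij_is_inj[OF bij_bapp]])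
      ultimately show ?thesis by simp
    qed
    then show ?thesis using p subgrp_uminus[OF subgrp_G, of p] by (simp add: perms_of_iff stab_set_def)
  qed
qed

text \<open>An element is labelled by the images of \<open>Z\<close> under its inverse, which are
  words of unchanged lengths. The inverse is used because \<open>a - b\<close> fixes
  \<open>z\<close> exactly if \<open>- a\<close> and \<open>- b\<close> agree at
  \<open>z\<close>.\<close>

lemma stab_set_finite_index:
  assumes A: "finite A" and Z: "finite Z" "Z \<subseteq> lists A"
  shows "almost_sub (perms_of G) (perms_of (stab_set G Z))"
proof (rule almost_subI[where c = "\<lambda>p. restrict (bapp (- p)) Z"])
  have "(\<lambda>p. restrict (bapp (- p)) Z) ` perms_of G \<subseteq> (\<Pi>\<^sub>E z\<in>Z. words_len A (length z))"
  proof
    fix f assume "f \<in> (\<lambda>p. restrict (bapp (- p)) Z) ` perms_of G"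
    then obtain p where p: "p \<in> perms_of G" "f = restrict (bapp (- p)) Z" by blast
    have p': "bapp (- p) \<in> tree_aut A"
      using subgrp_uminus[OF subgrp_G p(1)] G_aut by (auto simp: perms_of_iff)
    have "bapp (- p) z \<in> words_len A (length z)" if "z \<in> Z" for z
    proof -
      have "z \<in> lists A" using that Z(2) by blast
      then show ?thesis using tree_aut_length[OF p'] tree_aut_lists[OF p'] by (simp add: words_len_def)
    qed
    then show "f \<in> (\<Pi>\<^sub>E z\<in>Z. words_len A (length z))" using p by auto
  qed
  moreover have "finite (\<Pi>\<^sub>E z\<in>Z. words_len A (length z))"
    using Z(1) words_len_finite[OF A] by (rule finite_PiE)
  ultimately show "finite ((\<lambda>p. restrict (bapp (- p)) Z) ` perms_of G)" by (rule finite_subset)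
  fix a b assume ab: "a \<in> perms_of G" "b \<in> perms_of G" "restrict (bapp (- a)) Z = restrict (bapp (- b)) Z"
  have "bapp (a - b) z = z" if "z \<in> Z" for z
  proof -
    have "bapp (- a) z = bapp (- b) z" using ab(3) that by (metis restrict_apply)
    then have "bapp (a + - b) z = bapp (a + - a) z"
      by (simp add: bapp_plus del: add_uminus_conv_diff right_minus)
    then show ?thesis by (simp add: bapp_zero)
  qed
  then show "a - b \<in> perms_of (stab_set G Z)"
    using subgrp_diff[OF subgrp_G ab(1,2)] by (simp add: perms_of_iff stab_set_def)
qed

lemma level_stab_normal: "normalizes (perms_of G) (perms_of (level_stab A G n))"
  unfolding normalizes_def
proof (intro ballI)
  fix g s assume g: "g \<in> perms_of G" and s: "s \<in> perms_of (level_stab A G n)"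
  have sG: "s \<in> perms_of G" and sw: "\<forall>w\<in>words_len A n. bapp s w = w" using s by (auto simp: level_stab_iff)
  have g': "bapp (- g) \<in> tree_aut A"
    using subgrp_uminus[OF subgrp_G g] G_aut by (auto simp: perms_of_iff)
  have "bapp (gconj g s) w = w" if w: "w \<in> words_len A n" for w
  proof -
    have "bapp (- g) w \<in> words_len A n"
      using w tree_aut_length[OF g'] tree_aut_lists[OF g'] by (simp add: words_len_def)
    then have "bapp (g + s + - g) w = bapp (g + - g) w"
      using sw by (simp add: bapp_plus del: add_uminus_conv_diff right_minus)
    then show ?thesis by (simp add: gconj_def bapp_zero)
  qed
  then show "gconj g s \<in> perms_of (level_stab A G n)"
    using subgrp_gconj[OF subgrp_G g sG] by (simp add: level_stab_iff)
qed

text \<open>Every word of level \<open>n\<close> can be extended by a letter, and an automorphism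
  fixing a word fixes its prefixes.\<close>

lemma level_stab_antimono:
  assumes "A \<noteq> {}"
  shows "antimono (\<lambda>n. perms_of (level_stab A G n))"
proof (rule decseq_SucI, rule subsetI)
  fix n p assume p: "p \<in> perms_of (level_stab A G (Suc n))"
  then have "p \<in> perms_of G" by (simp only: level_stab_iff)
  then have pG: "bapp p \<in> tree_aut A" using G_aut by (auto simp: perms_of_iff)
  obtain a where a: "a \<in> A" using assms by blast
  have "bapp p w = w" if w: "w \<in> words_len A n" for w
  proof (rule tree_aut_fix_prefix[OF pG])
    show "w \<in> lists A" "w @ [a] \<in> lists A" "prefix w (w @ [a])" using w a by (auto simp: words_len_def)
    show "bapp p (w @ [a]) = w @ [a]" using p w a by (simp add: level_stab_iff words_len_def)
  qed
  then show "p \<in> perms_of (level_stab A G n)" using p by (simp add: level_stab_iff)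
qed

subsection \<open>The space of subgroups\<close>

lemma sub_code_inj: "K \<subseteq> G \<Longrightarrow> M \<subseteq> G \<Longrightarrow> sub_code G K = sub_code G M \<Longrightarrow> K = M"
  unfolding sub_code_def by (metis (no_types, lifting) restrict_apply subset_antisym subset_iff)

text \<open>Open sets of the product are tested on boxes restricting finitely many coordinates;
  confining the coordinates in \<open>F\<close> to the values of \<open>H\<close> amounts to
  agreement with \<open>H\<close> on \<open>F\<close>.\<close>

lemma sub_code_derived:
  assumes H: "H \<subseteq> G" and S: "\<And>K. K \<in> S \<Longrightarrow> K \<subseteq> G"
  shows "sub_code G H \<in> sub_top G derived_set_of (sub_code G ` S) \<longleftrightarrow>
    (\<forall>F. finite F \<and> F \<subseteq> G \<longrightarrow> (\<exists>K\<in>S. K \<noteq> H \<and> K \<inter> F = H \<inter> F))"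
proof
  assume d: "sub_code G H \<in> sub_top G derived_set_of (sub_code G ` S)"
  show "\<forall>F. finite F \<and> F \<subseteq> G \<longrightarrow> (\<exists>K\<in>S. K \<noteq> H \<and> K \<inter> F = H \<inter> F)"
  proof (intro allI impI)
    fix F assume F: "finite F \<and> F \<subseteq> G"
    let ?U = "\<lambda>g. if g \<in> F then {g \<in> H} else UNIV"
    have "openin (sub_top G) (Pi\<^sub>E G ?U)"
      unfolding sub_top_def openin_PiE_gen
      using F finite_subset[of "{g \<in> G. ?U g \<noteq> UNIV}" F] by auto
    moreover have "sub_code G H \<in> Pi\<^sub>E G ?U" by (auto simp: sub_code_def)
    ultimately obtain y where y: "y \<noteq> sub_code G H" "y \<in> sub_code G ` S" "y \<in> Pi\<^sub>E G ?U"
      using d unfolding in_derived_set_of by blast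
    then obtain K where K: "K \<in> S" "y = sub_code G K" by blast
    have "g \<in> K \<longleftrightarrow> g \<in> H" if "g \<in> F" for g
    proof -
      have "g \<in> G" using F that by blast
      then have "y g \<in> ?U g" using y(3) by (auto simp: PiE_iff)
      then show ?thesis using K(2) that \<open>g \<in> G\<close> by (simp add: sub_code_def)
    qed
    then have "K \<inter> F = H \<inter> F" by blast
    moreover have "K \<noteq> H" using K(2) y(1) by auto
    ultimately show "\<exists>K\<in>S. K \<noteq> H \<and> K \<inter> F = H \<inter> F" using K(1) by (intro bexI[of _ K] conjI)
  qed
next
  assume r: "\<forall>F. finite F \<and> F \<subseteq> G \<longrightarrow> (\<exists>K\<in>S. K \<noteq> H \<and> K \<inter> F = H \<inter> F)"
  show "sub_code G H \<in> sub_top G derived_set_of (sub_code G ` S)"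
    unfolding in_derived_set_of
  proof (intro conjI allI impI)
    show "sub_code G H \<in> topspace (sub_top G)" by (simp add: sub_top_def sub_code_def)
    fix T assume T: "sub_code G H \<in> T \<and> openin (sub_top G) T"
    then obtain U where U: "finite {g \<in> G. U g \<noteq> (UNIV :: bool set)}" "sub_code G H \<in> Pi\<^sub>E G U" "Pi\<^sub>E G U \<subseteq> T"
      unfolding sub_top_def openin_product_topology_alt by force
    let ?F = "{g \<in> G. U g \<noteq> UNIV}"
    obtain K where K: "K \<in> S" "K \<noteq> H" "K \<inter> ?F = H \<inter> ?F"
    proof -
      have "finite ?F \<and> ?F \<subseteq> G" using U(1) by simp
      then have "\<exists>K\<in>S. K \<noteq> H \<and> K \<inter> ?F = H \<inter> ?F" by (rule r[rule_format])
      then show thesis using that by blast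
    qed
    have "sub_code G K \<in> Pi\<^sub>E G U"
    proof
      fix g assume g: "g \<in> G"
      show "sub_code G K g \<in> U g"
      proof (cases "U g = UNIV")
        case False
        then have "g \<in> K \<longleftrightarrow> g \<in> H" using K(3) g by blast
        then have "sub_code G K g = sub_code G H g" using g by (simp add: sub_code_def)
        then show ?thesis using U(2) g by (simp add: PiE_iff)
      qed simp
    qed (simp add: sub_code_def)
    moreover have "sub_code G K \<noteq> sub_code G H" using sub_code_inj S[OF K(1)] H K(2) by blast
    ultimately show "\<exists>y\<noteq>sub_code G H. y \<in> sub_code G ` S \<and> y \<in> T" using K(1) U(3) by blast
  qed
qed

lemma cb_deriv_eq: "cb_deriv A G n = sub_code G ` {K. K \<subseteq> G \<and> perms_of K \<in> cbd (perms_of G) n}"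
proof (induction n)
  case 0
  have "{K. subgroup K (sub_grp A G)} = {K. K \<subseteq> G \<and> perms_of K \<in> cbd (perms_of G) 0}"
    using perms_of_mono by (auto simp: subgroup_iff)
  then show ?case by (simp add: Sub_space_def)
next
  case (Suc n)
  let ?S = "\<lambda>n. {K. K \<subseteq> G \<and> perms_of K \<in> cbd (perms_of G) n}"
  have eq: "(\<forall>F. finite F \<and> F \<subseteq> G \<longrightarrow> (\<exists>K\<in>?S n. K \<noteq> H \<and> K \<inter> F = H \<inter> F)) \<longleftrightarrow>
      (\<forall>F. finite F \<and> F \<subseteq> perms_of G \<longrightarrow> (\<exists>P\<in>cbd (perms_of G) n. P \<noteq> perms_of H \<and> P \<inter> F = perms_of H \<inter> F))"
    (is "?l \<longleftrightarrow> ?r") if H: "H \<subseteq> G" for H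
  proof
    assume l: ?l
    show ?r
    proof (intro allI impI)
      fix F assume F: "finite F \<and> F \<subseteq> perms_of G"
      then have "finite (bapp ` F) \<and> bapp ` F \<subseteq> G" by (auto simp: perms_of_def)
      then have "\<exists>K\<in>?S n. K \<noteq> H \<and> K \<inter> bapp ` F = H \<inter> bapp ` F" by (rule l[rule_format])
      then obtain K where K: "K \<subseteq> G" "perms_of K \<in> cbd (perms_of G) n" "K \<noteq> H" "K \<inter> bapp ` F = H \<inter> bapp ` F"
        by blast
      have "perms_of K \<noteq> perms_of H" using K(1,3) H bapp_perms_of by metis
      moreover have "perms_of K \<inter> F = perms_of H \<inter> F"
        using K(4) perms_of_Int perms_of_bapp_image by metis
      ultimately show "\<exists>P\<in>cbd (perms_of G) n. P \<noteq> perms_of H \<and> P \<inter> F = perms_of H \<inter> F"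
        using K(2) by (intro bexI[of _ "perms_of K"] conjI)
    qed
  next
    assume r: ?r
    show ?l
    proof (intro allI impI)
      fix F assume F: "finite F \<and> F \<subseteq> G"
      have "finite (perms_of F)" using finite_perms_of[of F] F G_bij by blast
      moreover have "perms_of F \<subseteq> perms_of G" using F perms_of_mono by blast
      ultimately obtain P where P: "P \<in> cbd (perms_of G) n" "P \<noteq> perms_of H" "P \<inter> perms_of F = perms_of H \<inter> perms_of F"
        using r[rule_format, of "perms_of F"] by blast
      have PG: "bapp ` P \<subseteq> G" using cbd_subgrp[OF P(1)] by (auto simp: perms_of_def)
      have "perms_of (bapp ` P \<inter> F) = perms_of (H \<inter> F)"
        using P(3) by (simp add: perms_of_Int perms_of_bapp_image)
      then have "bapp ` P \<inter> F = H \<inter> F" using bapp_perms_of H PG by (metis le_infI1)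
      moreover have "bapp ` P \<noteq> H" using P(2) perms_of_bapp_image by blast
      moreover have "bapp ` P \<in> ?S n" using PG P(1) by (simp add: perms_of_bapp_image)
      ultimately show "\<exists>K\<in>?S n. K \<noteq> H \<and> K \<inter> F = H \<inter> F" by (intro bexI[of _ "bapp ` P"] conjI)
    qed
  qed
  show ?case
  proof (rule Set.set_eqI)
    fix x
    have "x \<in> cb_deriv A G (Suc n) \<longleftrightarrow>
        (\<exists>H\<in>?S n. x = sub_code G H \<and> sub_code G H \<in> sub_top G derived_set_of (sub_code G ` ?S n))"
      using Suc.IH by auto
    also have "\<dots> \<longleftrightarrow> (\<exists>H\<in>?S n. x = sub_code G H \<and> H \<in> ?S (Suc n))"
    proof (rule bex_cong[OF refl])
      fix H assume H: "H \<in> ?S n"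
      then have HG: "H \<subseteq> G" by blast
      have "sub_code G H \<in> sub_top G derived_set_of (sub_code G ` ?S n) \<longleftrightarrow>
          (\<forall>F. finite F \<and> F \<subseteq> G \<longrightarrow> (\<exists>K\<in>?S n. K \<noteq> H \<and> K \<inter> F = H \<inter> F))"
        by (rule sub_code_derived[OF HG]) blast
      also have "\<dots> \<longleftrightarrow> H \<in> ?S (Suc n)" unfolding eq[OF HG] using H by simp
      finally show "(x = sub_code G H \<and> sub_code G H \<in> sub_top G derived_set_of (sub_code G ` ?S n))
          = (x = sub_code G H \<and> H \<in> ?S (Suc n))" by simp
    qed
    also have "\<dots> \<longleftrightarrow> x \<in> sub_code G ` ?S (Suc n)" by auto
    finally show "x \<in> cb_deriv A G (Suc n) \<longleftrightarrow> x \<in> sub_code G ` ?S (Suc n)" .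
  qed
qed

lemma sub_code_mem_cb_deriv:
  assumes "H \<subseteq> G"
  shows "sub_code G H \<in> cb_deriv A G n \<longleftrightarrow> perms_of H \<in> cbd (perms_of G) n"
  unfolding cb_deriv_eq using assms sub_code_inj by blast

lemma inf_chain_iff:
  assumes "H \<subseteq> G"
  shows "inf_chain (perms_of G) n (perms_of H) \<longleftrightarrow> (\<exists>c :: nat \<Rightarrow> 'a tfun set.
      c 0 = G \<and> c n = H \<and> (\<forall>i\<le>n. subgroup (c i) (sub_grp A G)) \<and>
      (\<forall>i<n. c (Suc i) \<subset> c i \<and> infinite_index A (c i) (c (Suc i))))" (is "?l \<longleftrightarrow> ?r")
proof
  assume ?r
  then obtain c where c: "c 0 = G" "c n = H" "\<forall>i\<le>n. subgroup (c i) (sub_grp A G)"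
    "\<forall>i<n. c (Suc i) \<subset> c i \<and> infinite_index A (c i) (c (Suc i))" by (elim exE conjE)
  have sub: "c i \<subseteq> G" if "i \<le> n" for i using c(3) that subgroup_iff by blast
  show ?l unfolding inf_chain_def
  proof (intro exI[of _ "\<lambda>i. perms_of (c i)"] conjI allI impI)
    fix i assume i: "i \<le> n"
    show "subgrp (perms_of (c i))" using c(3) i subgroup_iff by blast
    show "perms_of (c i) \<subseteq> perms_of G" by (rule perms_of_mono[OF sub[OF i]])
  next
    fix i assume i: "i < n"
    have ci: "c (Suc i) \<subset> c i" "infinite_index A (c i) (c (Suc i))" using c(4) i by blast+
    have "perms_of (c (Suc i)) \<noteq> perms_of (c i)"
      using ci(1) bapp_perms_of[OF sub[of i]] bapp_perms_of[OF sub[of "Suc i"]] i by auto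
    then show "perms_of (c (Suc i)) \<subset> perms_of (c i)" using perms_of_mono[of "c (Suc i)" "c i"] ci(1) by blast
    show "\<not> almost_sub (perms_of (c i)) (perms_of (c (Suc i)))"
      using ci(2) finite_rcosets_iff[of "c (Suc i)" "c i"] c(3) sub[of i] i by (simp add: infinite_index_def)
  qed (simp_all only: c(1,2))
next
  assume ?l
  then obtain c where c: "c 0 = perms_of G" "c n = perms_of H" "\<forall>i\<le>n. subgrp (c i) \<and> c i \<subseteq> perms_of G"
    "\<forall>i<n. c (Suc i) \<subset> c i \<and> \<not> almost_sub (c i) (c (Suc i))" unfolding inf_chain_def by (elim exE conjE)
  have sg: "subgroup (bapp ` c i) (sub_grp A G)" if "i \<le> n" for i
    using c(3) that subgroup_bapp_image by blast
  show ?r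
  proof (intro exI[of _ "\<lambda>i. bapp ` c i"] conjI allI impI)
    show "bapp ` c 0 = G" "bapp ` c n = H"
      using bapp_perms_of[OF order_refl] bapp_perms_of[OF assms] by (simp_all only: c(1,2))
    fix i assume i: "i < n"
    have ci: "c (Suc i) \<subset> c i" "\<not> almost_sub (c i) (c (Suc i))" using c(4) i by blast+
    have "bapp ` c (Suc i) \<noteq> bapp ` c i" using ci(1) perms_of_bapp_image by (metis less_irrefl)
    then show "bapp ` c (Suc i) \<subset> bapp ` c i" using ci(1) by blast
    have "bapp ` c i \<subseteq> G" using sg[of i] i subgroup_iff by simp
    then show "infinite_index A (bapp ` c i) (bapp ` c (Suc i))"
      using ci(2) finite_rcosets_iff[of "bapp ` c (Suc i)" "bapp ` c i"] sg[of "Suc i"] i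
      by (simp add: infinite_index_def perms_of_bapp_image)
  qed (use sg in blast)
qed

end

section \<open>The hypotheses in the abstract setting\<close>

lemma tree_aut_empty: "tree_aut {} \<subseteq> {id}"
proof
  fix g :: "'a tfun" assume g: "g \<in> tree_aut {}"
  have "g w = w" for w
    using tree_aut_fix[OF g, of w] tree_aut_length[OF g, of w] by (cases "w = []") auto
  then show "g \<in> {id}" by auto
qed

context aut_subgroup
begin

lemma ji_group_perms_of:
  assumes "finite A" "fin_gen A G G" "just_infinite A G" "well_approximated A G"
  shows "ji_group (perms_of G)"
proof
  show "subgrp (perms_of G)" by (rule subgrp_G)
  show "fg (perms_of G)" by (rule fg_if_fin_gen[OF assms(2) order_refl])
  show "infinite (perms_of G)"
    using assms(3) finite_perms_of[of G] G_bij by (auto simp: just_infinite_def)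
  show "almost_sub (perms_of G) N"
    if N: "subgrp N" "N \<subseteq> perms_of G" "normalizes (perms_of G) N" "N \<noteq> {0}" for N
  proof -
    have "bapp ` N \<noteq> {id}"
    proof
      assume "bapp ` N = {id}"
      then have "bapp ` N = bapp ` {0}" by (simp add: bapp_zero)
      then show False using N(4) perms_of_bapp_image by metis
    qed
    then have "finite (rcosets\<^bsub>sub_grp A G\<^esub> (bapp ` N))"
      using assms(3) normal_bapp_image[OF N(1-3)] by (simp add: just_infinite_def)
    then show ?thesis
      using finite_rcosets_iff[OF subgroup_bapp_image[OF N(1,2)] order_refl]
      by (simp add: perms_of_bapp_image)
  qed
  show "finite (gspan {g})" if "g \<in> perms_of G" for g
    by (rule torsion_if_well_approximated[OF assms(1,4) that])
qed

text \<open>Lengthened by \<open>N\<close> letters, \<open>w\<close> acquires a leaf as prefix. So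
  \<open>w\<close> lies below that leaf, where the section is trivial, or is a prefix of it, and
  prefixes of fixed words are fixed.\<close>

lemma sections_faithful:
  assumes ne: "A \<noteq> {}" and Y: "leaf_set A Y" "spanning A Y"
    and g: "g \<in> tree_aut A" "\<forall>y\<in>Y. g y = y" "\<forall>y\<in>Y. tsection A g y = id"
  shows "g = id"
proof
  fix w
  obtain a where a: "a \<in> A" using ne by blast
  obtain N where N: "\<forall>w\<in>lists A. length w \<ge> N \<longrightarrow> (\<exists>y\<in>Y. prefix y w)"
    using Y(2) by (auto simp: spanning_def)
  show "g w = id w"
  proof (cases "w \<in> lists A")
    case True
    let ?v = "w @ replicate N a"
    have "?v \<in> lists A" using True a by (auto simp: in_lists_conv_set)
    then obtain y where y: "y \<in> Y" "prefix y ?v" using bspec[OF N, of ?v] by auto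
    have yl: "y \<in> lists A" using y Y(1) by (auto simp: leaf_set_def)
    have "prefix w ?v" by simp
    then consider "prefix y w" | "prefix w y" using prefix_same_cases[OF y(2)] by blast
    then show ?thesis
    proof cases
      case 1
      then obtain v where v: "w = y @ v" by (auto elim: prefixE)
      then have "v \<in> lists A" using True by simp
      then show ?thesis using tree_aut_append[OF g(1) yl, of v] g(2,3) y(1) v by simp
    next
      case 2
      then show ?thesis using tree_aut_fix_prefix[OF g(1) True yl 2] g(2) y(1) by simp
    qed
  next
    case False
    then show ?thesis using tree_aut_fix[OF g(1)] by simp
  qed
qed

end

text \<open>Rank \<open>n\<close> is expressed as membership in the derivative of order
  \<open>n\<close> but not in the next one. As \<open>n\<close> is a natural number, finiteness of
  the rank is part of the conclusion, and finite stages of the derivative suffice to state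
  it.\<close>

theorem theorem4p6:
  fixes A :: "'a set" and G H :: "'a tfun set" and Y :: "'a list set"
  assumes "finite A"
    and "is_subgroup_of_aut A G"
    and "fin_gen A G G"
    and "just_infinite A G"
    and "strongly_self_replicating A G"
    and "well_approximated A G"
    and "leaf_set A Y" and "spanning A Y"
    and "subgroup H (sub_grp A G)"
    and "infra_direct A G H Y"
  shows "\<exists>n::nat. depth A G H = enat n \<and>
           sub_code G H \<in> cb_deriv A G n \<and> sub_code G H \<notin> cb_deriv A G (Suc n)"
proof -
  interpret aut_subgroup A G by unfold_locales (rule assms(2))
  have inf: "infinite G" using assms(4) by (simp add: just_infinite_def)
  have ne: "A \<noteq> {}"
  proof
    assume "A = {}"
    then have "G \<subseteq> {id}" using order_trans[OF G_aut] tree_aut_empty by simp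
    then show False using inf finite_subset[of G "{id}"] by simp
  qed
  have ss: "self_similar A G" using assms(5) by (simp add: strongly_self_replicating_def)
  have Y: "finite Y" "Y \<subseteq> lists A" using assms(7) by (auto simp: leaf_set_def)
  have H: "H \<subseteq> G" "subgrp (perms_of H)" using assms(9) subgroup_iff by blast+
  define L where "L = perms_of (stab_set G Y)"
  \<comment> \<open>\<open>Bperm\<close> is meaningful only for bijections; for elements of
    \<open>L\<close> the section is one, since self-similarity puts it into
    \<open>G\<close>.\<close>
  define psi where "psi y p = Bperm (tsection A (bapp p) y)" for y and p :: "'a list bperm"
  have LD: "bapp p \<in> G" "bapp p \<in> tree_aut A" "\<forall>y\<in>Y. bapp p y = y" if "p \<in> L" for p
    using that G_aut by (auto simp: L_def perms_of_iff stab_set_def)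
  have sec: "tsection A (bapp p) y \<in> G" if "p \<in> L" "y \<in> Y" for p y
    using tsection_self_similar[OF ss G_aut LD(1)[OF that(1)]] that(2) Y(2) by blast
  have bpsi: "bapp (psi y p) = tsection A (bapp p) y" if "p \<in> L" "y \<in> Y" for p y
    unfolding psi_def by (rule bapp_Bperm[OF G_bij[OF sec[OF that]]])
  have L: "subgrp L" "L \<subseteq> perms_of G" "almost_sub (perms_of G) L"
    unfolding L_def using stab_set_subgrp stab_set_finite_index[OF assms(1) Y]
    by (auto simp: perms_of_iff stab_set_def)
  have hom: "hom_on L (psi y)" if y: "y \<in> Y" for y
    unfolding hom_on_def
  proof (intro ballI)
    fix p q assume p: "p \<in> L" and q: "q \<in> L"
    have "y \<in> lists A" using y Y(2) by blast
    then have "tsection A (bapp p \<circ> bapp q) y = tsection A (bapp p) y \<circ> tsection A (bapp q) y"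
      using tsection_comp[OF LD(2)[OF p] LD(2)[OF q]] LD(3)[OF q] y by blast
    then have "bapp (psi y (p + q)) = bapp (psi y p + psi y q)"
      using p q y by (simp add: bpsi subgrp_add[OF L(1)] bapp_plus)
    then show "psi y (p + q) = psi y p + psi y q" by (simp add: bapp_inject)
  qed
  have faithful: "p = 0" if p: "p \<in> L" "\<forall>y\<in>Y. psi y p = 0" for p
  proof -
    have "tsection A (bapp p) y = id" if "y \<in> Y" for y
      using bpsi[OF p(1) that] p(2) that by (simp add: bapp_zero)
    then have "bapp p = id"
      using sections_faithful[OF ne assms(7,8) LD(2,3)[OF p(1)]] by blast
    then have "bapp p = bapp 0" by (simp add: bapp_zero)
    then show ?thesis by (simp add: bapp_inject)
  qed
  have stab: "subgrp (perms_of (level_stab A G n))" "perms_of (level_stab A G n) \<subseteq> perms_of G"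
    "almost_sub (perms_of G) (perms_of (level_stab A G n))" for n
  proof -
    show "subgrp (perms_of (level_stab A G n))" unfolding level_stab_def by (rule stab_set_subgrp)
    show "perms_of (level_stab A G n) \<subseteq> perms_of G" by (auto simp: level_stab_iff)
    have "words_len A n \<subseteq> lists A" by (auto simp: words_len_def)
    then show "almost_sub (perms_of G) (perms_of (level_stab A G n))"
      unfolding level_stab_def
      by (rule stab_set_finite_index[OF assms(1) words_len_finite[OF assms(1)]])
  qed
  interpret ji_group "perms_of G" by (rule ji_group_perms_of[OF assms(1,3,4,6)])
  interpret section_family "perms_of G" L Y psi
    by unfold_locales (use L Y(1) hom faithful in \<open>auto simp: bpsi sec perms_of_iff\<close>)
  interpret approximated_family "perms_of G" L Y psi "\<lambda>n. perms_of (level_stab A G n)"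
  proof
    show "x \<in> M" if "fg M" "M \<subseteq> perms_of G"
      "\<And>n. \<exists>h\<in>M. \<exists>s\<in>perms_of (level_stab A G n). x = h + s" for M x
      by (rule approximation[OF assms(6) that])
  qed (rule stab level_stab_normal level_stab_antimono[OF ne])+
  have "infra (perms_of H)"
    unfolding infra_def
  proof (intro conjI ballI)
    show "subgrp (perms_of H)" "perms_of H \<subseteq> perms_of G" using H perms_of_mono by blast+
    fix y assume y: "y \<in> Y"
    let ?K = "(\<lambda>g. tsection A g y) ` stab_set H Y"
    have K: "subgroup ?K (sub_grp A G)" "finite (rcosets\<^bsub>sub_grp A G\<^esub> ?K)"
      using assms(10) y by (auto simp: infra_direct_def finite_index_subgroup_def)
    have "almost_sub (perms_of G) (perms_of ?K)"
      using finite_rcosets_iff[OF K(1) order_refl] K(2) by blast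
    moreover have "perms_of ?K \<subseteq> psi y ` (perms_of H \<inter> L)"
    proof
      fix p assume "p \<in> perms_of ?K"
      then obtain h where h: "h \<in> H" "\<forall>y\<in>Y. h y = y" "bapp p = tsection A h y"
        by (auto simp: perms_of_iff stab_set_def)
      have b: "bapp (Bperm h) = h" using h(1) H(1) G_bij bapp_Bperm by blast
      have hL: "Bperm h \<in> perms_of H \<inter> L"
        using h(1,2) H(1) b by (auto simp: L_def perms_of_iff stab_set_def)
      have "bapp p = bapp (psi y (Bperm h))" using bpsi[of "Bperm h" y] hL y h(3) b by simp
      then have "p = psi y (Bperm h)" by (simp add: bapp_inject)
      then show "p \<in> psi y ` (perms_of H \<inter> L)" using hL by blast
    qed
    ultimately show "almost_sub (perms_of G) (psi y ` (perms_of H \<inter> L))"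
      by (rule almost_sub_mono_right)
  qed
  then obtain n where n: "\<forall>m. inf_chain (perms_of G) m (perms_of H) \<longrightarrow> m \<le> n"
    "n = 0 \<or> inf_chain (perms_of G) n (perms_of H)"
    "perms_of H \<in> cbd (perms_of G) n" "perms_of H \<notin> cbd (perms_of G) (Suc n)"
    by (rule infra_cb_rank)
  have "depth A G H = Sup {enat m | m. inf_chain (perms_of G) m (perms_of H)}"
    unfolding depth_def inf_chain_iff[OF H(1)] ..
  also have "\<dots> = enat n"
  proof (rule antisym)
    show "Sup {enat m | m. inf_chain (perms_of G) m (perms_of H)} \<le> enat n"
      using n(1) by (intro Sup_least) auto
    \<comment> \<open>For \<open>n = 0\<close> the set of chain lengths may be empty, and its
      supremum is then 0.\<close>
    show "enat n \<le> Sup {enat m | m. inf_chain (perms_of G) m (perms_of H)}"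
      using n(2) by (auto simp: zero_enat_def[symmetric] intro: Sup_upper)
  qed
  finally show ?thesis
    using n(3,4) sub_code_mem_cb_deriv[OF H(1)] by blast
qed

end
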